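(* Suppose there are positive constants $\Lambda_1,\Lambda_0,R$ such that the nonnegative function $\alpha\in L^\infty(\mathbb{R}^3)$ satisfies $\Lambda_0\le\alpha(x)\le\Lambda_1$ for all $x\in\mathbb{R}^3\setminus B_R$. Then there exists a number $\epsilon>0$ such that every global solution $u$ of $$\partial_{tt}^2u-\Delta u+\alpha(x)\partial_tu+u=u^3,\qquad (u(0),\partial_tu(0))=(u_0,u_1),$$ on $\mathbb{R}^3$ with $(u_0,u_1)\in\mathcal{PS}^+$ and $\|(u_0,u_1)\|_{H^1\times L^2}<\epsilon$ has exponentially decaying energy: there exist constants $C,\gamma>0$ such that $E[\vec u(t)]\le Ce^{-\gamma t}$ for all $t\ge 0$.
   Context: $B_R$ is the ball of radius $R$ centered at the origin in $\mathbb{R}^3$. Solutions are real-valued and taken in the energy space, i.e. $\vec u:=(u,\partial_tu)$ takes values in $H^1(\mathbb{R}^3)\times L^2(\mathbb{R}^3)$ continuously in time; a global solution is one defined for all $t\ge0$. The energy is $$E[\vec u(t)]:=\int_{\mathbb{R}^3}\left[\frac{|\partial_tu|^2+|\nabla u|^2+u^2}{2}-\frac{u^4}{4}\right]dx,$$ and $E[(u_0,u_1)]$ is the same expression with $(u,\partial_tu)$ replaced by $(u_0,u_1)$. For $\varphi\in H^1(\mathbb{R}^3)$ let $$J[\varphi]:=\int_{\mathbb{R}^3}\left[\frac{|\nabla\varphi|^2+\varphi^2}{2}-\frac{\varphi^4}{4}\right]dx,\qquad K[\varphi]:=\int_{\mathbb{R}^3}\left(|\nabla\varphi|^2+\varphi^2-\varphi^4\right)dx,$$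 and $h_0:=\inf\{J[\varphi]:\varphi\in H^1\setminus\{0\},\ K[\varphi]=0\}$. The set $\mathcal{PS}^+$ is $$\mathcal{PS}^+:=\{(u_0,u_1)\in H^1\times L^2: E[(u_0,u_1)]<h_0,\ K[u_0]\ge0\}.$$ *)

theory Defs
  imports "HOL-Analysis.Analysis"
begin

text \<open>
  Elements of Lebesgue and Sobolev spaces are represented by functions \<open>real ^ 3 \<Rightarrow> _\<close>, considered up
  to equality almost everywhere with respect to Lebesgue measure. All integrals are Bochner
  integrals, hence 0 when the integrand is not integrable.
\<close>

type_synonym R3 = "real ^ 3"

subsection \<open>Test functions\<close>

definition partial :: "3 \<Rightarrow> (R3 \<Rightarrow> real) \<Rightarrow> R3 \<Rightarrow> real" where
  "partial i f x = frechet_derivative f (at x) (axis i 1)"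

definition laplace :: "(R3 \<Rightarrow> real) \<Rightarrow> R3 \<Rightarrow> real" where
  "laplace f x = (\<Sum>i\<in>UNIV. partial i (partial i f) x)"

text \<open>\<open>C\<^sup>\<infinity>\<close>: all iterated partial derivatives exist and are (Frechet) differentiable, hence continuous.\<close>

definition smooth :: "(R3 \<Rightarrow> real) \<Rightarrow> bool" where
  "smooth f \<longleftrightarrow> (\<forall>is. fold partial is f differentiable_on UNIV)"

definition test_functions :: "(R3 \<Rightarrow> real) set" where
  "test_functions = {\<phi>. smooth \<phi> \<and> compact (closure {x. \<phi> x \<noteq> 0})}"

subsection \<open>Function spaces\<close>

definition L2 :: "(R3 \<Rightarrow> 'b::euclidean_space) set" where
  "L2 = {f. f \<in> borel_measurable lebesgue \<and> integrable lebesgue (\<lambda>x. (norm (f x))\<^sup>2)}"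

definition L2_norm :: "(R3 \<Rightarrow> 'b::euclidean_space) \<Rightarrow> real" where
  "L2_norm f = sqrt (\<integral>x. (norm (f x))\<^sup>2 \<partial>lebesgue)"

definition Linf :: "(R3 \<Rightarrow> real) set" where
  "Linf = {f. f \<in> borel_measurable lebesgue \<and> (\<exists>c. AE x in lebesgue. \<bar>f x\<bar> \<le> c)}"

definition has_weak_gradient :: "(R3 \<Rightarrow> real) \<Rightarrow> (R3 \<Rightarrow> R3) \<Rightarrow> bool" where
  "has_weak_gradient f g \<longleftrightarrow>
     (\<forall>\<phi>\<in>test_functions. \<forall>i.
        (\<integral>x. f x * partial i \<phi> x \<partial>lebesgue) = - (\<integral>x. g x $ i * \<phi> x \<partial>lebesgue))"

definition H1 :: "(R3 \<Rightarrow> real) set" where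
  "H1 = {f \<in> L2. \<exists>g\<in>L2. has_weak_gradient f g}"

text \<open>For \<open>f \<in> H1\<close> the weak gradient is unique almost everywhere, so the choice of a representative is
  immaterial under the integral.\<close>

definition weak_gradient :: "(R3 \<Rightarrow> real) \<Rightarrow> R3 \<Rightarrow> R3" where
  "weak_gradient f = (SOME g. g \<in> L2 \<and> has_weak_gradient f g)"

definition H1_norm :: "(R3 \<Rightarrow> real) \<Rightarrow> real" where
  "H1_norm f = sqrt ((L2_norm (weak_gradient f))\<^sup>2 + (L2_norm f)\<^sup>2)"

definition energy_space_norm :: "(R3 \<Rightarrow> real) \<Rightarrow> (R3 \<Rightarrow> real) \<Rightarrow> real" where
  "energy_space_norm u0 u1 = sqrt ((H1_norm u0)\<^sup>2 + (L2_norm u1)\<^sup>2)"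

subsection \<open>Energy functionals\<close>

definition energy :: "(R3 \<Rightarrow> real) \<Rightarrow> (R3 \<Rightarrow> real) \<Rightarrow> real" where
  "energy u0 u1 =
     (\<integral>x. ((u1 x)\<^sup>2 + (norm (weak_gradient u0 x))\<^sup>2 + (u0 x)\<^sup>2) / 2 - (u0 x) ^ 4 / 4 \<partial>lebesgue)"

definition J :: "(R3 \<Rightarrow> real) \<Rightarrow> real" where
  "J \<phi> = (\<integral>x. ((norm (weak_gradient \<phi> x))\<^sup>2 + (\<phi> x)\<^sup>2) / 2 - (\<phi> x) ^ 4 / 4 \<partial>lebesgue)"

definition K :: "(R3 \<Rightarrow> real) \<Rightarrow> real" where
  "K \<phi> = (\<integral>x. (norm (weak_gradient \<phi> x))\<^sup>2 + (\<phi> x)\<^sup>2 - (\<phi> x) ^ 4 \<partial>lebesgue)"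

text \<open>The infimum is taken over a nonempty set of reals bounded below by 0, since \<open>K \<phi> = 0\<close> implies
  \<open>J \<phi> = (H1_norm \<phi>)\<^sup>2 / 4\<close>.\<close>

definition h0 :: real where
  "h0 = Inf {J \<phi> | \<phi>. \<phi> \<in> H1 \<and> \<not> (AE x in lebesgue. \<phi> x = 0) \<and> K \<phi> = 0}"

definition PS_plus :: "((R3 \<Rightarrow> real) \<times> (R3 \<Rightarrow> real)) set" where
  "PS_plus = {(u0, u1). u0 \<in> H1 \<and> u1 \<in> L2 \<and> energy u0 u1 < h0 \<and> K u0 \<ge> 0}"

subsection \<open>Global energy-space solutions\<close>

text \<open>
  A pair \<open>(u, ut)\<close> is a global solution of \<open>\<partial>\<^sub>t\<^sub>tu - \<Delta>u + \<alpha> \<partial>\<^sub>tu + u = u\<^sup>3\<close> with data \<open>(u0, u1)\<close> if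
  \<open>u \<in> C([0,\<infinity>); H1) \<inter> C\<^sup>1([0,\<infinity>); L2)\<close>, where \<open>ut\<close> is the time derivative of \<open>u\<close> in \<open>L2\<close>, and the equation
  holds in the sense of distributions: \<open>\<partial>\<^sub>t ut = \<Delta>u - \<alpha> ut - u + u\<^sup>3\<close> as distributions on \<open>R3\<close> at each
  time. As every term on the right depends continuously on \<open>t\<close> when paired with a test function, this
  is the same as the equation in the sense of space-time distributions. The filter
  \<open>at t within {0..}\<close> gives one-sided limits at \<open>t = 0\<close>.
\<close>

definition global_solution ::
  "(R3 \<Rightarrow> real) \<Rightarrow> (R3 \<Rightarrow> real) \<Rightarrow> (R3 \<Rightarrow> real) \<Rightarrow> (real \<Rightarrow> R3 \<Rightarrow> real) \<Rightarrow> (real \<Rightarrow> R3 \<Rightarrow> real) \<Rightarrow> bool"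
where
  "global_solution \<alpha> u0 u1 u ut \<longleftrightarrow>
     (\<forall>t\<ge>0. u t \<in> H1 \<and> ut t \<in> L2) \<and>
     (\<forall>t\<ge>0. ((\<lambda>s. H1_norm (\<lambda>x. u s x - u t x)) \<longlongrightarrow> 0) (at t within {0..})) \<and>
     (\<forall>t\<ge>0. ((\<lambda>s. L2_norm (\<lambda>x. ut s x - ut t x)) \<longlongrightarrow> 0) (at t within {0..})) \<and>
     (\<forall>t\<ge>0. ((\<lambda>s. L2_norm (\<lambda>x. (u s x - u t x) / (s - t) - ut t x)) \<longlongrightarrow> 0) (at t within {0..})) \<and>
     (\<forall>\<phi>\<in>test_functions. \<forall>t\<ge>0.
        ((\<lambda>s. \<integral>x. ut s x * \<phi> x \<partial>lebesgue) has_real_derivative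
           (\<integral>x. u t x * laplace \<phi> x + (- (\<alpha> x * ut t x) - u t x + (u t x) ^ 3) * \<phi> x \<partial>lebesgue))
        (at t within {0..})) \<and>
     (AE x in lebesgue. u 0 x = u0 x) \<and> (AE x in lebesgue. ut 0 x = u1 x)"

end

theory Submission
  imports Defs
begin

text \<open>
  The energy dissipates only through \<open>\<integral>\<alpha> (\<partial>\<^sub>tu)\<^sup>2\<close>, which is blind on \<open>B\<^sub>R\<close>. It is corrected by the multiplier
  functional \<open>\<integral>\<partial>\<^sub>tu (f \<bullet> \<nabla>u + q u)\<close> with \<open>\<theta> = k\<^sup>2 / (k\<^sup>2 + \<bar>x\<bar>\<^sup>2)\<close>, \<open>f = \<theta> x\<close>,
  \<open>w = 1 - \<theta> - 1 / (16 k)\<close> and \<open>q = div f / 2 + w\<close>. Its derivative contains \<open>\<integral>w (\<partial>\<^sub>tu)\<^sup>2\<close>, where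
  \<open>w\<close> is negative on \<open>B\<^sub>R\<close> for large \<open>k\<close> and can be absorbed by the damping elsewhere, minus a quadratic
  form in \<open>u\<close> and \<open>\<nabla>u\<close>. At a large scale \<open>k\<close> that form is coercive on \<open>H\<^sup>1\<close>, by a Hardy inequality,
  so no compactness or unique continuation is needed. Smallness of the data, propagated by a continuity
  argument, lets the Sobolev inequality absorb the cubic term. Hence a large multiple of the energy plus
  the multiplier functional is equivalent to the squared norm and satisfies a Gronwall inequality. A
  solution in the energy space is not regular enough for these computations, so they are made for
  its mollification in space, and the mollification is removed in the integrated inequality.
\<close>

subsection \<open>The Hilbert space of square-integrable functions\<close>

text \<open>The form of \<open>q\<close> is forced: integration by parts turns f \<bullet> grad v
  paired with v into - div f / 2, so q = div f / 2 + w leaves the weight w on the kinetic term, and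
  the same choice reduces the zero-order weights of the form in u and grad u to w. Hence w has to be
  negative on the ball, where the damping gives no control, although the same w enters the form that
  must stay positive. The two demands are reconciled at order 1 / k: on the ball 1 - \<theta> is at
  most R^2 / k^2, so subtracting 1 / (16 k) makes w at most - 1 / (32 k) for large k. The gradient
  survives this loss because the derivative of f contributes \<theta> |grad u|^2, and u^2 survives
  it because the Hardy term has the larger factor 1 / (4 k).

  Cubing does not commute with mollification. Therefore only the quadratic part of the energy and
  the multiplier functional are mollified, while the quartic part is differentiated along the
  solution itself; the two cubic contributions to the energy derivative then cancel only in the
  limit. The cross term of damping and multiplier is paid for by the dissipation, since \<alpha>^2
  \<le> B \<alpha> for an essential bound B.\<close>

lemma L2_measurable [measurable_dest]: "f \<in> L2 \<Longrightarrow> f \<in> borel_measurable lebesgue"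
  by (simp add: L2_def)

lemma L2_integrable_sq: "(f :: R3 \<Rightarrow> real) \<in> L2 \<Longrightarrow> integrable lebesgue (\<lambda>x. (f x)\<^sup>2)"
  by (simp add: L2_def)

lemma L2I: "f \<in> borel_measurable lebesgue \<Longrightarrow> integrable lebesgue (\<lambda>x. (f x)\<^sup>2) \<Longrightarrow> (f :: R3 \<Rightarrow> real) \<in> L2"
  by (simp add: L2_def)

lemma L2_dominated:
  fixes f :: "R3 \<Rightarrow> real" and g :: "R3 \<Rightarrow> real"
  assumes "g \<in> L2" "f \<in> borel_measurable lebesgue" "AE x in lebesgue. \<bar>f x\<bar> \<le> \<bar>g x\<bar>"
  shows "f \<in> L2"
proof (rule L2I[OF assms(2)])
  note [measurable] = assms(2)
  show "integrable lebesgue (\<lambda>x. (f x)\<^sup>2)"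
  proof (rule Bochner_Integration.integrable_bound[OF L2_integrable_sq[OF assms(1)]])
    show "AE x in lebesgue. norm ((f x)\<^sup>2) \<le> norm ((g x)\<^sup>2)"
      using assms(3) by eventually_elim (simp add: abs_le_square_iff)
  qed measurable
qed

lemma L2_mult_integrable:
  fixes f g :: "R3 \<Rightarrow> real"
  assumes "f \<in> L2" "g \<in> L2"
  shows "integrable lebesgue (\<lambda>x. f x * g x)"
proof -
  note [measurable] = L2_measurable[OF assms(1)] L2_measurable[OF assms(2)]
  show ?thesis
  proof (rule Bochner_Integration.integrable_bound)
    show "integrable lebesgue (\<lambda>x. (f x)\<^sup>2 + (g x)\<^sup>2)"
      using assms by (intro Bochner_Integration.integrable_add L2_integrable_sq)
    show "AE x in lebesgue. norm (f x * g x) \<le> norm ((f x)\<^sup>2 + (g x)\<^sup>2)"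
    proof (rule AE_I2)
      fix x
      have "2 * (\<bar>f x\<bar> * \<bar>g x\<bar>) \<le> (f x)\<^sup>2 + (g x)\<^sup>2"
        using sum_squares_bound[of "\<bar>f x\<bar>" "\<bar>g x\<bar>"] by (simp add: mult_ac)
      moreover have "0 \<le> \<bar>f x\<bar> * \<bar>g x\<bar>" by simp
      ultimately show "norm (f x * g x) \<le> norm ((f x)\<^sup>2 + (g x)\<^sup>2)"
        unfolding real_norm_def abs_mult by linarith
    qed
  qed measurable
qed

lemma L2_add:
  fixes f g :: "R3 \<Rightarrow> real"
  assumes "f \<in> L2" "g \<in> L2"
  shows "(\<lambda>x. f x + g x) \<in> L2"
proof (rule L2I)
  note [measurable] = L2_measurable[OF assms(1)] L2_measurable[OF assms(2)]
  show "(\<lambda>x. f x + g x) \<in> borel_measurable lebesgue" by measurable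
  have "(\<lambda>x. (f x + g x)\<^sup>2) = (\<lambda>x. (f x)\<^sup>2 + (g x)\<^sup>2 + 2 * (f x * g x))"
    by (simp add: power2_eq_square algebra_simps)
  then show "integrable lebesgue (\<lambda>x. (f x + g x)\<^sup>2)"
    using assms by (simp add: L2_integrable_sq L2_mult_integrable)
qed

lemma L2_cmult:
  fixes f :: "R3 \<Rightarrow> real"
  assumes "f \<in> L2"
  shows "(\<lambda>x. c * f x) \<in> L2"
proof (rule L2I)
  note [measurable] = L2_measurable[OF assms(1)]
  show "(\<lambda>x. c * f x) \<in> borel_measurable lebesgue" by measurable
  show "integrable lebesgue (\<lambda>x. (c * f x)\<^sup>2)"
    using L2_integrable_sq[OF assms] by (simp add: power_mult_distrib)
qed

lemma L2_diff:
  fixes f g :: "R3 \<Rightarrow> real"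
  assumes "f \<in> L2" "g \<in> L2"
  shows "(\<lambda>x. f x - g x) \<in> L2"
  using L2_add[OF assms(1) L2_cmult[OF assms(2), of "-1"]] by simp

lemma L2_uminus: "(f :: R3 \<Rightarrow> real) \<in> L2 \<Longrightarrow> (\<lambda>x. - f x) \<in> L2"
  using L2_cmult[of f "-1"] by simp

lemma L2_zero: "(\<lambda>x. 0 :: real) \<in> L2"
  by (rule L2I) simp_all

lemma L2_sum: "(\<And>i. i \<in> I \<Longrightarrow> f i \<in> L2) \<Longrightarrow> (\<lambda>x. \<Sum>i\<in>I. f i x :: real) \<in> L2"
  by (induction I rule: infinite_finite_induct) (simp_all add: L2_zero L2_add)

definition bdd_measurable :: "(R3 \<Rightarrow> real) \<Rightarrow> bool" where
  "bdd_measurable m \<longleftrightarrow> m \<in> borel_measurable lebesgue \<and> (\<exists>c. AE x in lebesgue. \<bar>m x\<bar> \<le> c)"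

lemma bdd_measurableI:
  "continuous_on UNIV m \<Longrightarrow> (\<And>x. \<bar>m x\<bar> \<le> c) \<Longrightarrow> bdd_measurable m"
  unfolding bdd_measurable_def
  by (auto intro!: exI[of _ c] AE_I2 simp: borel_measurable_continuous_onI measurable_completion)

lemma L2_bdd_mult:
  assumes "bdd_measurable m" "f \<in> L2"
  shows "(\<lambda>x. m x * f x) \<in> L2"
proof -
  obtain c where c: "AE x in lebesgue. \<bar>m x\<bar> \<le> c" and [measurable]: "m \<in> borel_measurable lebesgue"
    using assms(1) by (auto simp: bdd_measurable_def)
  note [measurable] = L2_measurable[OF assms(2)]
  show ?thesis
  proof (rule L2_dominated)
    show "(\<lambda>x. c * f x) \<in> L2" by (rule L2_cmult[OF assms(2)])
    show "AE x in lebesgue. \<bar>m x * f x\<bar> \<le> \<bar>c * f x\<bar>"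
      using c by eventually_elim (auto simp: abs_mult intro!: mult_right_mono)
  qed measurable
qed

section \<open>Square-integrable functions modulo null sets as an inner product space\<close>

definition l2rel :: "(R3 \<Rightarrow> real) \<Rightarrow> (R3 \<Rightarrow> real) \<Rightarrow> bool" where
  "l2rel f g \<longleftrightarrow> f \<in> L2 \<and> g \<in> L2 \<and> (AE x in lebesgue. f x = g x)"

lemma l2rel_part_equivp: "part_equivp l2rel"
proof (rule part_equivpI)
  show "\<exists>x. l2rel x x" by (rule exI[of _ "\<lambda>_. 0"]) (simp add: l2rel_def L2_zero)
  show "symp l2rel" by (rule sympI) (auto simp: l2rel_def eq_commute)
  show "transp l2rel"
  proof (rule transpI)
    fix x y z assume "l2rel x y" "l2rel y z"
    then have "AE t in lebesgue. x t = y t" "AE t in lebesgue. y t = z t" "x \<in> L2" "z \<in> L2"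
      by (auto simp: l2rel_def)
    moreover from this have "AE t in lebesgue. x t = z t" by (auto elim: AE_mp)
    ultimately show "l2rel x z" by (simp add: l2rel_def)
  qed
qed

\<comment> \<open>On classes the seminorm \<open>L2_norm\<close> becomes a norm, which makes
  derivatives of curves, bounded operators and limits in L2 available. The relation is partial
  because functions outside \<open>L2\<close> represent nothing. Only a \<open>real_inner\<close>
  instance is set up: every limit taken below is exhibited explicitly instead of being produced by
  completeness.\<close>
quotient_type l2 = "R3 \<Rightarrow> real" / partial: l2rel
  morphisms rep mk
  by (rule l2rel_part_equivp)

lemma rep_L2 [simp, intro]: "rep a \<in> L2"
  using Quotient3_rep_reflp[OF Quotient3_l2, of a] by (simp add: l2rel_def)

lemma mk_rep [simp]: "mk (rep a) = a"
  by (rule Quotient3_abs_rep[OF Quotient3_l2])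

lemma rep_mk_AE: "f \<in> L2 \<Longrightarrow> AE x in lebesgue. rep (mk f) x = f x"
  using rep_abs_rsp_left[OF Quotient3_l2, of f f] by (simp add: l2rel_def)

lemma mk_eq_iff: "f \<in> L2 \<Longrightarrow> g \<in> L2 \<Longrightarrow> mk f = mk g \<longleftrightarrow> (AE x in lebesgue. f x = g x)"
  using Quotient3_rel[OF Quotient3_l2, of f g] by (simp add: l2rel_def)

lemma mk_cong: "f \<in> L2 \<Longrightarrow> g \<in> L2 \<Longrightarrow> (AE x in lebesgue. f x = g x) \<Longrightarrow> mk f = mk g"
  by (simp add: mk_eq_iff)

lemma l2_eqI: "AE x in lebesgue. rep a x = rep b x \<Longrightarrow> a = b"
  using mk_eq_iff[of "rep a" "rep b"] by simp

lemma rep_measurable [measurable]: "rep a \<in> borel_measurable lebesgue"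
  by (rule L2_measurable) simp

instantiation l2 :: real_inner
begin

definition zero_l2 :: l2 where "zero_l2 = mk (\<lambda>_. 0)"
definition plus_l2 :: "l2 \<Rightarrow> l2 \<Rightarrow> l2" where "plus_l2 a b = mk (\<lambda>x. rep a x + rep b x)"
definition minus_l2 :: "l2 \<Rightarrow> l2 \<Rightarrow> l2" where "minus_l2 a b = mk (\<lambda>x. rep a x - rep b x)"
definition uminus_l2 :: "l2 \<Rightarrow> l2" where "uminus_l2 a = mk (\<lambda>x. - rep a x)"
definition scaleR_l2 :: "real \<Rightarrow> l2 \<Rightarrow> l2" where "scaleR_l2 c a = mk (\<lambda>x. c * rep a x)"
definition inner_l2 :: "l2 \<Rightarrow> l2 \<Rightarrow> real" where
  "inner_l2 a b = (\<integral>x. rep a x * rep b x \<partial>lebesgue)"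
definition norm_l2 :: "l2 \<Rightarrow> real" where "norm_l2 a = sqrt (inner a a)"
definition sgn_l2 :: "l2 \<Rightarrow> l2" where "sgn_l2 a = inverse (norm a) *\<^sub>R a"
definition dist_l2 :: "l2 \<Rightarrow> l2 \<Rightarrow> real" where "dist_l2 a b = norm (a - b)"
definition uniformity_l2 :: "(l2 \<times> l2) filter" where
  "uniformity_l2 = (INF e\<in>{0<..}. principal {(x, y). dist x y < e})"
definition open_l2 :: "l2 set \<Rightarrow> bool" where
  "open_l2 U \<longleftrightarrow> (\<forall>x\<in>U. eventually (\<lambda>(x', y). x' = x \<longrightarrow> y \<in> U) uniformity)"

lemma rep_plus: "AE x in lebesgue. rep (a + b) x = rep a x + rep b x"
  unfolding plus_l2_def by (rule rep_mk_AE) (simp add: L2_add)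

lemma rep_scaleR: "AE x in lebesgue. rep (c *\<^sub>R a) x = c * rep a x"
  unfolding scaleR_l2_def by (rule rep_mk_AE) (simp add: L2_cmult)

lemma rep_zero: "AE x in lebesgue. rep 0 x = 0"
  unfolding zero_l2_def by (rule rep_mk_AE) (simp add: L2_zero)

lemma rep_minus: "AE x in lebesgue. rep (a - b) x = rep a x - rep b x"
  unfolding minus_l2_def by (rule rep_mk_AE) (simp add: L2_diff)

lemma rep_uminus: "AE x in lebesgue. rep (- a) x = - rep a x"
  unfolding uminus_l2_def by (rule rep_mk_AE) (simp add: L2_uminus)

instance
proof
  fix a b c :: l2 and r s :: real
  show "a + b + c = a + (b + c)"
    by (rule l2_eqI, use rep_plus[of "a+b" c] rep_plus[of a b] rep_plus[of a "b+c"] rep_plus[of b c] in eventually_elim) simp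
  show "a + b = b + a"
    by (rule l2_eqI, use rep_plus[of a b] rep_plus[of b a] in eventually_elim) simp
  show "0 + a = a"
    by (rule l2_eqI, use rep_plus[of 0 a] rep_zero in eventually_elim) simp
  show "- a + a = 0"
    by (rule l2_eqI, use rep_plus[of "-a" a] rep_zero rep_uminus[of a] in eventually_elim) simp
  show "a - b = a + - b"
    by (rule l2_eqI, use rep_plus[of a "-b"] rep_minus[of a b] rep_uminus[of b] in eventually_elim) simp
  show "r *\<^sub>R (a + b) = r *\<^sub>R a + r *\<^sub>R b"
    by (rule l2_eqI, use rep_scaleR[of r "a+b"] rep_plus[of a b] rep_plus[of "r *\<^sub>R a" "r *\<^sub>R b"]
        rep_scaleR[of r a] rep_scaleR[of r b] in eventually_elim) (simp add: algebra_simps)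
  show "(r + s) *\<^sub>R a = r *\<^sub>R a + s *\<^sub>R a"
    by (rule l2_eqI, use rep_scaleR[of "r+s" "a"] rep_plus[of "r *\<^sub>R a" "s *\<^sub>R a"]
        rep_scaleR[of r a] rep_scaleR[of s a] in eventually_elim) (simp add: algebra_simps)
  show "r *\<^sub>R s *\<^sub>R a = (r * s) *\<^sub>R a"
    by (rule l2_eqI, use rep_scaleR[of "r * s" "a"] rep_scaleR[of r "s *\<^sub>R a"] rep_scaleR[of s a] in eventually_elim)
       (simp add: algebra_simps)
  show "1 *\<^sub>R a = a"
    by (rule l2_eqI, use rep_scaleR[of 1 "a"] in eventually_elim) simp
  show "dist a b = norm (a - b)" by (rule dist_l2_def)
  show "sgn a = inverse (norm a) *\<^sub>R a" by (rule sgn_l2_def)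
  show "uniformity = (INF e\<in>{0<..}. principal {(x::l2, y). dist x y < e})" by (rule uniformity_l2_def)
  show "open U \<longleftrightarrow> (\<forall>x\<in>U. eventually (\<lambda>(x', y). x' = x \<longrightarrow> y \<in> U) uniformity)" for U :: "l2 set"
    by (rule open_l2_def)
  show "inner a b = inner b a" by (simp add: inner_l2_def mult.commute)
  show "inner (a + b) c = inner a c + inner b c"
  proof -
    have "inner (a + b) c = (\<integral>x. rep a x * rep c x + rep b x * rep c x \<partial>lebesgue)"
      unfolding inner_l2_def
      by (rule integral_cong_AE) (measurable, use rep_plus[of a b] in eventually_elim, simp add: algebra_simps)
    then show ?thesis by (simp add: inner_l2_def L2_mult_integrable)
  qed
  show "inner (r *\<^sub>R a) b = r * inner a b"
  proof -
    have "inner (r *\<^sub>R a) b = (\<integral>x. r * (rep a x * rep b x) \<partial>lebesgue)"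
      unfolding inner_l2_def
      by (rule integral_cong_AE) (measurable, use rep_scaleR[of r a] in eventually_elim, simp add: algebra_simps)
    then show ?thesis by (simp add: inner_l2_def)
  qed
  show "0 \<le> inner a a" by (simp add: inner_l2_def)
  show "inner a a = 0 \<longleftrightarrow> a = 0"
  proof
    assume "inner a a = 0"
    then have ae: "AE x in lebesgue. rep a x * rep a x = 0"
      unfolding inner_l2_def
      by (subst (asm) integral_nonneg_eq_0_iff_AE) (auto simp: L2_mult_integrable)
    show "a = 0"
      by (intro l2_eqI) (use ae rep_zero in eventually_elim, simp)
  next
    assume "a = 0"
    have "(\<integral>x. rep 0 x * rep 0 x \<partial>lebesgue) = (\<integral>x. 0 \<partial>(lebesgue :: R3 measure))"
      by (rule integral_cong_AE) (measurable, use rep_zero in eventually_elim, simp)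
    then show "inner a a = 0" using \<open>a = 0\<close> by (simp add: inner_l2_def)
  qed
  show "norm a = sqrt (inner a a)" by (rule norm_l2_def)
qed

end

lemma inner_mk:
  assumes "f \<in> L2" "g \<in> L2"
  shows "mk f \<bullet> mk g = (\<integral>x. f x * g x \<partial>lebesgue)"
proof -
  note [measurable] = L2_measurable[OF assms(1)] L2_measurable[OF assms(2)]
  show ?thesis
    unfolding inner_l2_def
    by (rule integral_cong_AE) (measurable, use rep_mk_AE[OF assms(1)] rep_mk_AE[OF assms(2)] in eventually_elim, simp)
qed

lemma norm_mk_sq: "f \<in> L2 \<Longrightarrow> (norm (mk f))\<^sup>2 = (\<integral>x. (f x)\<^sup>2 \<partial>lebesgue)"
  by (simp add: power2_norm_eq_inner inner_mk) (simp add: power2_eq_square)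

lemma norm_mk: "f \<in> L2 \<Longrightarrow> norm (mk f) = L2_norm f"
  by (simp add: L2_norm_def norm_mk_sq[symmetric])

lemma mk_add:
  assumes "f \<in> L2" "g \<in> L2"
  shows "mk (\<lambda>x. f x + g x) = mk f + mk g"
  unfolding plus_l2_def
  by (subst mk_eq_iff) (simp_all add: L2_add assms,
      use rep_mk_AE[OF assms(1)] rep_mk_AE[OF assms(2)] in eventually_elim, simp)

lemma mk_diff:
  assumes "f \<in> L2" "g \<in> L2"
  shows "mk (\<lambda>x. f x - g x) = mk f - mk g"
  unfolding minus_l2_def
  by (subst mk_eq_iff) (simp_all add: L2_diff assms,
      use rep_mk_AE[OF assms(1)] rep_mk_AE[OF assms(2)] in eventually_elim, simp)

lemma mk_cmult:
  assumes "f \<in> L2"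
  shows "mk (\<lambda>x. c * f x) = c *\<^sub>R mk f"
  unfolding scaleR_l2_def
  by (rule mk_cong[OF L2_cmult[OF assms] L2_cmult[OF rep_L2]], use rep_mk_AE[OF assms(1)] in eventually_elim, simp)

lemma mk_uminus:
  assumes "f \<in> L2"
  shows "mk (\<lambda>x. - f x) = - mk f"
  unfolding uminus_l2_def
  by (rule mk_cong[OF L2_uminus[OF assms] L2_uminus[OF rep_L2]], use rep_mk_AE[OF assms(1)] in eventually_elim, simp)

lemma mk_zero: "mk (\<lambda>x. 0) = 0"
  by (simp add: zero_l2_def)

lemma mk_sum: "(\<And>i. i \<in> I \<Longrightarrow> f i \<in> L2) \<Longrightarrow> mk (\<lambda>x. \<Sum>i\<in>I. f i x) = (\<Sum>i\<in>I. mk (f i))"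
  by (induction I rule: infinite_finite_induct) (simp_all add: mk_zero mk_add L2_sum)

section \<open>Multiplication operators\<close>

definition Mul :: "(R3 \<Rightarrow> real) \<Rightarrow> l2 \<Rightarrow> l2" where
  "Mul m a = mk (\<lambda>x. m x * rep a x)"

lemma Mul_mk:
  assumes "bdd_measurable m" "f \<in> L2"
  shows "Mul m (mk f) = mk (\<lambda>x. m x * f x)"
  unfolding Mul_def
  by (rule mk_cong) (simp_all add: L2_bdd_mult assms, use rep_mk_AE[OF assms(2)] in eventually_elim, simp)

lemma bounded_linear_Mul:
  assumes "bdd_measurable m"
  shows "bounded_linear (Mul m)"
proof -
  obtain c where c: "AE x in lebesgue. \<bar>m x\<bar> \<le> c" and [measurable]: "m \<in> borel_measurable lebesgue"
    using assms(1) by (auto simp: bdd_measurable_def)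
  note L = L2_bdd_mult[OF assms]
  show ?thesis
  proof (rule bounded_linear_intro)
    show "Mul m (a + b) = Mul m a + Mul m b" for a b
    proof -
      have "Mul m (a + b) = mk (\<lambda>x. m x * rep a x + m x * rep b x)"
        unfolding Mul_def
        by (rule mk_cong) (auto intro!: L L2_add, use rep_plus[of a b] in eventually_elim, simp add: algebra_simps)
      also have "\<dots> = Mul m a + Mul m b" unfolding Mul_def by (rule mk_add) (auto intro!: L)
      finally show ?thesis .
    qed
    show "Mul m (r *\<^sub>R a) = r *\<^sub>R Mul m a" for r a
    proof -
      have "Mul m (r *\<^sub>R a) = mk (\<lambda>x. r * (m x * rep a x))"
        unfolding Mul_def
        by (rule mk_cong) (auto intro!: L L2_cmult, use rep_scaleR[of r a] in eventually_elim, simp add: algebra_simps)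
      also have "\<dots> = r *\<^sub>R Mul m a" unfolding Mul_def by (rule mk_cmult) (auto intro!: L)
      finally show ?thesis .
    qed
    show "norm (Mul m a) \<le> norm a * \<bar>c\<bar>" for a
    proof (rule power2_le_imp_le)
      have "(norm (Mul m a))\<^sup>2 = (\<integral>x. (m x * rep a x)\<^sup>2 \<partial>lebesgue)"
        unfolding Mul_def by (rule norm_mk_sq) (auto intro!: L)
      also have "\<dots> \<le> (\<integral>x. c\<^sup>2 * (rep a x)\<^sup>2 \<partial>lebesgue)"
      proof (rule integral_mono_AE)
        show "integrable lebesgue (\<lambda>x. (m x * rep a x)\<^sup>2)" by (intro L2_integrable_sq L) simp
        show "integrable lebesgue (\<lambda>x. c\<^sup>2 * (rep a x)\<^sup>2)" by (simp add: L2_integrable_sq)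
        show "AE x in lebesgue. (m x * rep a x)\<^sup>2 \<le> c\<^sup>2 * (rep a x)\<^sup>2"
          using c by eventually_elim
            (auto simp: power_mult_distrib abs_le_square_iff[symmetric] intro!: mult_right_mono)
      qed
      also have "\<dots> = (norm a * \<bar>c\<bar>)\<^sup>2"
        using norm_mk_sq[of "rep a"] by (simp add: power_mult_distrib)
      finally show "(norm (Mul m a))\<^sup>2 \<le> (norm a * \<bar>c\<bar>)\<^sup>2" .
    qed simp
  qed
qed

subsection \<open>Test functions\<close>

lemma partial_eqI: "(f has_derivative D) (at x) \<Longrightarrow> partial i f x = D (axis i 1)"
  unfolding partial_def by (metis frechet_derivative_at)

lemma has_derivative_partial:
  assumes "f differentiable (at x)"
  shows "(f has_derivative (\<lambda>h. \<Sum>i\<in>UNIV. h $ i * partial i f x)) (at x)"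
proof -
  let ?D = "frechet_derivative f (at x)"
  have D: "(f has_derivative ?D) (at x)"
    using assms by (simp add: frechet_derivative_works)
  then have lin: "linear ?D" by (rule has_derivative_linear)
  have "?D h = (\<Sum>i\<in>UNIV. h $ i * partial i f x)" for h
  proof -
    have "?D h = ?D (\<Sum>i\<in>UNIV. h $ i *\<^sub>R axis i 1)"
      by (simp add: basis_expansion flip: scalar_mult_eq_scaleR)
    also have "\<dots> = (\<Sum>i\<in>UNIV. h $ i * partial i f x)"
      using lin by (simp add: linear_sum linear_scale partial_def)
    finally show ?thesis .
  qed
  then have "?D = (\<lambda>h. \<Sum>i\<in>UNIV. h $ i * partial i f x)" by (rule ext)
  with D show ?thesis by simp
qed

lemma smooth_differentiable: "smooth f \<Longrightarrow> f differentiable (at x)"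
  unfolding smooth_def by (drule spec[of _ "[]"]) (simp add: differentiable_on_def)

lemma smooth_partial: "smooth f \<Longrightarrow> smooth (partial i f)"
  unfolding smooth_def by (rule allI, erule_tac x="i # is" in allE) simp

lemma smooth_continuous: "smooth f \<Longrightarrow> continuous_on S f"
  by (meson continuous_at_imp_continuous_on differentiable_imp_continuous_within smooth_differentiable)

text \<open>An invariant class replaces the induction over lists of derivatives in the definition of
  \<open>smooth\<close>. It is applied to \<open>gen\<close>, to convolutions with test functions
  and to scaled reflections of test functions.\<close>

lemma smoothI_closed:
  assumes "f \<in> C" "\<And>g x. g \<in> C \<Longrightarrow> g differentiable (at x)" "\<And>g i. g \<in> C \<Longrightarrow> partial i g \<in> C"
  shows "smooth f"
proof -
  have "fold partial is f \<in> C" for "is"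
    using assms(1) by (induction "is" arbitrary: f) (simp_all add: assms(3))
  then show ?thesis
    using assms(2) by (auto simp: smooth_def differentiable_on_def intro: differentiable_at_imp_differentiable_on)
qed

lemma test_functionsI:
  assumes "smooth f" "\<And>x. norm x > r \<Longrightarrow> f x = 0"
  shows "f \<in> test_functions"
proof -
  have "{x. f x \<noteq> 0} \<subseteq> cball 0 r"
    using assms(2) by (force simp: not_le[symmetric])
  then have "bounded {x. f x \<noteq> 0}"
    using bounded_cball bounded_subset by blast
  then show ?thesis using assms(1) by (simp add: test_functions_def)
qed

lemma test_smooth: "f \<in> test_functions \<Longrightarrow> smooth f"
  by (simp add: test_functions_def)

lemma test_support:
  assumes "f \<in> test_functions"
  obtains r where "r > 0" "\<And>x. norm x > r \<Longrightarrow> f x = 0"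
proof -
  have "bounded {x. f x \<noteq> 0}"
    using assms bounded_subset[OF compact_imp_bounded closure_subset] by (simp add: test_functions_def)
  then obtain r where r: "\<And>x. f x \<noteq> 0 \<Longrightarrow> norm x \<le> r" by (auto simp: bounded_iff)
  then have "\<And>x. norm x > max r 1 \<Longrightarrow> f x = 0" by force
  then show ?thesis by (intro that[of "max r 1"]) auto
qed

lemma partial_zero:
  assumes "\<And>x. norm x > r \<Longrightarrow> f x = 0" "norm x > r"
  shows "partial i f x = 0"
proof -
  have "open {x::R3. norm x > r}" by (intro open_Collect_less continuous_intros)
  then have "(f has_derivative (\<lambda>_. 0)) (at x)"
    using assms by (intro has_derivative_transform_within_open[of "\<lambda>_. 0" "\<lambda>_. 0" x UNIV "{x. norm x > r}" f]) auto
  then show ?thesis by (simp add: partial_eqI)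
qed

lemma test_partial: "f \<in> test_functions \<Longrightarrow> partial i f \<in> test_functions"
proof -
  assume f: "f \<in> test_functions"
  obtain r where r: "\<And>x. norm x > r \<Longrightarrow> f x = 0" using test_support[OF f] by metis
  show ?thesis
    by (rule test_functionsI[OF smooth_partial[OF test_smooth[OF f]] partial_zero[OF r]])
qed

section \<open>Smooth bump functions and mollifiers\<close>

definition expinv :: "nat \<Rightarrow> real \<Rightarrow> real" where
  "expinv k t = (if t > 0 then (1 / t) ^ k * exp (- (1 / t)) else 0)"

lemma power_le_fact_exp:
  assumes "x \<ge> 0"
  shows "x ^ n \<le> fact n * exp (x :: real)"
proof -
  have "(\<Sum>k\<in>{n}. x ^ k /\<^sub>R fact k) \<le> exp x"
    unfolding exp_def using assms
    by (intro sum_le_suminf summable_exp_generic) auto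
  then show ?thesis by (simp add: field_simps)
qed

text \<open>The exponential series dominates the power \<open>k + 2\<close> of 1 / t. The two powers
  in excess become the factor \<open>t\<^sup>2\<close>, which makes the difference quotient at 0
  tend to 0.\<close>

lemma expinv_le: "\<bar>expinv k t\<bar> \<le> fact (k + 2) * t\<^sup>2"
proof (cases "t > 0")
  case True
  have "(1 / t) ^ (k + 2) \<le> fact (k + 2) * exp (1 / t)"
    using True by (intro power_le_fact_exp) simp
  then have "(1 / t) ^ k * exp (- (1 / t)) \<le> fact (k + 2) * t\<^sup>2"
    using True by (simp add: exp_minus field_simps power_add power2_eq_square)
  then show ?thesis using True by (simp add: expinv_def)
qed (simp add: expinv_def)

text \<open>Since the derivative of 1 / t is minus its square, the functions exp (- 1 / t) times
  powers of 1 / t are closed under differentiation up to linear combinations. This is why the whole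
  family indexed by \<open>k\<close> is defined, although the bump itself uses only
  \<open>k = 0\<close>. At the origin the quadratic bound replaces the calculation.\<close>

lemma DERIV_expinv:
  "(expinv k has_real_derivative (expinv (k + 2) t - real k * expinv (k + 1) t)) (at t)"
proof -
  consider "t > 0" | "t < 0" | "t = 0" by linarith
  then show ?thesis
  proof cases
    case 1
    have inv: "((\<lambda>t. 1 / t) has_real_derivative - ((1 / t)\<^sup>2)) (at t)"
      using 1 by (auto intro!: derivative_eq_intros simp: power2_eq_square)
    have "((\<lambda>u. u ^ k * exp (- u)) has_real_derivative
        (real k * (1 / t) ^ (k - 1) - (1 / t) ^ k) * exp (- (1 / t))) (at (1 / t))"
      by (rule derivative_eq_intros | simp add: algebra_simps)+
    from DERIV_chain2[OF this inv]
    have "((\<lambda>t. (1 / t) ^ k * exp (- (1 / t))) has_real_derivative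
        (real k * (1 / t) ^ (k - 1) - (1 / t) ^ k) * exp (- (1 / t)) * - ((1 / t)\<^sup>2)) (at t)" .
    also have "(real k * (1 / t) ^ (k - 1) - (1 / t) ^ k) * exp (- (1 / t)) * - ((1 / t)\<^sup>2) =
        expinv (k + 2) t - real k * expinv (k + 1) t"
    proof -
      define u where "u = 1 / t"
      \<comment> \<open>The case distinction is due to truncated subtraction: for
        \<open>k = 0\<close> the factor \<open>real k\<close> removes the term with exponent
        \<open>k - 1\<close>.\<close>
      have "(real k * u ^ (k - 1) - u ^ k) * e * - (u\<^sup>2) = u ^ (k + 2) * e - real k * (u ^ (k + 1) * e)" for e
        by (cases k) (simp_all add: power2_eq_square algebra_simps)
      then show ?thesis using 1 by (simp add: expinv_def flip: u_def)
    qed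
    finally have "((\<lambda>t. (1 / t) ^ k * exp (- (1 / t))) has_real_derivative
       (expinv (k + 2) t - real k * expinv (k + 1) t)) (at t)" .
    then show ?thesis
      by (rule has_field_derivative_transform_within_open[where S="{0<..}"]) (use 1 in \<open>auto simp: expinv_def\<close>)
  next
    case 2
    have "((\<lambda>t::real. 0) has_real_derivative (expinv (k + 2) t - real k * expinv (k + 1) t)) (at t)"
      using 2 by (simp add: expinv_def)
    then show ?thesis
      by (rule has_field_derivative_transform_within_open[where S="{..<0}"]) (use 2 in \<open>auto simp: expinv_def\<close>)
  next
    case 3
    have "((\<lambda>h. (expinv k (0 + h) - expinv k 0) / h) \<longlongrightarrow> 0) (at 0)"
    proof (rule Lim_null_comparison)
      show "\<forall>\<^sub>F h in at 0. norm ((expinv k (0 + h) - expinv k 0) / h) \<le> fact (k + 2) * \<bar>h\<bar>"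
      proof (rule always_eventually, rule allI)
        fix h :: real
        have "\<bar>expinv k h\<bar> / \<bar>h\<bar> \<le> fact (k + 2) * \<bar>h\<bar>"
          using expinv_le[of k h] by (cases "h = 0") (auto simp: divide_le_eq power2_eq_square)
        then show "norm ((expinv k (0 + h) - expinv k 0) / h) \<le> fact (k + 2) * \<bar>h\<bar>"
          by (simp add: expinv_def)
      qed
      show "((\<lambda>h::real. fact (k + 2) * \<bar>h\<bar>) \<longlongrightarrow> 0) (at 0)"
        by (auto intro!: tendsto_eq_intros)
    qed
    then have "(expinv k has_real_derivative 0) (at 0)" by (simp add: DERIV_def)
    then show ?thesis using 3 by (simp add: expinv_def)
  qed
qed

text \<open>A class of functions that contains the standard bump functions and is closed under partial
  derivatives, hence consists of smooth functions.\<close>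

inductive_set gen :: "(R3 \<Rightarrow> real) set" where
  gen_const: "(\<lambda>_. c) \<in> gen"
| gen_coord: "(\<lambda>x. x $ i) \<in> gen"
| gen_expinv: "f \<in> gen \<Longrightarrow> (\<lambda>x. expinv k (f x)) \<in> gen"
| gen_add: "f \<in> gen \<Longrightarrow> g \<in> gen \<Longrightarrow> (\<lambda>x. f x + g x) \<in> gen"
| gen_mult: "f \<in> gen \<Longrightarrow> g \<in> gen \<Longrightarrow> (\<lambda>x. f x * g x) \<in> gen"

text \<open>The derivative is kept as a linear map at each point, with membership in
  \<open>gen\<close> asserted for each fixed direction \<open>h\<close>. The product and chain rules
  apply in this form, and a basis vector for \<open>h\<close> yields the partial
  derivatives.\<close>

lemma gen_derivative:
  "f \<in> gen \<Longrightarrow> \<exists>D. (\<forall>x. (f has_derivative D x) (at x)) \<and> (\<forall>h. (\<lambda>x. D x h) \<in> gen)"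
proof (induction rule: gen.induct)
  case (gen_const c)
  show ?case by (rule exI[of _ "\<lambda>_ _. 0"]) (auto intro: gen.gen_const)
next
  case (gen_coord i)
  show ?case
    by (rule exI[of _ "\<lambda>_ h. h $ i"])
       (auto intro: gen.gen_const bounded_linear_imp_has_derivative bounded_linear_vec_nth)
next
  case (gen_expinv f k)
  then obtain D where D: "\<And>x. (f has_derivative D x) (at x)" "\<And>h. (\<lambda>x. D x h) \<in> gen" by blast
  show ?case
  proof (rule exI[of _ "\<lambda>x h. (expinv (k + 2) (f x) + - real k * expinv (k + 1) (f x)) * D x h"], intro conjI allI)
    fix x
    show "((\<lambda>x. expinv k (f x)) has_derivative
        (\<lambda>h. (expinv (k + 2) (f x) + - real k * expinv (k + 1) (f x)) * D x h)) (at x)"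
      using DERIV_compose_FDERIV[OF DERIV_expinv D(1)[of x], where k1=k] by (simp add: mult.commute)
  next
    fix h show "(\<lambda>x. (expinv (k + 2) (f x) + - real k * expinv (k + 1) (f x)) * D x h) \<in> gen"
      using gen_expinv.hyps D(2) by (intro gen.intros)
  qed
next
  case (gen_add f g)
  then obtain D E where D: "\<And>x. (f has_derivative D x) (at x)" "\<And>h. (\<lambda>x. D x h) \<in> gen"
    and E: "\<And>x. (g has_derivative E x) (at x)" "\<And>h. (\<lambda>x. E x h) \<in> gen" by blast
  show ?case
    by (rule exI[of _ "\<lambda>x h. D x h + E x h"]) (auto intro: has_derivative_add D E gen.gen_add)
next
  case (gen_mult f g)
  then obtain D E where D: "\<And>x. (f has_derivative D x) (at x)" "\<And>h. (\<lambda>x. D x h) \<in> gen"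
    and E: "\<And>x. (g has_derivative E x) (at x)" "\<And>h. (\<lambda>x. E x h) \<in> gen" by blast
  show ?case
    by (rule exI[of _ "\<lambda>x h. f x * E x h + D x h * g x"])
       (auto intro!: has_derivative_mult D E gen.gen_add gen.gen_mult gen_mult.hyps)
qed

lemma gen_smooth: "f \<in> gen \<Longrightarrow> smooth f"
proof (erule smoothI_closed)
  fix g x assume "g \<in> gen"
  then show "g differentiable at x" using gen_derivative differentiable_def by blast
next
  fix g i assume "g \<in> gen"
  then obtain D where D: "\<And>x. (g has_derivative D x) (at x)" "\<And>h. (\<lambda>x. D x h) \<in> gen"
    using gen_derivative by blast
  then have "partial i g = (\<lambda>x. D x (axis i 1))" by (auto simp: partial_eqI)
  then show "partial i g \<in> gen" using D(2) by simp
qed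

lemma gen_sum: "finite I \<Longrightarrow> (\<And>i. i \<in> I \<Longrightarrow> f i \<in> gen) \<Longrightarrow> (\<lambda>x. \<Sum>i\<in>I. f i x) \<in> gen"
  by (induction I rule: finite_induct) (auto intro: gen.intros)

definition bump :: "real \<Rightarrow> R3 \<Rightarrow> real" where
  "bump r x = expinv 0 (r\<^sup>2 - (norm x)\<^sup>2)"

lemma bump_gen: "bump r \<in> gen"
proof -
  have "bump r = (\<lambda>x. expinv 0 (r\<^sup>2 + (\<Sum>i\<in>UNIV. (-1) * (x $ i * x $ i))))"
    by (rule ext) (simp add: bump_def power2_norm_eq_inner inner_vec_def sum_negf)
  also have "\<dots> \<in> gen" by (intro gen.intros gen_sum) auto
  finally show ?thesis .
qed

lemma bump_nonneg: "bump r x \<ge> 0"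
  by (simp add: bump_def expinv_def)

lemma bump_zero: "r > 0 \<Longrightarrow> norm x \<ge> r \<Longrightarrow> bump r x = 0"
proof -
  assume "r > 0" "norm x \<ge> r"
  then have "r\<^sup>2 \<le> (norm x)\<^sup>2" by (intro power_mono) auto
  then show ?thesis by (simp add: bump_def expinv_def)
qed

lemma bump_pos: "norm x < r \<Longrightarrow> bump r x > 0"
  using power_strict_mono[of "norm x" r 2] by (simp add: bump_def expinv_def)

lemma bump_test: "r > 0 \<Longrightarrow> bump r \<in> test_functions"
  by (rule test_functionsI[of _ r]) (auto intro: gen_smooth bump_gen bump_zero)

section \<open>Continuous functions of compact support\<close>

definition Cc :: "(R3 \<Rightarrow> real) set" where
  "Cc = {f. continuous_on UNIV f \<and> (\<exists>r. \<forall>x. norm x > r \<longrightarrow> f x = 0)}"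

lemma test_Cc: "f \<in> test_functions \<Longrightarrow> f \<in> Cc"
  unfolding Cc_def using test_support[of f] smooth_continuous[OF test_smooth] by blast

lemma Cc_measurable: "f \<in> Cc \<Longrightarrow> f \<in> borel_measurable borel"
  by (simp add: Cc_def borel_measurable_continuous_onI)

lemma Cc_measurable_lebesgue: "f \<in> Cc \<Longrightarrow> f \<in> borel_measurable lebesgue"
  by (simp add: Cc_measurable measurable_completion)

lemma Cc_bounded:
  assumes "f \<in> Cc"
  obtains B r where "B > 0" "r > 0" "\<And>x. \<bar>f x\<bar> \<le> B" "\<And>x. norm x > r \<Longrightarrow> f x = 0"
proof -
  obtain r where r: "\<And>x. norm x > r \<Longrightarrow> f x = 0" and c: "continuous_on UNIV f"
    using assms by (auto simp: Cc_def)
  have "compact (f ` cball 0 r)"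
    by (intro compact_continuous_image continuous_on_subset[OF c]) auto
  then obtain B where B: "\<And>y. y \<in> f ` cball 0 r \<Longrightarrow> norm y \<le> B"
    using compact_imp_bounded bounded_iff by metis
  have "\<bar>f x\<bar> \<le> max B 1" for x
  proof (cases "norm x > r")
    case False
    then have "f x \<in> f ` cball 0 r" by simp
    from B[OF this] show ?thesis by simp
  qed (simp add: r)
  moreover have "f x = 0" if "norm x > max r 1" for x using r that by simp
  ultimately show ?thesis by (intro that[of "max B 1" "max r 1"]) auto
qed

lemma Cc_integrable:
  assumes "f \<in> Cc"
  shows "integrable lborel f" "integrable lebesgue f"
proof -
  obtain B r where Br: "\<And>x. \<bar>f x\<bar> \<le> B" "\<And>x. norm x > r \<Longrightarrow> f x = 0"
    using Cc_bounded[OF assms] by metis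
  note [measurable] = Cc_measurable[OF assms]
  show *: "integrable lborel f"
  proof (rule Bochner_Integration.integrable_bound)
    show "integrable lborel (\<lambda>x::R3. indicator (cball 0 r) x * B)"
      by (intro integrable_mult_left integrable_real_indicator) (use emeasure_lborel_cball_finite[of 0 r] in auto)
    show "AE x in lborel. norm (f x) \<le> norm (indicator (cball 0 r) x * B)"
    proof (rule AE_I2)
      fix x show "norm (f x) \<le> norm (indicator (cball 0 r) x * B)"
        using Br(1)[of x] Br(2)[of x] by (cases "norm x > r") (auto simp: indicator_def)
    qed
  qed measurable
  show "integrable lebesgue f"
    by (subst integrable_completion) (auto simp: *)
qed

lemma Cc_mult: "f \<in> Cc \<Longrightarrow> g \<in> Cc \<Longrightarrow> (\<lambda>x. f x * g x) \<in> Cc"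
  by (auto simp: Cc_def intro!: continuous_intros)

lemma Cc_L2: "f \<in> Cc \<Longrightarrow> f \<in> L2"
  using Cc_integrable(2)[OF Cc_mult[of f f]]
  by (intro L2I) (simp_all add: Cc_measurable_lebesgue power2_eq_square)

lemma Cc_reflect:
  assumes "f \<in> Cc"
  shows "(\<lambda>y. f (x - y)) \<in> Cc"
proof -
  obtain r where r: "\<And>x. norm x > r \<Longrightarrow> f x = 0" and c: "continuous_on UNIV f"
    using assms by (auto simp: Cc_def)
  have "f (x - y) = 0" if "norm y > norm x + r" for y
    using that norm_triangle_ineq2[of y x] by (intro r) (simp add: norm_minus_commute)
  moreover have "continuous_on UNIV (\<lambda>y. f (x - y))"
    by (rule continuous_on_compose2[OF c]) (auto intro: continuous_on_diff continuous_on_const continuous_on_id)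
  ultimately show ?thesis
    unfolding Cc_def by blast
qed

lemma Cc_uniformly_continuous:
  assumes "f \<in> Cc" "e > 0"
  obtains d where "d > 0" "\<And>x y. norm (x - y) < d \<Longrightarrow> \<bar>f x - f y\<bar> < e"
proof -
  obtain B r where r: "\<And>x. norm x > r \<Longrightarrow> f x = 0" "r > 0"
    using Cc_bounded[OF assms(1)] by metis
  have c: "continuous_on UNIV f"
    using assms(1) by (simp add: Cc_def)
  have "uniformly_continuous_on (cball 0 (r + 2)) f"
    by (intro compact_uniformly_continuous continuous_on_subset[OF c]) auto
  then obtain d where d: "d > 0"
    "\<forall>x\<in>cball 0 (r + 2). \<forall>x'\<in>cball 0 (r + 2). dist x' x < d \<longrightarrow> dist (f x') (f x) < e"
    using assms(2) unfolding uniformly_continuous_on_def by blast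
  have "\<bar>f x - f y\<bar> < e" if *: "norm (x - y) < min d 1" for x y
  proof (cases "x \<in> cball 0 (r + 2) \<and> y \<in> cball 0 (r + 2)")
    case True
    then show ?thesis using d(2)[rule_format, of y x] * by (simp add: dist_norm)
  next
    case False
    have "norm x > r" "norm y > r"
      using False * norm_triangle_ineq2[of x y] norm_triangle_ineq2[of y x]
      by (auto simp: norm_minus_commute)
    then show ?thesis using r assms(2) by simp
  qed
  then show ?thesis using d(1) by (intro that[of "min d 1"]) auto
qed

lemma bump_integral_pos:
  assumes "r > 0"
  shows "0 < (\<integral>x. bump r x \<partial>lebesgue)"
proof -
  have "(\<integral>x. bump r x \<partial>lebesgue) \<noteq> 0"
  proof
    assume "(\<integral>x. bump r x \<partial>lebesgue) = 0"
    then have ae: "AE x in lebesgue. bump r x = 0"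
      by (subst (asm) integral_nonneg_eq_0_iff_AE)
         (auto simp: bump_nonneg Cc_integrable[OF test_Cc[OF bump_test[OF assms]]])
    have ae2: "AE x in lebesgue. x \<notin> ball (0::R3) r"
      using ae
    proof eventually_elim
      case (elim x)
      then show ?case using bump_pos[of x r] by auto
    qed
    then have "emeasure lebesgue (ball (0::R3) r) = 0"
      by (subst (asm) AE_iff_measurable[of "ball 0 r"]) auto
    then show False
      using assms by (simp add: emeasure_lborel_ball_finite content_ball_pos emeasure_eq_measure2)
  qed
  then show ?thesis
    using Bochner_Integration.integral_nonneg[of lebesgue "bump r"] by (simp add: bump_nonneg less_le)
qed

definition mollifier :: "real \<Rightarrow> R3 \<Rightarrow> real" where
  "mollifier r x = bump r x / (\<integral>x. bump r x \<partial>lebesgue)"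

lemma mollifier_test:
  assumes "r > 0"
  shows "mollifier r \<in> test_functions"
proof -
  have "mollifier r = (\<lambda>x. (1 / (\<integral>x. bump r x \<partial>lebesgue)) * bump r x)"
    by (simp add: mollifier_def fun_eq_iff)
  also have "\<dots> \<in> gen" by (intro gen.intros bump_gen)
  finally show ?thesis
    using assms by (intro test_functionsI[of _ r] gen_smooth) (auto simp: mollifier_def bump_zero)
qed

lemma mollifier_even: "mollifier r (- x) = mollifier r x"
  by (simp add: mollifier_def bump_def)

lemma mollifier_nonneg: "r > 0 \<Longrightarrow> mollifier r x \<ge> 0"
  by (simp add: mollifier_def bump_nonneg)

lemma mollifier_zero: "r > 0 \<Longrightarrow> norm x \<ge> r \<Longrightarrow> mollifier r x = 0"
  by (simp add: mollifier_def bump_zero)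

lemma mollifier_integral: "r > 0 \<Longrightarrow> (\<integral>x. mollifier r x \<partial>lebesgue) = 1"
  using bump_integral_pos[of r] by (simp add: mollifier_def)

subsection \<open>Convolution with test functions\<close>

definition conv :: "(R3 \<Rightarrow> real) \<Rightarrow> (R3 \<Rightarrow> real) \<Rightarrow> R3 \<Rightarrow> real" where
  "conv \<kappa> f x = (\<integral>y. \<kappa> (x - y) * f y \<partial>lebesgue)"

lemma conv_integrable:
  "\<kappa> \<in> Cc \<Longrightarrow> f \<in> L2 \<Longrightarrow> integrable lebesgue (\<lambda>y. \<kappa> (x - y) * f y)"
  by (rule L2_mult_integrable[OF Cc_L2[OF Cc_reflect]])

lemma conv_cong:
  assumes "\<kappa> \<in> Cc" "f \<in> borel_measurable lebesgue" "g \<in> borel_measurable lebesgue" "AE x in lebesgue. f x = g x"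
  shows "conv \<kappa> f = conv \<kappa> g"
proof
  fix x
  note [measurable] = assms(2,3) Cc_measurable_lebesgue[OF Cc_reflect[OF assms(1)]]
  show "conv \<kappa> f x = conv \<kappa> g x"
    unfolding conv_def by (rule integral_cong_AE) (measurable, use assms(4) in eventually_elim, simp)
qed

lemma conv_add: "\<kappa> \<in> Cc \<Longrightarrow> f \<in> L2 \<Longrightarrow> g \<in> L2 \<Longrightarrow> conv \<kappa> (\<lambda>x. f x + g x) x = conv \<kappa> f x + conv \<kappa> g x"
  by (simp add: conv_def conv_integrable distrib_left)

lemma conv_cmult: "conv \<kappa> (\<lambda>x. c * f x) x = c * conv \<kappa> f x"
  by (simp add: conv_def mult.left_commute[of _ c])

text \<open>Compact support makes the partial derivatives uniformly continuous, so the mean value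
  inequality along the segment from \<open>z\<close> to \<open>z + h\<close> works with one radius
  for all base points. Each of the three coordinates is allowed an error \<open>e / 3\<close>. The
  uniformity in \<open>z\<close> permits differentiation under the convolution integral.\<close>

lemma test_uniformly_differentiable:
  assumes "\<kappa> \<in> test_functions" "e > 0"
  obtains d where "d > 0"
    "\<And>z h. norm h < d \<Longrightarrow> \<bar>\<kappa> (z + h) - \<kappa> z - (\<Sum>i\<in>UNIV. h $ i * partial i \<kappa> z)\<bar> \<le> e * norm h"
proof -
  have "\<exists>d>0. \<forall>x y. norm (x - y) < d \<longrightarrow> \<bar>partial i \<kappa> x - partial i \<kappa> y\<bar> < e / 3" for i
    by (rule Cc_uniformly_continuous[OF test_Cc[OF test_partial[OF assms(1), of i]], of "e / 3"])
       (use assms(2) in simp, blast)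
  then obtain D where D: "\<And>i. D i > 0"
    "\<And>i x y. norm (x - y) < D i \<Longrightarrow> \<bar>partial i \<kappa> x - partial i \<kappa> y\<bar> < e / 3" by metis
  define d where "d = Min (range D)"
  have dpos: "d > 0" using D(1) by (simp add: d_def)
  have dle: "d \<le> D i" for i by (simp add: d_def)
  let ?F = "\<lambda>y h. \<Sum>i\<in>UNIV. h $ i * partial i \<kappa> y"
  have "\<bar>\<kappa> (z + h) - \<kappa> z - ?F z h\<bar> \<le> e * norm h" if h: "norm h < d" for z h
  proof -
    have "norm (\<kappa> (z + h) - \<kappa> z - ?F z ((z + h) - z)) \<le> norm ((z + h) - z) * e"
    proof (rule differentiable_bound_linearization[where S="ball z d"])
      show "z + t *\<^sub>R (z + h - z) \<in> ball z d" if "t \<in> {0..1}" for t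
      proof -
        have "norm (t *\<^sub>R h) \<le> norm h" using that by (simp add: mult_left_le_one_le)
        then show ?thesis using h by (simp add: dist_norm)
      qed
      show "(\<kappa> has_derivative ?F x) (at x within ball z d)" for x
        by (rule has_derivative_at_withinI[OF has_derivative_partial[OF smooth_differentiable[OF test_smooth[OF assms(1)]]]])
      show "onorm (?F x - ?F z) \<le> e" if x: "x \<in> ball z d" for x
      proof (rule onorm_le)
        fix k :: R3
        have "\<bar>(?F x - ?F z) k\<bar> = \<bar>\<Sum>i\<in>UNIV. k $ i * (partial i \<kappa> x - partial i \<kappa> z)\<bar>"
          by (simp add: sum_subtractf right_diff_distrib)
        also have "\<dots> \<le> (\<Sum>i\<in>(UNIV :: 3 set). norm k * (e / 3))"
        proof (rule order_trans[OF sum_abs], rule sum_mono)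
          fix i :: 3
          have "norm (x - z) < D i" using x dle[of i] by (simp add: dist_norm norm_minus_commute)
          then show "\<bar>k $ i * (partial i \<kappa> x - partial i \<kappa> z)\<bar> \<le> norm k * (e / 3)"
            unfolding abs_mult using D(2)[of x z i] component_le_norm_cart[of k i]
            by (intro mult_mono) auto
        qed
        also have "\<dots> = e * norm k" by simp
        finally show "norm ((?F x - ?F z) k) \<le> e * norm k" by simp
      qed
      show "z \<in> ball z d" using dpos by simp
    qed
    then show ?thesis by (simp add: mult.commute)
  qed
  then show ?thesis using dpos that by blast
qed

lemma indicator_L2: "(\<lambda>y. indicator (cball x r) y :: real) \<in> L2"
proof (rule L2I)
  have "(\<lambda>y::R3. (indicator (cball x r) y :: real)\<^sup>2) = indicator (cball x r)"
    by (auto simp: fun_eq_iff indicator_def)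
  moreover have "emeasure lebesgue (cball x r) < \<infinity>"
    using emeasure_lborel_cball_finite[of x r] by simp
  ultimately show "integrable lebesgue (\<lambda>y::R3. (indicator (cball x r) y :: real)\<^sup>2)"
    by (simp del: emeasure_completion)
  show "(\<lambda>y. indicator (cball x r) y :: real) \<in> borel_measurable lebesgue"
    by (rule borel_measurable_indicator) simp
qed

text \<open>For increments shorter than 1 the Taylor remainder of the kernel lives on the ball of
  radius \<open>r + 1\<close> about \<open>x\<close>. Its integral against \<open>f\<close> is thus
  at most the uniform remainder bound times the integral \<open>A\<close> of |f| over that ball,
  which is finite as \<open>f\<close> is in L2. Dividing \<open>e\<close> by \<open>A + 1\<close>
  covers the case \<open>A = 0\<close>.\<close>

lemma conv_has_derivative:
  assumes "\<kappa> \<in> test_functions" "f \<in> L2"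
  shows "(conv \<kappa> f has_derivative (\<lambda>h. \<Sum>i\<in>UNIV. h $ i * conv (partial i \<kappa>) f x)) (at x)"
proof -
  obtain r where r: "r > 0" "\<And>x. norm x > r \<Longrightarrow> \<kappa> x = 0" by (rule test_support[OF assms(1)]) blast
  define A where "A = (\<integral>y. indicator (cball x (r + 1)) y * \<bar>f y\<bar> \<partial>lebesgue)"
  note [measurable] = L2_measurable[OF assms(2)]
  have fabs: "(\<lambda>y. \<bar>f y\<bar>) \<in> L2"
    by (rule L2_dominated[OF assms(2)]) auto
  have intA: "integrable lebesgue (\<lambda>y. indicator (cball x (r + 1)) y * \<bar>f y\<bar>)"
    by (intro L2_mult_integrable indicator_L2 fabs)
  have A0: "A \<ge> 0" unfolding A_def by (intro Bochner_Integration.integral_nonneg) auto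
  note ci = conv_integrable[OF test_Cc[OF assms(1)] assms(2)]
  note cip = conv_integrable[OF test_Cc[OF test_partial[OF assms(1)]] assms(2)]
  show ?thesis
    unfolding has_derivative_at_alt
  proof (intro conjI allI impI)
    show "bounded_linear (\<lambda>h. \<Sum>i\<in>UNIV. h $ i * conv (partial i \<kappa>) f x)"
      by (intro bounded_linear_sum bounded_linear_mult_const bounded_linear_vec_nth)
    fix e :: real assume e: "e > 0"
    obtain d where d: "d > 0"
      "\<And>z h. norm h < d \<Longrightarrow> \<bar>\<kappa> (z + h) - \<kappa> z - (\<Sum>i\<in>UNIV. h $ i * partial i \<kappa> z)\<bar> \<le> e / (A + 1) * norm h"
      by (rule test_uniformly_differentiable[OF assms(1), of "e / (A + 1)"]) (use e A0 in auto)
    show "\<exists>d>0. \<forall>y. norm (y - x) < d \<longrightarrow>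
        norm (conv \<kappa> f y - conv \<kappa> f x - (\<Sum>i\<in>UNIV. (y - x) $ i * conv (partial i \<kappa>) f x)) \<le> e * norm (y - x)"
    proof (intro exI[of _ "min d 1"] conjI allI impI)
      show "min d 1 > 0" using d by simp
      fix w assume w: "norm (w - x) < min d 1"
      define h where "h = w - x"
      define Rm where "Rm y = \<kappa> (w - y) - \<kappa> (x - y) - (\<Sum>i\<in>UNIV. h $ i * partial i \<kappa> (x - y))" for y
      have Rb: "\<bar>Rm y * f y\<bar> \<le> e / (A + 1) * norm h * (indicator (cball x (r + 1)) y * \<bar>f y\<bar>)" for y
      proof (cases "y \<in> cball x (r + 1)")
        case True
        have "\<bar>Rm y\<bar> \<le> e / (A + 1) * norm h"
          using d(2)[of h "x - y"] w by (simp add: Rm_def h_def)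
        then have "\<bar>Rm y\<bar> * \<bar>f y\<bar> \<le> (e / (A + 1) * norm h) * \<bar>f y\<bar>"
          by (rule mult_right_mono) simp
        then show ?thesis using True by (simp add: abs_mult)
      next
        case False
        then have xy: "norm (x - y) > r + 1" by (simp add: dist_norm)
        have "norm (w - y) > r"
          using norm_triangle_ineq[of "w - y" "x - w"] xy w by (simp add: norm_minus_commute)
        then have "Rm y = 0"
          using xy partial_zero[OF r(2), where x="x - y"] by (simp add: Rm_def r(2))
        then show ?thesis using e A0 by (simp add: indicator_def)
      qed
      have eq: "Rm y * f y = \<kappa> (w - y) * f y - \<kappa> (x - y) * f y - (\<Sum>i\<in>UNIV. h $ i * (partial i \<kappa> (x - y) * f y))" for y
        by (simp add: Rm_def left_diff_distrib sum_distrib_right mult.assoc)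
      have intR: "integrable lebesgue (\<lambda>y. Rm y * f y)"
        unfolding eq by (intro Bochner_Integration.integrable_diff Bochner_Integration.integrable_sum integrable_mult_right ci cip)
      have "conv \<kappa> f w - conv \<kappa> f x - (\<Sum>i\<in>UNIV. h $ i * conv (partial i \<kappa>) f x) = (\<integral>y. Rm y * f y \<partial>lebesgue)"
        unfolding eq conv_def
        by (simp add: Bochner_Integration.integral_diff Bochner_Integration.integral_sum ci cip)
      also have "\<bar>\<dots>\<bar> \<le> (\<integral>y. e / (A + 1) * norm h * (indicator (cball x (r + 1)) y * \<bar>f y\<bar>) \<partial>lebesgue)"
      proof (rule order_trans[OF integral_abs_bound], rule integral_mono)
        show "integrable lebesgue (\<lambda>y. \<bar>Rm y * f y\<bar>)" by (rule integrable_abs[OF intR])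
        show "integrable lebesgue (\<lambda>y. e / (A + 1) * norm h * (indicator (cball x (r + 1)) y * \<bar>f y\<bar>))"
          by (rule integrable_mult_right[OF intA])
      qed (rule Rb)
      also have "\<dots> = e * norm h * (A / (A + 1))" by (simp add: A_def)
      also have "\<dots> \<le> e * norm h"
        using A0 e by (intro mult_left_le) (auto simp: divide_simps)
      finally show "norm (conv \<kappa> f w - conv \<kappa> f x - (\<Sum>i\<in>UNIV. (w - x) $ i * conv (partial i \<kappa>) f x)) \<le> e * norm (w - x)"
        by (simp add: h_def)
    qed
  qed
qed

lemma partial_conv:
  "\<kappa> \<in> test_functions \<Longrightarrow> f \<in> L2 \<Longrightarrow> partial i (conv \<kappa> f) = conv (partial i \<kappa>) f"
  by (rule ext, subst partial_eqI[OF conv_has_derivative]) (auto simp: axis_def if_distrib[of "\<lambda>x. x * _"] cong: if_cong)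

lemma smooth_conv:
  assumes "\<kappa> \<in> test_functions" "f \<in> L2"
  shows "smooth (conv \<kappa> f)"
proof (rule smoothI_closed[where C="(\<lambda>\<kappa>. conv \<kappa> f) ` test_functions"])
  show "conv \<kappa> f \<in> (\<lambda>\<kappa>. conv \<kappa> f) ` test_functions" using assms(1) by blast
  show "g differentiable at x" if "g \<in> (\<lambda>\<kappa>. conv \<kappa> f) ` test_functions" for g x
    using that conv_has_derivative[OF _ assms(2)] by (auto simp: differentiable_def)
  show "partial i g \<in> (\<lambda>\<kappa>. conv \<kappa> f) ` test_functions" if "g \<in> (\<lambda>\<kappa>. conv \<kappa> f) ` test_functions" for g i
    using that by (auto simp: partial_conv assms(2) intro: test_partial)
qed

lemma continuous_conv: "\<kappa> \<in> test_functions \<Longrightarrow> f \<in> L2 \<Longrightarrow> continuous_on S (conv \<kappa> f)"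
  by (rule smooth_continuous[OF smooth_conv])

lemma conv_test:
  assumes "\<kappa> \<in> test_functions" "f \<in> L2" "\<And>x. norm x > m \<Longrightarrow> f x = 0"
  shows "conv \<kappa> f \<in> test_functions"
proof -
  obtain r where r: "r > 0" "\<And>x. norm x > r \<Longrightarrow> \<kappa> x = 0" by (rule test_support[OF assms(1)]) blast
  have "conv \<kappa> f x = 0" if x: "norm x > r + m" for x
  proof -
    have "\<kappa> (x - y) * f y = 0" for y
    proof (cases "norm y > m")
      case False
      then have "norm (x - y) > r" using x norm_triangle_ineq2[of x y] by simp
      then show ?thesis by (simp add: r)
    qed (simp add: assms(3))
    then have "(\<lambda>y. \<kappa> (x - y) * f y) = (\<lambda>_. 0)" by (rule ext)
    then show ?thesis by (simp add: conv_def)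
  qed
  then show ?thesis by (rule test_functionsI[OF smooth_conv[OF assms(1,2)]])
qed

lemma test_reflect:
  assumes "\<kappa> \<in> test_functions"
  shows "(\<lambda>y. \<kappa> (x - y)) \<in> test_functions" "partial i (\<lambda>y. \<kappa> (x - y)) y = - partial i \<kappa> (x - y)"
proof -
  \<comment> \<open>The scalar factor is part of the class because every derivative of a reflected
    function changes its sign.\<close>
  let ?C = "{\<lambda>y. c * \<kappa> (x - y) |c \<kappa>. \<kappa> \<in> test_functions}"
  have D: "((\<lambda>y. c * \<kappa> (x - y)) has_derivative (\<lambda>h. c * (\<Sum>i\<in>UNIV. (- h) $ i * partial i \<kappa> (x - y)))) (at y)"
    if "\<kappa> \<in> test_functions" for c \<kappa> y
  proof -
    have "(\<kappa> has_derivative (\<lambda>h. \<Sum>i\<in>UNIV. h $ i * partial i \<kappa> (x - y))) (at (x - y))"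
      by (intro has_derivative_partial smooth_differentiable test_smooth that)
    moreover have "((\<lambda>y. x - y) has_derivative (\<lambda>h. - h)) (at y)"
      by (auto intro!: derivative_eq_intros)
    ultimately have "((\<lambda>y. \<kappa> (x - y)) has_derivative (\<lambda>h. \<Sum>i\<in>UNIV. (- h) $ i * partial i \<kappa> (x - y))) (at y)"
      by (rule has_derivative_compose[rotated])
    then show ?thesis by (rule has_derivative_mult_right)
  qed
  have P: "partial i (\<lambda>y. c * \<kappa> (x - y)) = (\<lambda>y. (- c) * partial i \<kappa> (x - y))"
    if "\<kappa> \<in> test_functions" for c \<kappa> i
  proof
    fix y
    have "(\<Sum>j\<in>UNIV. (- axis i 1 :: R3) $ j * partial j \<kappa> (x - y)) = - partial i \<kappa> (x - y)"
      by (simp add: axis_def if_distrib[of "\<lambda>x. x * _"] sum_negf cong: if_cong)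
    then show "partial i (\<lambda>y. c * \<kappa> (x - y)) y = (- c) * partial i \<kappa> (x - y)"
      by (subst partial_eqI[OF D[OF that]]) simp
  qed
  show "partial i (\<lambda>y. \<kappa> (x - y)) y = - partial i \<kappa> (x - y)"
    using P[OF assms, of i 1] by simp
  have "smooth (\<lambda>y. 1 * \<kappa> (x - y))"
  proof (rule smoothI_closed[of _ ?C])
    show "(\<lambda>y. 1 * \<kappa> (x - y)) \<in> ?C" using assms by blast
    show "g differentiable at y" if "g \<in> ?C" for g y
      using that D by (auto simp: differentiable_def)
    show "partial i g \<in> ?C" if "g \<in> ?C" for g i
    proof -
      have "\<exists>c k. g = (\<lambda>y. c * k (x - y)) \<and> k \<in> test_functions" using that by simp
      then obtain c k where k: "g = (\<lambda>y. c * k (x - y))" "k \<in> test_functions" by (elim exE conjE)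
      have "partial i g = (\<lambda>y. (- c) * partial i k (x - y))" using P[OF k(2), of i c] k(1) by simp
      then show ?thesis using test_partial[OF k(2)] by blast
    qed
  qed
  moreover obtain r where r: "r > 0" "\<And>x. norm x > r \<Longrightarrow> \<kappa> x = 0" by (rule test_support[OF assms(1)]) blast
  have "\<kappa> (x - y) = 0" if "norm y > norm x + r" for y
    using that norm_triangle_ineq2[of y x] by (intro r) (simp add: norm_minus_commute)
  ultimately show "(\<lambda>y. \<kappa> (x - y)) \<in> test_functions"
    by (intro test_functionsI[of _ "norm x + r"]) auto
qed

text \<open>For fixed \<open>x\<close> the reflected kernel is itself a test function and can be
  inserted into the definition of the weak gradient. The sign from that definition cancels the sign
  from the reflection.\<close>

lemma conv_weak_gradient:
  assumes "\<kappa> \<in> test_functions" "f \<in> L2" "has_weak_gradient f g"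
  shows "conv (partial i \<kappa>) f = conv \<kappa> (\<lambda>x. g x $ i)"
proof
  fix x
  have "(\<integral>y. f y * partial i (\<lambda>y. \<kappa> (x - y)) y \<partial>lebesgue) = - (\<integral>y. g y $ i * \<kappa> (x - y) \<partial>lebesgue)"
    using assms(3) test_reflect(1)[OF assms(1)] by (simp add: has_weak_gradient_def)
  then show "conv (partial i \<kappa>) f x = conv \<kappa> (\<lambda>x. g x $ i) x"
    by (simp add: conv_def test_reflect(2)[OF assms(1)] mult.commute)
qed

section \<open>Young's inequality and symmetry of convolution\<close>

lemma nn_integral_lborel_reflect:
  fixes F :: "R3 \<Rightarrow> ennreal"
  assumes [measurable]: "F \<in> borel_measurable borel"
  shows "(\<integral>\<^sup>+y. F (x - y) \<partial>lborel) = (\<integral>\<^sup>+y. F y \<partial>lborel)"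
  by (subst (2) lborel_affine[of "-1" x]) (simp_all add: nn_integral_density nn_integral_distr)

lemma nn_integral_lborel_translate:
  fixes F :: "R3 \<Rightarrow> ennreal"
  assumes [measurable]: "F \<in> borel_measurable borel"
  shows "(\<integral>\<^sup>+x. F (x - y) \<partial>lborel) = (\<integral>\<^sup>+y. F y \<partial>lborel)"
  by (subst (2) lborel_affine[of "1" "-y"]) (simp_all add: nn_integral_density nn_integral_distr)

text \<open>Fubini's theorem is used on the product of two copies of \<open>lborel\<close>, where
  joint measurability is clear for Borel functions. Convolutions and L2 pairings do not see the
  change on a null set.\<close>

lemma borel_representative:
  assumes "f \<in> L2"
  obtains g :: "R3 \<Rightarrow> real" where "g \<in> borel_measurable borel" "g \<in> L2" "AE x in lebesgue. f x = g x"
proof -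
  obtain g where g: "g \<in> borel_measurable lborel" "AE x in lborel. f x = g x"
    using completion_ex_borel_measurable_real[OF L2_measurable[OF assms]] by blast
  have g2: "g \<in> borel_measurable lebesgue" "AE x in lebesgue. f x = g x"
    using g by (auto intro: measurable_completion AE_completion)
  then have "g \<in> L2" by (intro L2_dominated[OF assms]) auto
  with g g2 show ?thesis by (intro that[of g]) auto
qed

text \<open>Young's inequality for an L1 kernel: write |\<kappa>| as the product of its two square
  roots, apply Cauchy-Schwarz for fixed \<open>x\<close>, and exchange the integrals. The extended
  nonnegative integral is used throughout, so that finiteness comes out as part of the
  result.\<close>

lemma conv_L2:
  assumes "\<kappa> \<in> test_functions" "f \<in> L2"
  shows "conv \<kappa> f \<in> L2" "(\<integral>x. (conv \<kappa> f x)\<^sup>2 \<partial>lebesgue) \<le> (\<integral>x. \<bar>\<kappa> x\<bar> \<partial>lebesgue)\<^sup>2 * (\<integral>x. (f x)\<^sup>2 \<partial>lebesgue)"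
proof -
  obtain g where g [measurable]: "g \<in> borel_measurable borel" and gL: "g \<in> L2" and ae: "AE x in lebesgue. f x = g x"
    by (rule borel_representative[OF assms(2)])
  have kC: "\<kappa> \<in> Cc" by (rule test_Cc[OF assms(1)])
  note [measurable] = Cc_measurable[OF kC]
  have eq: "conv \<kappa> f = conv \<kappa> g"
    by (rule conv_cong[OF kC L2_measurable[OF assms(2)] L2_measurable[OF gL] ae])
  have fg: "(\<integral>x. (f x)\<^sup>2 \<partial>lebesgue) = (\<integral>x. (g x)\<^sup>2 \<partial>lebesgue)"
    using mk_cong[OF assms(2) gL ae] norm_mk_sq[OF assms(2)] norm_mk_sq[OF gL] by simp
  define a where "a = (\<integral>x. \<bar>\<kappa> x\<bar> \<partial>lebesgue)"
  define G where "G = (\<integral>x. (g x)\<^sup>2 \<partial>lebesgue)"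
  have a0: "a \<ge> 0" "G \<ge> 0" by (auto simp: a_def G_def)
  have a: "(\<integral>\<^sup>+x. \<bar>\<kappa> x\<bar> \<partial>lborel) = ennreal a"
    using nn_integral_eq_integral[OF integrable_abs[OF Cc_integrable(2)[OF kC]]]
    by (simp add: nn_integral_completion a_def)
  have G: "(\<integral>\<^sup>+x. (g x)\<^sup>2 \<partial>lborel) = ennreal G"
    using nn_integral_eq_integral[OF L2_integrable_sq[OF gL]] by (simp add: nn_integral_completion G_def)
  have pw: "ennreal ((conv \<kappa> g x)\<^sup>2) \<le> ennreal a * (\<integral>\<^sup>+y. \<bar>\<kappa> (x - y)\<bar> * (g y)\<^sup>2 \<partial>lborel)" for x
  proof -
    have "ennreal \<bar>conv \<kappa> g x\<bar> \<le> (\<integral>\<^sup>+y. \<bar>\<kappa> (x - y) * g y\<bar> \<partial>lebesgue)"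
      using integral_norm_bound_ennreal[OF conv_integrable[OF kC gL, of x]] by (simp add: conv_def)
    also have "\<dots> = (\<integral>\<^sup>+y. ennreal (sqrt \<bar>\<kappa> (x - y)\<bar>) * ennreal (sqrt \<bar>\<kappa> (x - y)\<bar> * \<bar>g y\<bar>) \<partial>lborel)"
      unfolding nn_integral_completion
      by (intro nn_integral_cong) (simp add: abs_mult flip: ennreal_mult mult.assoc)
    finally have "(ennreal \<bar>conv \<kappa> g x\<bar>)\<^sup>2 \<le> (\<integral>\<^sup>+y. ennreal (sqrt \<bar>\<kappa> (x - y)\<bar>) * ennreal (sqrt \<bar>\<kappa> (x - y)\<bar> * \<bar>g y\<bar>) \<partial>lborel)\<^sup>2"
      by (rule power_mono) simp
    also have "\<dots> \<le> (\<integral>\<^sup>+y. (ennreal (sqrt \<bar>\<kappa> (x - y)\<bar>))\<^sup>2 \<partial>lborel) * (\<integral>\<^sup>+y. (ennreal (sqrt \<bar>\<kappa> (x - y)\<bar> * \<bar>g y\<bar>))\<^sup>2 \<partial>lborel)"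
      by (rule Cauchy_Schwarz_nn_integral) measurable
    also have "\<dots> = (\<integral>\<^sup>+y. \<bar>\<kappa> (x - y)\<bar> \<partial>lborel) * (\<integral>\<^sup>+y. \<bar>\<kappa> (x - y)\<bar> * (g y)\<^sup>2 \<partial>lborel)"
      by (simp add: ennreal_power power_mult_distrib)
    also have "(\<integral>\<^sup>+y. \<bar>\<kappa> (x - y)\<bar> \<partial>lborel) = ennreal a"
      using nn_integral_lborel_reflect[of "\<lambda>y. ennreal \<bar>\<kappa> y\<bar>" x] a by simp
    finally show ?thesis by (simp add: ennreal_power)
  qed
  have le: "(\<integral>\<^sup>+x. ennreal ((conv \<kappa> g x)\<^sup>2) \<partial>lborel) \<le> ennreal (a\<^sup>2 * G)"
  proof -
    have "(\<integral>\<^sup>+x. ennreal ((conv \<kappa> g x)\<^sup>2) \<partial>lborel) \<le> (\<integral>\<^sup>+x. ennreal a * (\<integral>\<^sup>+y. \<bar>\<kappa> (x - y)\<bar> * (g y)\<^sup>2 \<partial>lborel) \<partial>lborel)"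
      by (intro nn_integral_mono pw)
    also have "\<dots> = ennreal a * (\<integral>\<^sup>+x. (\<integral>\<^sup>+y. \<bar>\<kappa> (x - y)\<bar> * (g y)\<^sup>2 \<partial>lborel) \<partial>lborel)"
      by (rule nn_integral_cmult) measurable
    also have "(\<integral>\<^sup>+x. (\<integral>\<^sup>+y. \<bar>\<kappa> (x - y)\<bar> * (g y)\<^sup>2 \<partial>lborel) \<partial>lborel) = (\<integral>\<^sup>+y. (\<integral>\<^sup>+x. \<bar>\<kappa> (x - y)\<bar> * (g y)\<^sup>2 \<partial>lborel) \<partial>lborel)"
      by (rule lborel_pair.Fubini'[symmetric]) measurable
    also have "\<dots> = (\<integral>\<^sup>+y. ennreal a * (g y)\<^sup>2 \<partial>lborel)"
    proof (rule nn_integral_cong)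
      fix y
      have "(\<integral>\<^sup>+x. \<bar>\<kappa> (x - y)\<bar> * (g y)\<^sup>2 \<partial>lborel) = (\<integral>\<^sup>+x. \<bar>\<kappa> (x - y)\<bar> \<partial>lborel) * (g y)\<^sup>2"
        by (simp add: ennreal_mult nn_integral_multc)
      also have "(\<integral>\<^sup>+x. \<bar>\<kappa> (x - y)\<bar> \<partial>lborel) = ennreal a"
        using nn_integral_lborel_translate[of "\<lambda>y. ennreal \<bar>\<kappa> y\<bar>" y] a by simp
      finally show "(\<integral>\<^sup>+x. \<bar>\<kappa> (x - y)\<bar> * (g y)\<^sup>2 \<partial>lborel) = ennreal a * (g y)\<^sup>2" .
    qed
    also have "\<dots> = ennreal a * ennreal G"
      by (simp add: nn_integral_cmult G)
    also have "ennreal a * (ennreal a * ennreal G) = ennreal (a\<^sup>2 * G)"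
      using a0 by (simp add: ennreal_mult'' power2_eq_square mult.assoc)
    finally show ?thesis .
  qed
  have meas: "conv \<kappa> g \<in> borel_measurable lebesgue"
    by (intro measurable_completion) (simp add: borel_measurable_continuous_onI continuous_conv[OF assms(1) gL])
  have int: "integrable lebesgue (\<lambda>x. (conv \<kappa> g x)\<^sup>2)"
    unfolding integrable_iff_bounded using le meas
    by (auto simp: nn_integral_completion intro: le_less_trans)
  show "conv \<kappa> f \<in> L2" unfolding eq by (rule L2I[OF meas int])
  have "ennreal (\<integral>x. (conv \<kappa> g x)\<^sup>2 \<partial>lebesgue) \<le> ennreal (a\<^sup>2 * G)"
    using nn_integral_eq_integral[OF int] le by (simp add: nn_integral_completion)
  then show "(\<integral>x. (conv \<kappa> f x)\<^sup>2 \<partial>lebesgue) \<le> (\<integral>x. \<bar>\<kappa> x\<bar> \<partial>lebesgue)\<^sup>2 * (\<integral>x. (f x)\<^sup>2 \<partial>lebesgue)"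
    unfolding eq fg using a0 by (simp add: ennreal_le_iff flip: a_def G_def)
qed

text \<open>Fubini's theorem and evenness of the kernel. Absolute integrability on the product
  follows by bounding the product of g (y) and k (x) by the sum of their squares, after which each
  half is the L1 norm of the kernel times a squared L2 norm.\<close>

lemma conv_adjoint:
  assumes "\<kappa> \<in> test_functions" "\<And>x. \<kappa> (- x) = \<kappa> x" "f \<in> L2" "h \<in> L2"
  shows "(\<integral>x. conv \<kappa> f x * h x \<partial>lebesgue) = (\<integral>x. f x * conv \<kappa> h x \<partial>lebesgue)"
proof -
  obtain g where g [measurable]: "g \<in> borel_measurable borel" and gL: "g \<in> L2" and aeg: "AE x in lebesgue. f x = g x"
    by (rule borel_representative[OF assms(3)])
  obtain k where k [measurable]: "k \<in> borel_measurable borel" and kL: "k \<in> L2" and aek: "AE x in lebesgue. h x = k x"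
    by (rule borel_representative[OF assms(4)])
  have kC: "\<kappa> \<in> Cc" by (rule test_Cc[OF assms(1)])
  have absk: "(\<lambda>x. \<bar>\<kappa> x\<bar>) \<in> Cc" using kC by (auto simp: Cc_def intro: continuous_intros)
  note [measurable] = Cc_measurable[OF kC]
  have mk_eq: "mk f = mk g" "mk h = mk k"
    by (rule mk_cong[OF assms(3) gL aeg], rule mk_cong[OF assms(4) kL aek])
  have eq: "conv \<kappa> f = conv \<kappa> g" "conv \<kappa> h = conv \<kappa> k"
    by (rule conv_cong[OF kC L2_measurable[OF assms(3)] L2_measurable[OF gL] aeg],
        rule conv_cong[OF kC L2_measurable[OF assms(4)] L2_measurable[OF kL] aek])
  note cL = conv_L2(1)[OF assms(1) gL] conv_L2(1)[OF assms(1) kL]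
  have fin: "(\<integral>\<^sup>+x. \<integral>\<^sup>+y. \<bar>\<kappa> (x - y)\<bar> * ((g y)\<^sup>2 + (k x)\<^sup>2) \<partial>lborel \<partial>lborel) < \<infinity>"
  proof -
    have a: "(\<integral>\<^sup>+x. \<bar>\<kappa> x\<bar> \<partial>lborel) < \<infinity>"
      using Cc_integrable(1)[OF absk] by (simp add: integrable_iff_bounded)
    have gk: "(\<integral>\<^sup>+x. (g x)\<^sup>2 \<partial>lborel) < \<infinity>" "(\<integral>\<^sup>+x. (k x)\<^sup>2 \<partial>lborel) < \<infinity>"
      using L2_integrable_sq[OF gL] L2_integrable_sq[OF kL] by (simp_all add: integrable_iff_bounded nn_integral_completion)
    have "(\<integral>\<^sup>+x. \<integral>\<^sup>+y. \<bar>\<kappa> (x - y)\<bar> * ((g y)\<^sup>2 + (k x)\<^sup>2) \<partial>lborel \<partial>lborel) =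
       (\<integral>\<^sup>+x. \<integral>\<^sup>+y. (ennreal \<bar>\<kappa> (x - y)\<bar> * ennreal ((g y)\<^sup>2) + ennreal \<bar>\<kappa> (x - y)\<bar> * ennreal ((k x)\<^sup>2)) \<partial>lborel \<partial>lborel)"
      by (intro nn_integral_cong) (simp add: distrib_left flip: ennreal_mult ennreal_plus)
    also have "\<dots> = (\<integral>\<^sup>+x. \<integral>\<^sup>+y. ennreal \<bar>\<kappa> (x - y)\<bar> * ennreal ((g y)\<^sup>2) \<partial>lborel \<partial>lborel) +
        (\<integral>\<^sup>+x. \<integral>\<^sup>+y. ennreal \<bar>\<kappa> (x - y)\<bar> * ennreal ((k x)\<^sup>2) \<partial>lborel \<partial>lborel)"
      by (simp add: nn_integral_add)
    also have "(\<integral>\<^sup>+x. \<integral>\<^sup>+y. ennreal \<bar>\<kappa> (x - y)\<bar> * ennreal ((g y)\<^sup>2) \<partial>lborel \<partial>lborel) =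
        (\<integral>\<^sup>+y. \<integral>\<^sup>+x. ennreal \<bar>\<kappa> (x - y)\<bar> * ennreal ((g y)\<^sup>2) \<partial>lborel \<partial>lborel)"
      by (rule lborel_pair.Fubini'[symmetric]) measurable
    also have "\<dots> = (\<integral>\<^sup>+x. \<bar>\<kappa> x\<bar> \<partial>lborel) * (\<integral>\<^sup>+x. (g x)\<^sup>2 \<partial>lborel)"
      using nn_integral_lborel_translate[of "\<lambda>y. ennreal \<bar>\<kappa> y\<bar>"]
      by (simp add: nn_integral_multc nn_integral_cmult)
    also have "(\<integral>\<^sup>+x. \<integral>\<^sup>+y. ennreal \<bar>\<kappa> (x - y)\<bar> * ennreal ((k x)\<^sup>2) \<partial>lborel \<partial>lborel) =
       (\<integral>\<^sup>+x. \<bar>\<kappa> x\<bar> \<partial>lborel) * (\<integral>\<^sup>+x. (k x)\<^sup>2 \<partial>lborel)"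
      using nn_integral_lborel_reflect[of "\<lambda>y. ennreal \<bar>\<kappa> y\<bar>"]
      by (simp add: nn_integral_multc nn_integral_cmult)
    finally show ?thesis using a gk by (simp add: ennreal_mult_less_top)
  qed
  have int: "integrable (lborel \<Otimes>\<^sub>M lborel) (\<lambda>(x, y). \<kappa> (x - y) * g y * k x)"
  proof (rule Bochner_Integration.integrable_bound)
    show "integrable (lborel \<Otimes>\<^sub>M lborel) (\<lambda>(x, y). \<bar>\<kappa> (x - y)\<bar> * ((g y)\<^sup>2 + (k x)\<^sup>2))"
      unfolding integrable_iff_bounded using fin
      by (subst lborel.nn_integral_fst[symmetric]) (auto simp: split_beta' abs_mult)
    show "AE z in lborel \<Otimes>\<^sub>M lborel. norm (case z of (x, y) \<Rightarrow> \<kappa> (x - y) * g y * k x)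
        \<le> norm (case z of (x, y) \<Rightarrow> \<bar>\<kappa> (x - y)\<bar> * ((g y)\<^sup>2 + (k x)\<^sup>2))"
    proof (rule AE_I2)
      fix z :: "R3 \<times> R3"
      obtain x y where z: "z = (x, y)" by (cases z)
      have "2 * (\<bar>g y\<bar> * \<bar>k x\<bar>) \<le> (g y)\<^sup>2 + (k x)\<^sup>2"
        using sum_squares_bound[of "\<bar>g y\<bar>" "\<bar>k x\<bar>"] by (simp add: mult_ac)
      moreover have "0 \<le> \<bar>g y\<bar> * \<bar>k x\<bar>" by simp
      ultimately have "\<bar>g y\<bar> * \<bar>k x\<bar> \<le> (g y)\<^sup>2 + (k x)\<^sup>2" by linarith
      from mult_left_mono[OF this abs_ge_zero[of "\<kappa> (x - y)"]]
      show "norm (case z of (x, y) \<Rightarrow> \<kappa> (x - y) * g y * k x)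
        \<le> norm (case z of (x, y) \<Rightarrow> \<bar>\<kappa> (x - y)\<bar> * ((g y)\<^sup>2 + (k x)\<^sup>2))"
        by (simp add: z abs_mult mult.assoc)
    qed
  qed measurable
  have "(\<integral>x. conv \<kappa> f x * h x \<partial>lebesgue) = (\<integral>x. conv \<kappa> g x * k x \<partial>lebesgue)"
    unfolding eq using inner_mk[OF cL(1) assms(4)] inner_mk[OF cL(1) kL] mk_eq by simp
  also have "\<dots> = (\<integral>x. (\<integral>y. \<kappa> (x - y) * g y * k x \<partial>lborel) \<partial>lborel)"
    by (simp add: conv_def integral_completion)
  also have "\<dots> = (\<integral>y. (\<integral>x. \<kappa> (x - y) * g y * k x \<partial>lborel) \<partial>lborel)"
    using lborel_pair.Fubini_integral[of "\<lambda>x y. \<kappa> (x - y) * g y * k x"] int by simp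
  also have "\<dots> = (\<integral>y. g y * (\<integral>x. \<kappa> (y - x) * k x \<partial>lborel) \<partial>lborel)"
    using assms(2)[of "_ - _"] by (simp add: mult.assoc mult.left_commute)
  also have "\<dots> = (\<integral>y. g y * conv \<kappa> k y \<partial>lebesgue)"
    by (simp add: conv_def integral_completion)
  also have "\<dots> = (\<integral>x. f x * conv \<kappa> h x \<partial>lebesgue)"
    unfolding eq using inner_mk[OF assms(3) cL(2)] inner_mk[OF gL cL(2)] mk_eq by simp
  finally show ?thesis .
qed

section \<open>Convolution as a bounded operator\<close>

definition Conv :: "(R3 \<Rightarrow> real) \<Rightarrow> l2 \<Rightarrow> l2" where
  "Conv \<kappa> a = mk (conv \<kappa> (rep a))"

lemma Conv_mk:
  assumes "\<kappa> \<in> test_functions" "f \<in> L2"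
  shows "Conv \<kappa> (mk f) = mk (conv \<kappa> f)"
  using conv_cong[OF test_Cc[OF assms(1)] rep_measurable L2_measurable[OF assms(2)] rep_mk_AE[OF assms(2)]]
  by (simp add: Conv_def)

lemma norm_Conv_le:
  assumes "\<kappa> \<in> test_functions"
  shows "norm (Conv \<kappa> a) \<le> (\<integral>x. \<bar>\<kappa> x\<bar> \<partial>lebesgue) * norm a"
proof (rule power2_le_imp_le)
  have "(norm (mk (rep a)))\<^sup>2 = (\<integral>x. (rep a x)\<^sup>2 \<partial>lebesgue)" by (rule norm_mk_sq) simp
  then show "(norm (Conv \<kappa> a))\<^sup>2 \<le> ((\<integral>x. \<bar>\<kappa> x\<bar> \<partial>lebesgue) * norm a)\<^sup>2"
    unfolding Conv_def norm_mk_sq[OF conv_L2(1)[OF assms rep_L2]] power_mult_distrib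
    using conv_L2(2)[OF assms rep_L2, of a] by simp
qed simp

lemma bounded_linear_Conv:
  assumes "\<kappa> \<in> test_functions"
  shows "bounded_linear (Conv \<kappa>)"
proof (rule bounded_linear_intro)
  note L = conv_L2(1)[OF assms]
  show "Conv \<kappa> (a + b) = Conv \<kappa> a + Conv \<kappa> b" for a b
  proof -
    have "Conv \<kappa> (a + b) = Conv \<kappa> (mk (\<lambda>x. rep a x + rep b x))" by (simp add: plus_l2_def)
    also have "\<dots> = mk (conv \<kappa> (\<lambda>x. rep a x + rep b x))"
      by (intro Conv_mk assms L2_add rep_L2)
    also have "\<dots> = mk (\<lambda>x. conv \<kappa> (rep a) x + conv \<kappa> (rep b) x)"
      by (rule arg_cong[where f=mk], intro ext conv_add test_Cc assms rep_L2)
    also have "\<dots> = Conv \<kappa> a + Conv \<kappa> b" unfolding Conv_def by (intro mk_add L) auto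
    finally show ?thesis .
  qed
  show "Conv \<kappa> (r *\<^sub>R a) = r *\<^sub>R Conv \<kappa> a" for r a
  proof -
    have "Conv \<kappa> (r *\<^sub>R a) = Conv \<kappa> (mk (\<lambda>x. r * rep a x))" by (simp add: scaleR_l2_def)
    also have "\<dots> = mk (conv \<kappa> (\<lambda>x. r * rep a x))"
      by (intro Conv_mk assms L2_cmult rep_L2)
    also have "\<dots> = mk (\<lambda>x. r * conv \<kappa> (rep a) x)"
      by (rule arg_cong[where f=mk], intro ext conv_cmult)
    also have "\<dots> = r *\<^sub>R Conv \<kappa> a" unfolding Conv_def by (intro mk_cmult L) auto
    finally show ?thesis .
  qed
  show "norm (Conv \<kappa> a) \<le> norm a * (\<integral>x. \<bar>\<kappa> x\<bar> \<partial>lebesgue)" for a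
    using norm_Conv_le[OF assms] by (simp add: mult.commute)
qed

lemma Conv_adjoint:
  assumes "\<kappa> \<in> test_functions" "\<And>x. \<kappa> (- x) = \<kappa> x"
  shows "Conv \<kappa> a \<bullet> b = a \<bullet> Conv \<kappa> b"
proof -
  have "Conv \<kappa> a \<bullet> mk (rep b) = mk (rep a) \<bullet> Conv \<kappa> b"
    unfolding Conv_def by (simp add: inner_mk conv_L2(1) assms conv_adjoint del: mk_rep)
  then show ?thesis by simp
qed

subsection \<open>Approximation by test functions\<close>

lemma L2_dominated_convergence:
  fixes f :: "R3 \<Rightarrow> real" and s :: "nat \<Rightarrow> R3 \<Rightarrow> real"
  assumes [measurable]: "f \<in> borel_measurable lebesgue" "\<And>n. s n \<in> borel_measurable lebesgue"
    and w: "w \<in> L2"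
    and lim: "AE x in lebesgue. (\<lambda>n. s n x) \<longlonglongrightarrow> f x"
    and bound: "\<And>n. AE x in lebesgue. \<bar>s n x\<bar> \<le> w x"
  shows "f \<in> L2" "\<And>n. s n \<in> L2" "(\<lambda>n. mk (s n)) \<longlonglongrightarrow> mk f"
proof -
  have w0: "AE x in lebesgue. \<bar>w x\<bar> = w x" using bound[of 0] by eventually_elim simp
  have ball: "AE x in lebesgue. \<forall>n. \<bar>s n x\<bar> \<le> w x" using bound by (simp add: AE_all_countable)
  show sL: "s n \<in> L2" for n
  proof (rule L2_dominated[OF w])
    show "AE x in lebesgue. \<bar>s n x\<bar> \<le> \<bar>w x\<bar>" using bound[of n] w0 by eventually_elim simp
  qed measurable
  have fb: "AE x in lebesgue. \<bar>f x\<bar> \<le> w x"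
    using lim ball
  proof eventually_elim
    case (elim x)
    show ?case by (rule LIMSEQ_le_const2[OF tendsto_rabs[OF elim(1)]]) (use elim(2) in auto)
  qed
  show fL: "f \<in> L2"
  proof (rule L2_dominated[OF w])
    show "AE x in lebesgue. \<bar>f x\<bar> \<le> \<bar>w x\<bar>" using fb w0 by eventually_elim simp
  qed measurable
  have "(\<lambda>n. \<integral>x. (s n x - f x)\<^sup>2 \<partial>lebesgue) \<longlonglongrightarrow> (\<integral>x. 0 \<partial>(lebesgue :: R3 measure))"
  proof (rule integral_dominated_convergence[where w="\<lambda>x. (2 * w x)\<^sup>2"])
    show "integrable lebesgue (\<lambda>x. (2 * w x)\<^sup>2)" by (intro L2_integrable_sq L2_cmult w)
    show "AE x in lebesgue. (\<lambda>n. (s n x - f x)\<^sup>2) \<longlonglongrightarrow> 0"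
      using lim
    proof eventually_elim
      case (elim x)
      have "(\<lambda>n. (s n x - f x)\<^sup>2) \<longlonglongrightarrow> (f x - f x)\<^sup>2" by (intro tendsto_intros elim)
      then show ?case by simp
    qed
    show "AE x in lebesgue. norm ((s n x - f x)\<^sup>2) \<le> (2 * w x)\<^sup>2" for n
      using bound[of n] fb
    proof eventually_elim
      case (elim x)
      then have "\<bar>s n x - f x\<bar> \<le> \<bar>2 * w x\<bar>" by linarith
      then show ?case by (simp add: abs_le_square_iff)
    qed
  qed measurable
  moreover have "(norm (mk (s n) - mk f))\<^sup>2 = (\<integral>x. (s n x - f x)\<^sup>2 \<partial>lebesgue)" for n
    using norm_mk_sq[OF L2_diff[OF sL fL]] mk_diff[OF sL fL] by simp
  ultimately have "(\<lambda>n. (norm (mk (s n) - mk f))\<^sup>2) \<longlonglongrightarrow> 0" by simp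
  from tendsto_real_sqrt[OF this] have "(\<lambda>n. norm (mk (s n) - mk f)) \<longlonglongrightarrow> 0" by simp
  then show "(\<lambda>n. mk (s n)) \<longlonglongrightarrow> mk f"
    using Lim_null tendsto_norm_zero_iff by blast
qed

definition trunc :: "nat \<Rightarrow> (R3 \<Rightarrow> real) \<Rightarrow> R3 \<Rightarrow> real" where
  "trunc n f x = indicator (cball 0 (real n)) x * f x"

lemma eventually_in_cball: "\<forall>\<^sub>F n in sequentially. (x :: R3) \<in> cball 0 (real n)"
proof -
  obtain N where "norm x \<le> real N" using real_arch_simple by blast
  then show ?thesis by (auto simp: eventually_sequentially intro!: exI[of _ N])
qed

lemma trunc_L2:
  assumes "f \<in> L2"
  shows "trunc n f \<in> L2"
proof (rule L2_dominated[OF assms])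
  show "trunc n f \<in> borel_measurable lebesgue"
    unfolding trunc_def[abs_def] using L2_measurable[OF assms]
    by (intro borel_measurable_times borel_measurable_indicator) simp_all
qed (auto simp: trunc_def indicator_def)

lemma trunc_support: "norm x > real n \<Longrightarrow> trunc n f x = 0"
  by (simp add: trunc_def indicator_def)

lemma trunc_tendsto:
  assumes "f \<in> L2"
  shows "(\<lambda>n. mk (trunc n f)) \<longlonglongrightarrow> mk f"
proof (rule L2_dominated_convergence(3))
  note [measurable] = L2_measurable[OF assms]
  show "(\<lambda>x. \<bar>f x\<bar>) \<in> L2"
    by (rule L2_dominated[OF assms]) auto
  show "AE x in lebesgue. (\<lambda>n. trunc n f x) \<longlonglongrightarrow> f x"
  proof (rule AE_I2)
    fix x
    show "(\<lambda>n. trunc n f x) \<longlonglongrightarrow> f x"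
      by (rule tendsto_eventually, use eventually_in_cball[of x] in eventually_elim) (simp add: trunc_def)
  qed
qed (use L2_measurable[OF assms] L2_measurable[OF trunc_L2[OF assms]] in \<open>auto simp: trunc_def indicator_def\<close>)

text \<open>Measurability supplies continuous functions that converge to \<open>f\<close> off a null
  set, without any domination. Clamping their values to [-M, M] and multiplying by a continuous
  cutoff enforces a common majorant and compact support, and neither operation changes the limit.
  One \<open>M\<close> bounds both the values and the support.\<close>

lemma Cc_dense_bounded:
  assumes [measurable]: "f \<in> borel_measurable lebesgue"
    and M: "\<And>x. \<bar>f x\<bar> \<le> M" "\<And>x. norm x > M \<Longrightarrow> f x = 0"
  shows "\<exists>g. (\<forall>n. g n \<in> Cc) \<and> (\<lambda>n. mk (g n)) \<longlonglongrightarrow> mk f"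
proof -
  have "f measurable_on UNIV"
    by (rule lebesgue_measurable_imp_measurable_on) auto
  then obtain N g where N: "negligible N" and g: "\<And>n. continuous_on UNIV (g n)"
    and lim: "\<And>x. x \<notin> N \<Longrightarrow> (\<lambda>n. g n x) \<longlonglongrightarrow> f x"
    by (auto simp: measurable_on_def)
  define cut where "cut x = max 0 (min 1 (M + 1 - norm x))" for x :: R3
  define h where "h n x = max (- M) (min M (g n x)) * cut x" for n x
  have M0: "M \<ge> 0" using M(1)[of 0] by linarith
  have hC: "h n \<in> Cc" for n
    unfolding Cc_def h_def cut_def using g[of n]
    by (auto intro!: continuous_intros exI[of _ "M + 1"])
  have "(\<lambda>n. mk (h n)) \<longlonglongrightarrow> mk f"
  proof (rule L2_dominated_convergence(3)[where w="\<lambda>x. M * indicator (cball 0 (M + 1)) x"])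
    show "h n \<in> borel_measurable lebesgue" for n by (rule Cc_measurable_lebesgue[OF hC])
    show "(\<lambda>x. M * indicator (cball 0 (M + 1)) x) \<in> L2" by (intro L2_cmult indicator_L2)
    show "AE x in lebesgue. \<bar>h n x\<bar> \<le> M * indicator (cball 0 (M + 1)) x" for n
    proof (rule AE_I2)
      fix x
      have "\<bar>max (- M) (min M (g n x))\<bar> \<le> M" using M0 by linarith
      moreover have "\<bar>cut x\<bar> \<le> indicator (cball 0 (M + 1)) x" by (auto simp: cut_def indicator_def)
      ultimately show "\<bar>h n x\<bar> \<le> M * indicator (cball 0 (M + 1)) x"
        unfolding h_def abs_mult using M0 by (intro mult_mono) auto
    qed
    have "AE x in lebesgue. x \<notin> N" using N by (simp add: negligible_iff_null_sets AE_not_in)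
    then show "AE x in lebesgue. (\<lambda>n. h n x) \<longlonglongrightarrow> f x"
    proof eventually_elim
      case (elim x)
      have "(\<lambda>n. h n x) \<longlonglongrightarrow> max (- M) (min M (f x)) * cut x"
        unfolding h_def by (intro tendsto_intros lim elim)
      moreover have "max (- M) (min M (f x)) = f x" using M(1)[of x] by linarith
      moreover have "f x * cut x = f x" using M(2)[of x] by (cases "norm x > M") (auto simp: cut_def)
      ultimately show ?case by simp
    qed
  qed measurable
  with hC show ?thesis by blast
qed

lemma Cc_dense:
  assumes "e > 0"
  obtains g where "g \<in> Cc" "norm (a - mk g) < e"
proof -
  \<comment> \<open>Domain and values are truncated at the same height \<open>n\<close>, which is
    the shape that \<open>Cc_dense_bounded\<close> expects.\<close>
  define t where "t n x = indicator (cball 0 (real n)) x * max (- real n) (min (real n) (rep a x))" for n x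
  have t_meas: "t n \<in> borel_measurable lebesgue" for n
    unfolding t_def[abs_def] by (intro borel_measurable_times borel_measurable_indicator) (simp_all, measurable)
  have "(\<lambda>n. mk (t n)) \<longlonglongrightarrow> mk (rep a)"
  proof (rule L2_dominated_convergence(3)[where w="\<lambda>x. \<bar>rep a x\<bar>"])
    show "(\<lambda>x. \<bar>rep a x\<bar>) \<in> L2" by (rule L2_dominated[OF rep_L2[of a]]) auto
    show "AE x in lebesgue. (\<lambda>n. t n x) \<longlonglongrightarrow> rep a x"
    proof (rule AE_I2)
      fix x
      obtain N where "\<bar>rep a x\<bar> \<le> real N" using real_arch_simple by blast
      then have ev: "\<forall>\<^sub>F n in sequentially. \<bar>rep a x\<bar> \<le> real n"
        by (auto simp: eventually_sequentially intro!: exI[of _ N])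
      show "(\<lambda>n. t n x) \<longlonglongrightarrow> rep a x"
        by (intro tendsto_eventually, use ev eventually_in_cball[of x] in eventually_elim) (auto simp: t_def)
    qed
    show "AE x in lebesgue. \<bar>t n x\<bar> \<le> \<bar>rep a x\<bar>" for n
      by (rule AE_I2) (auto simp: t_def indicator_def)
  qed (use t_meas in auto)
  then have "\<forall>\<^sub>F n in sequentially. dist (mk (t n)) a < e / 2"
    using assms by (intro tendstoD) auto
  then obtain n where n: "dist (mk (t n)) a < e / 2" using eventually_happens'[OF sequentially_bot] by blast
  have "\<bar>t n x\<bar> \<le> real n" for x by (auto simp: t_def indicator_def)
  moreover have "t n x = 0" if "norm x > real n" for x using that by (simp add: t_def indicator_def)
  ultimately obtain g where g: "\<And>k. g k \<in> Cc" "(\<lambda>k. mk (g k)) \<longlonglongrightarrow> mk (t n)"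
    using Cc_dense_bounded[OF t_meas, of n "real n"] by blast
  then have "\<forall>\<^sub>F k in sequentially. dist (mk (g k)) (mk (t n)) < e / 2"
    using assms by (intro tendstoD) auto
  then obtain k where k: "dist (mk (g k)) (mk (t n)) < e / 2" using eventually_happens'[OF sequentially_bot] by blast
  have "dist a (mk (g k)) < e"
    using n k dist_triangle[of a "mk (g k)" "mk (t n)"] by (simp add: dist_commute)
  then show ?thesis using g(1) by (intro that[of "g k"]) (auto simp: dist_norm)
qed

section \<open>Mollifiers as an approximate identity\<close>

definition moll :: "nat \<Rightarrow> R3 \<Rightarrow> real" where
  "moll n = mollifier (1 / real (Suc n))"

lemma moll_test: "moll n \<in> test_functions"
  by (simp add: moll_def mollifier_test)

lemma moll_even: "moll n (- x) = moll n x"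
  by (simp add: moll_def mollifier_even)

lemma moll_nonneg: "moll n x \<ge> 0"
  by (simp add: moll_def mollifier_nonneg)

lemma moll_zero: "norm x \<ge> 1 / real (Suc n) \<Longrightarrow> moll n x = 0"
  by (simp add: moll_def mollifier_zero)

lemma moll_reflect_integral: "(\<integral>y. moll n (x - y) \<partial>lebesgue) = 1"
proof -
  have C: "moll n \<in> Cc" by (rule test_Cc[OF moll_test])
  note [measurable] = Cc_measurable[OF C]
  have "ennreal (\<integral>y. moll n (x - y) \<partial>lebesgue) = (\<integral>\<^sup>+y. moll n (x - y) \<partial>lebesgue)"
    by (rule nn_integral_eq_integral[symmetric]) (auto simp: moll_nonneg Cc_integrable Cc_reflect[OF C])
  also have "\<dots> = (\<integral>\<^sup>+y. moll n y \<partial>lebesgue)"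
    using nn_integral_lborel_reflect[of "\<lambda>y. ennreal (moll n y)" x] by (simp add: nn_integral_completion)
  also have "\<dots> = ennreal (\<integral>y. moll n y \<partial>lebesgue)"
    by (rule nn_integral_eq_integral) (auto simp: moll_nonneg Cc_integrable C)
  also have "(\<integral>y. moll n y \<partial>lebesgue) = 1" by (simp add: moll_def mollifier_integral)
  finally show ?thesis by (simp add: Bochner_Integration.integral_nonneg moll_nonneg)
qed

abbreviation P :: "nat \<Rightarrow> l2 \<Rightarrow> l2" where "P n \<equiv> Conv (moll n)"

lemma norm_P_le: "norm (P n a) \<le> norm a"
  using norm_Conv_le[OF moll_test, of n a]
  by (simp add: moll_nonneg) (simp add: moll_def mollifier_integral)

lemma moll_conv_tendsto:
  assumes "g \<in> Cc"
  shows "(\<lambda>n. conv (moll n) g x) \<longlonglongrightarrow> g x"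
proof (rule LIMSEQ_I)
  fix e :: real assume e: "e > 0"
  obtain d where d: "d > 0" "\<And>x y. norm (x - y) < d \<Longrightarrow> \<bar>g x - g y\<bar> < e / 2"
    by (rule Cc_uniformly_continuous[OF assms, of "e / 2"]) (use e in simp, blast)
  obtain N where N: "1 / real (Suc N) < d" using d(1) nat_approx_posE by blast
  have "norm (conv (moll n) g x - g x) < e" if n: "n \<ge> N" for n
  proof -
    have C: "moll n \<in> Cc" by (rule test_Cc[OF moll_test])
    have i1: "integrable lebesgue (\<lambda>y. moll n (x - y) * g y)" by (rule conv_integrable[OF C Cc_L2[OF assms]])
    have i2: "integrable lebesgue (\<lambda>y. moll n (x - y))" by (rule Cc_integrable(2)[OF Cc_reflect[OF C]])
    have "conv (moll n) g x - g x = (\<integral>y. moll n (x - y) * g y - moll n (x - y) * g x \<partial>lebesgue)"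
      using i1 i2 by (simp add: conv_def moll_reflect_integral)
    also have "\<bar>\<dots>\<bar> \<le> (\<integral>y. moll n (x - y) * (e / 2) \<partial>lebesgue)"
    proof (rule order_trans[OF integral_abs_bound], rule integral_mono)
      show "integrable lebesgue (\<lambda>y. \<bar>moll n (x - y) * g y - moll n (x - y) * g x\<bar>)"
        using i1 i2 by (intro integrable_abs Bochner_Integration.integrable_diff) auto
      show "integrable lebesgue (\<lambda>y. moll n (x - y) * (e / 2))" using i2 by simp
      fix y
      show "\<bar>moll n (x - y) * g y - moll n (x - y) * g x\<bar> \<le> moll n (x - y) * (e / 2)"
      proof (cases "norm (x - y) \<ge> 1 / real (Suc n)")
        case False
        have "1 / real (Suc n) \<le> 1 / real (Suc N)" using n by (simp add: frac_le)
        then have "norm (y - x) < d" using False N by (simp add: norm_minus_commute)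
        then have "\<bar>g y - g x\<bar> \<le> e / 2" using d(2) by (meson less_imp_le)
        from mult_left_mono[OF this moll_nonneg[of n "x - y"]]
        show ?thesis by (simp add: moll_nonneg abs_mult flip: right_diff_distrib)
      qed (simp add: moll_zero)
    qed
    also have "\<dots> = e / 2" by (simp add: moll_reflect_integral)
    finally show ?thesis using e by simp
  qed
  then show "\<exists>N. \<forall>n\<ge>N. norm (conv (moll n) g x - g x) < e" by blast
qed

lemma P_tendsto_Cc:
  assumes "g \<in> Cc"
  shows "(\<lambda>n. P n (mk g)) \<longlonglongrightarrow> mk g"
proof -
  obtain B r where B: "B > 0" "r > 0" "\<And>x. \<bar>g x\<bar> \<le> B" "\<And>x. norm x > r \<Longrightarrow> g x = 0"
    using Cc_bounded[OF assms] by metis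
  have L: "g \<in> L2" by (rule Cc_L2[OF assms])
  have "(\<lambda>n. mk (conv (moll n) g)) \<longlonglongrightarrow> mk g"
  proof (rule L2_dominated_convergence(3)[where w="\<lambda>x. B * indicator (cball 0 (r + 1)) x"])
    show "(\<lambda>x. B * indicator (cball 0 (r + 1)) x) \<in> L2" by (intro L2_cmult indicator_L2)
    show "AE x in lebesgue. \<bar>conv (moll n) g x\<bar> \<le> B * indicator (cball 0 (r + 1)) x" for n
    proof (rule AE_I2)
      fix x
      have C: "moll n \<in> Cc" by (rule test_Cc[OF moll_test])
      show "\<bar>conv (moll n) g x\<bar> \<le> B * indicator (cball 0 (r + 1)) x"
      proof (cases "norm x > r + 1")
        case True
        have "moll n (x - y) * g y = 0" for y
        proof (cases "norm y > r")
          case False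
          then have "norm (x - y) \<ge> 1" using True norm_triangle_ineq2[of x y] by simp
          moreover have "1 / real (Suc n) \<le> 1" by simp
          ultimately have "norm (x - y) \<ge> 1 / real (Suc n)" by linarith
          then show ?thesis by (simp add: moll_zero)
        qed (simp add: B)
        then have "(\<lambda>y. moll n (x - y) * g y) = (\<lambda>_. 0)" by (rule ext)
        then show ?thesis using B(1) by (simp add: conv_def)
      next
        case False
        have "\<bar>conv (moll n) g x\<bar> \<le> (\<integral>y. moll n (x - y) * B \<partial>lebesgue)"
          unfolding conv_def
        proof (rule order_trans[OF integral_abs_bound], rule integral_mono)
          show "integrable lebesgue (\<lambda>y. \<bar>moll n (x - y) * g y\<bar>)"
            by (rule integrable_abs[OF conv_integrable[OF C L]])
          show "integrable lebesgue (\<lambda>y. moll n (x - y) * B)"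
            using Cc_integrable(2)[OF Cc_reflect[OF C]] by simp
          show "\<bar>moll n (x - y) * g y\<bar> \<le> moll n (x - y) * B" for y
            using mult_left_mono[OF B(3)[of y] moll_nonneg[of n "x - y"]] by (simp add: abs_mult moll_nonneg)
        qed
        then show ?thesis using False by (simp add: moll_reflect_integral)
      qed
    qed
  qed (auto intro: L2_measurable L conv_L2(1)[OF moll_test] moll_conv_tendsto[OF assms])
  then show ?thesis by (simp add: Conv_mk moll_test L)
qed

text \<open>Density and equicontinuity: the convergence holds on the dense set \<open>Cc\<close>,
  and all \<open>P n\<close> are contractions because the mollifiers are nonnegative with integral
  one.\<close>

lemma P_tendsto: "(\<lambda>n. P n a) \<longlonglongrightarrow> a"
proof (rule LIMSEQ_I)
  fix e :: real assume e: "e > 0"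
  obtain g where g: "g \<in> Cc" "norm (a - mk g) < e / 3" by (rule Cc_dense[of "e / 3" a]) (use e in auto)
  have "\<forall>\<^sub>F n in sequentially. dist (P n (mk g)) (mk g) < e / 3"
    using e by (intro tendstoD P_tendsto_Cc g) auto
  then obtain N where N: "\<And>n. n \<ge> N \<Longrightarrow> dist (P n (mk g)) (mk g) < e / 3"
    by (auto simp: eventually_sequentially)
  have "norm (P n a - a) < e" if "n \<ge> N" for n
  proof -
    interpret bounded_linear "P n" by (rule bounded_linear_Conv[OF moll_test])
    have "P n a - a = P n (a - mk g) + (P n (mk g) - mk g) - (a - mk g)" by (simp add: diff)
    then have "norm (P n a - a) \<le> norm (P n (a - mk g)) + norm (P n (mk g) - mk g) + norm (a - mk g)"
      by (metis (no_types) norm_triangle_ineq4 norm_triangle_ineq add_right_mono order_trans)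
    moreover have "norm (P n (a - mk g)) \<le> norm (a - mk g)" by (rule norm_P_le)
    moreover have "norm (P n (mk g) - mk g) < e / 3" using N[OF that] by (simp add: dist_norm)
    ultimately show ?thesis using g(2) by linarith
  qed
  then show "\<exists>N. \<forall>n\<ge>N. norm (P n a - a) < e" by blast
qed

subsection \<open>Weak gradients\<close>

definition grad :: "3 \<Rightarrow> (R3 \<Rightarrow> real) \<Rightarrow> l2" where
  "grad i f = mk (\<lambda>x. weak_gradient f x $ i)"

lemma L2_component:
  fixes g :: "R3 \<Rightarrow> R3"
  assumes "g \<in> L2"
  shows "(\<lambda>x. g x $ i) \<in> L2"
proof (rule L2I)
  have g: "g \<in> borel_measurable lebesgue" "integrable lebesgue (\<lambda>x. (norm (g x))\<^sup>2)"
    using assms by (auto simp: L2_def)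
  show *: "(\<lambda>x. g x $ i) \<in> borel_measurable lebesgue"
    by (rule measurable_compose[OF g(1)]) (simp add: borel_measurable_continuous_onI continuous_on_component continuous_on_id)
  show "integrable lebesgue (\<lambda>x. (g x $ i)\<^sup>2)"
  proof (rule Bochner_Integration.integrable_bound[OF g(2)])
    show "(\<lambda>x. (g x $ i)\<^sup>2) \<in> borel_measurable lebesgue" using * by measurable
    show "AE x in lebesgue. norm ((g x $ i)\<^sup>2) \<le> norm ((norm (g x))\<^sup>2)"
      using component_le_norm_cart by (auto simp: abs_le_square_iff[symmetric])
  qed
qed

lemma H1_L2: "f \<in> H1 \<Longrightarrow> f \<in> L2"
  by (simp add: H1_def)

lemma H1_weak_gradient:
  assumes "f \<in> H1"
  shows "weak_gradient f \<in> L2" "has_weak_gradient f (weak_gradient f)"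
proof -
  have "\<exists>g. g \<in> L2 \<and> has_weak_gradient f g" using assms by (auto simp: H1_def)
  then have "weak_gradient f \<in> L2 \<and> has_weak_gradient f (weak_gradient f)"
    unfolding weak_gradient_def by (rule someI_ex)
  then show "weak_gradient f \<in> L2" "has_weak_gradient f (weak_gradient f)" by auto
qed

text \<open>This identity is the bridge between the chosen weak gradient and the function itself:
  its left side depends on \<open>f\<close> only through its class.\<close>

lemma Conv_grad:
  assumes "\<kappa> \<in> test_functions" "f \<in> H1"
  shows "Conv (partial i \<kappa>) (mk f) = Conv \<kappa> (grad i f)"
  unfolding grad_def using assms
  by (simp add: Conv_mk test_partial H1_L2 L2_component H1_weak_gradient
      conv_weak_gradient[OF assms(1) H1_L2[OF assms(2)] H1_weak_gradient(2)[OF assms(2)]])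

lemma H1_diff:
  assumes "f \<in> H1" "g \<in> H1"
  shows "(\<lambda>x. f x - g x) \<in> H1"
proof -
  let ?F = "weak_gradient f" and ?G = "weak_gradient g"
  have "has_weak_gradient (\<lambda>x. f x - g x) (\<lambda>x. ?F x - ?G x)"
    unfolding has_weak_gradient_def
  proof (intro ballI allI)
    fix \<phi> i assume \<phi>: "\<phi> \<in> test_functions"
    have "\<phi> \<in> L2" "partial i \<phi> \<in> L2" by (auto intro: Cc_L2 test_Cc test_partial \<phi>)
    moreover have "f \<in> L2" "g \<in> L2" "(\<lambda>x. ?F x $ i) \<in> L2" "(\<lambda>x. ?G x $ i) \<in> L2"
      using assms by (auto intro: H1_L2 L2_component H1_weak_gradient)
    moreover have "(\<integral>x. f x * partial i \<phi> x \<partial>lebesgue) = - (\<integral>x. ?F x $ i * \<phi> x \<partial>lebesgue)"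
      "(\<integral>x. g x * partial i \<phi> x \<partial>lebesgue) = - (\<integral>x. ?G x $ i * \<phi> x \<partial>lebesgue)"
      using H1_weak_gradient(2)[OF assms(1)] H1_weak_gradient(2)[OF assms(2)] \<phi>
      by (auto simp: has_weak_gradient_def)
    ultimately show "(\<integral>x. (f x - g x) * partial i \<phi> x \<partial>lebesgue) = - (\<integral>x. (?F x - ?G x) $ i * \<phi> x \<partial>lebesgue)"
      by (simp add: left_diff_distrib L2_mult_integrable)
  qed
  moreover have "(\<lambda>x. ?F x - ?G x) \<in> L2"
  proof -
    have [measurable]: "?F \<in> borel_measurable lebesgue" "?G \<in> borel_measurable lebesgue"
      and int: "integrable lebesgue (\<lambda>x. (norm (?F x))\<^sup>2)" "integrable lebesgue (\<lambda>x. (norm (?G x))\<^sup>2)"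
      using H1_weak_gradient(1)[OF assms(1)] H1_weak_gradient(1)[OF assms(2)] by (auto simp: L2_def)
    have "integrable lebesgue (\<lambda>x. (norm (?F x - ?G x))\<^sup>2)"
    proof (rule Bochner_Integration.integrable_bound)
      show "integrable lebesgue (\<lambda>x. 2 * (norm (?F x))\<^sup>2 + 2 * (norm (?G x))\<^sup>2)" using int by simp
      show "AE x in lebesgue. norm ((norm (?F x - ?G x))\<^sup>2) \<le> norm (2 * (norm (?F x))\<^sup>2 + 2 * (norm (?G x))\<^sup>2)"
      proof (rule AE_I2)
        fix x
        have "(norm (?F x - ?G x))\<^sup>2 \<le> (norm (?F x) + norm (?G x))\<^sup>2"
          by (intro power_mono norm_triangle_ineq4) auto
        also have "\<dots> \<le> 2 * (norm (?F x))\<^sup>2 + 2 * (norm (?G x))\<^sup>2"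
          using sum_squares_bound[of "norm (?F x)" "norm (?G x)"] by (simp add: power2_sum)
        finally show "norm ((norm (?F x - ?G x))\<^sup>2) \<le> norm (2 * (norm (?F x))\<^sup>2 + 2 * (norm (?G x))\<^sup>2)"
          by simp
      qed
    qed measurable
    then show ?thesis by (simp add: L2_def)
  qed
  ultimately show ?thesis using assms by (auto simp: H1_def intro: L2_diff)
qed

text \<open>The choice in \<open>weak_gradient\<close> gives no relation between representatives for
  \<open>f\<close>, \<open>g\<close> and their difference. After mollification all derivatives sit
  on the kernel, where linearity is available, and \<open>P n\<close> tends to the identity.\<close>

lemma grad_diff:
  assumes "f \<in> H1" "g \<in> H1"
  shows "grad i (\<lambda>x. f x - g x) = grad i f - grad i g"
proof -
  have "P n (grad i (\<lambda>x. f x - g x)) = P n (grad i f - grad i g)" for n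
  proof -
    interpret p: bounded_linear "P n" by (rule bounded_linear_Conv[OF moll_test])
    interpret q: bounded_linear "Conv (partial i (moll n))" by (rule bounded_linear_Conv[OF test_partial[OF moll_test]])
    show ?thesis
      using assms by (simp add: Conv_grad[OF moll_test, symmetric] H1_diff mk_diff H1_L2 q.diff p.diff)
  qed
  then have "(\<lambda>n. P n (grad i f - grad i g)) \<longlonglongrightarrow> grad i (\<lambda>x. f x - g x)"
    using P_tendsto[of "grad i (\<lambda>x. f x - g x)"] by simp
  then show ?thesis by (rule LIMSEQ_unique[OF _ P_tendsto])
qed

lemma L2_norm_sq_components:
  fixes g :: "R3 \<Rightarrow> R3"
  assumes "g \<in> L2"
  shows "(L2_norm g)\<^sup>2 = (\<Sum>i\<in>UNIV. (norm (mk (\<lambda>x. g x $ i)))\<^sup>2)"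
proof -
  have "(L2_norm g)\<^sup>2 = (\<integral>x. (norm (g x))\<^sup>2 \<partial>lebesgue)" by (simp add: L2_norm_def)
  also have "\<dots> = (\<integral>x. (\<Sum>i\<in>UNIV. (g x $ i)\<^sup>2) \<partial>lebesgue)"
    by (simp add: power2_norm_eq_inner inner_vec_def) (simp add: power2_eq_square)
  also have "\<dots> = (\<Sum>i\<in>UNIV. (norm (mk (\<lambda>x. g x $ i)))\<^sup>2)"
    by (simp add: Bochner_Integration.integral_sum L2_integrable_sq L2_component assms norm_mk_sq)
  finally show ?thesis .
qed

lemma H1_norm_sq:
  assumes "f \<in> H1"
  shows "(H1_norm f)\<^sup>2 = (\<Sum>i\<in>UNIV. (norm (grad i f))\<^sup>2) + (norm (mk f))\<^sup>2"
  unfolding H1_norm_def grad_def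
  by (simp add: L2_norm_sq_components H1_weak_gradient[OF assms] norm_mk H1_L2[OF assms] sum_nonneg)

text \<open>The order of choices matters. For a fixed mollifier the derivatives fall on the kernel,
  so mollifying a truncation of \<open>f\<close> is continuous in L2 even though the truncation is
  by a discontinuous indicator. Hence \<open>n\<close> is chosen before the truncation radius
  \<open>m\<close>.\<close>

lemma test_dense_H1:
  assumes "f \<in> H1" "e > 0"
  obtains \<phi> where "\<phi> \<in> test_functions" "norm (mk \<phi> - mk f) < e" "\<And>i. norm (mk (partial i \<phi>) - grad i f) < e"
proof -
  have L: "f \<in> L2" by (rule H1_L2[OF assms(1)])
  have "\<forall>\<^sub>F n in sequentially. dist (P n (mk f)) (mk f) < e / 2 \<and> (\<forall>i\<in>UNIV. dist (P n (grad i f)) (grad i f) < e / 2)"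
    using assms(2) by (intro eventually_conj eventually_ball_finite ballI tendstoD P_tendsto) auto
  then obtain n where n: "dist (P n (mk f)) (mk f) < e / 2" "\<And>i. dist (P n (grad i f)) (grad i f) < e / 2"
    using eventually_happens'[OF sequentially_bot] by blast
  let ?\<phi> = "\<lambda>m. conv (moll n) (trunc m f)"
  have \<phi>: "?\<phi> m \<in> test_functions" for m
    by (rule conv_test[OF moll_test trunc_L2[OF L] trunc_support])
  have lim: "(\<lambda>m. mk (conv \<kappa> (trunc m f))) \<longlonglongrightarrow> Conv \<kappa> (mk f)" if "\<kappa> \<in> test_functions" for \<kappa>
    using bounded_linear.tendsto[OF bounded_linear_Conv[OF that] trunc_tendsto[OF L]]
    by (simp add: Conv_mk that trunc_L2 L)
  have "\<forall>\<^sub>F m in sequentially. dist (mk (?\<phi> m)) (P n (mk f)) < e / 2 \<and>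
      (\<forall>i\<in>UNIV. dist (mk (conv (partial i (moll n)) (trunc m f))) (Conv (partial i (moll n)) (mk f)) < e / 2)"
    using assms(2) by (intro eventually_conj eventually_ball_finite ballI tendstoD lim moll_test test_partial) auto
  then obtain m where m: "dist (mk (?\<phi> m)) (P n (mk f)) < e / 2"
    "\<And>i. dist (mk (partial i (?\<phi> m))) (P n (grad i f)) < e / 2"
    using eventually_happens'[OF sequentially_bot]
    by (auto simp: partial_conv[OF moll_test trunc_L2[OF L]] Conv_grad[OF moll_test assms(1)])
  have "dist (mk (?\<phi> m)) (mk f) < e" using dist_triangle_half_r[of "P n (mk f)" _ e] m(1) n(1) by (simp add: dist_commute)
  moreover have "dist (mk (partial i (?\<phi> m))) (grad i f) < e" for i
    using dist_triangle_half_r[of "P n (grad i f)" _ e] m(2)[of i] n(2)[of i] by (simp add: dist_commute)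
  ultimately show ?thesis using \<phi>[of m] by (intro that[of "?\<phi> m"]) (auto simp: dist_norm)
qed

subsection \<open>The Sobolev inequality\<close>

definition coords :: "real \<times> real \<times> real \<Rightarrow> R3" where
  "coords = (\<lambda>(a, b, c). vector [a, b, c])"

lemma coords_nth: "coords (a, b, c) $ 1 = a" "coords (a, b, c) $ 2 = b" "coords (a, b, c) $ 3 = c"
  by (simp_all add: coords_def)

lemma coords_eq: "coords (a, b, c) = a *\<^sub>R axis 1 1 + b *\<^sub>R axis 2 1 + c *\<^sub>R axis 3 1"
  by (simp add: vec_eq_iff forall_3 coords_nth axis_def)

lemma continuous_coords: "continuous_on UNIV coords"
proof -
  have eq: "coords = (\<lambda>p. fst p *\<^sub>R axis 1 1 + fst (snd p) *\<^sub>R axis 2 1 + snd (snd p) *\<^sub>R axis 3 1)"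
    by (auto simp: fun_eq_iff coords_eq)
  show ?thesis by (subst eq) (intro continuous_intros)
qed

lemma measurable_coords [measurable]: "coords \<in> borel_measurable borel"
  by (rule borel_measurable_continuous_onI[OF continuous_coords])

text \<open>Both measures agree on boxes, because \<open>coords\<close> identifies a box with the
  product of its three sides. The purpose is to express integrals over space as iterated line
  integrals.\<close>

lemma lborel_coords: "lborel = distr lborel borel coords"
proof (rule lborel_eqI)
  fix l u :: R3
  assume le: "\<And>b. b \<in> Basis \<Longrightarrow> l \<bullet> b \<le> u \<bullet> b"
  have le': "l $ i \<le> u $ i" for i
    using le[of "axis i 1"] by (simp add: inner_axis axis_in_Basis_iff)
  let ?l = "(l $ 1, l $ 2, l $ 3)" and ?u = "(u $ 1, u $ 2, u $ 3)"
  have "coords (a, b, c) \<in> box l u \<longleftrightarrow> (a, b, c) \<in> box ?l ?u" for a b c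
  proof -
    have "(a, b, c) \<in> box ?l ?u \<longleftrightarrow> (\<forall>i. l $ i < coords (a, b, c) $ i \<and> coords (a, b, c) $ i < u $ i)"
      by (auto simp: box_def Basis_prod_def forall_3 coords_nth)
    then show ?thesis by (simp add: mem_box_cart)
  qed
  then have "coords -` box l u = box ?l ?u" by auto
  then have "emeasure (distr lborel borel coords) (box l u) = emeasure lborel (box ?l ?u)"
    by (simp add: emeasure_distr)
  also have "\<dots> = ennreal ((u $ 1 - l $ 1) * ((u $ 2 - l $ 2) * (u $ 3 - l $ 3)))"
  proof -
    have "(Basis :: (real \<times> real \<times> real) set) = {(1, 0, 0), (0, 1, 0), (0, 0, 1)}"
      by (auto simp: Basis_prod_def zero_prod_def)
    note B = this
    show ?thesis unfolding emeasure_lborel_box_eq B using le' by simp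
  qed
  also have "(u $ 1 - l $ 1) * ((u $ 2 - l $ 2) * (u $ 3 - l $ 3)) = (\<Prod>b\<in>Basis. (u - l) \<bullet> b)"
  proof -
    have "(\<Prod>b\<in>Basis. (u - l) \<bullet> b) = (\<Prod>i\<in>UNIV. (u - l) \<bullet> axis i 1)"
    proof -
      have B: "(Basis :: R3 set) = range (\<lambda>i. axis i 1)" by (auto simp: Basis_vec_def)
      show ?thesis unfolding B by (subst prod.reindex) (auto simp: inj_on_def axis_eq_axis)
    qed
    also have "\<dots> = (u $ 1 - l $ 1) * ((u $ 2 - l $ 2) * (u $ 3 - l $ 3))"
      unfolding UNIV_3 by (simp add: inner_axis)
    finally show ?thesis by simp
  qed
  finally show "emeasure (distr lborel borel coords) (box l u) = ennreal (\<Prod>b\<in>Basis. (u - l) \<bullet> b)" .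
qed simp

lemma nn_integral_coords:
  fixes F :: "R3 \<Rightarrow> ennreal"
  assumes [measurable]: "F \<in> borel_measurable borel"
  shows "(\<integral>\<^sup>+x. F x \<partial>lborel) = (\<integral>\<^sup>+a. \<integral>\<^sup>+b. \<integral>\<^sup>+c. F (coords (a, b, c)) \<partial>lborel \<partial>lborel \<partial>lborel)"
proof -
  have [measurable]: "coords \<in> borel_measurable (borel \<Otimes>\<^sub>M borel)"
    using measurable_coords by (simp add: borel_prod)
  have m: "(\<lambda>q. F (coords (a, q))) \<in> borel_measurable (lborel \<Otimes>\<^sub>M lborel)" for a
  proof -
    have "(\<lambda>q. F (coords (a, q))) \<in> borel_measurable (borel :: (real \<times> real) measure)" by measurable
    then show ?thesis by (simp add: lborel_prod)
  qed
  have "(\<integral>\<^sup>+x. F x \<partial>lborel) = (\<integral>\<^sup>+p. F (coords p) \<partial>lborel)"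
    by (subst lborel_coords, rule nn_integral_distr) simp_all
  also have "\<dots> = (\<integral>\<^sup>+p. F (coords p) \<partial>(lborel \<Otimes>\<^sub>M lborel))"
    by (simp add: lborel_prod)
  also have "\<dots> = (\<integral>\<^sup>+a. \<integral>\<^sup>+q. F (coords (a, q)) \<partial>lborel \<partial>lborel)"
    by (rule lborel.nn_integral_fst[symmetric]) measurable
  also have "\<dots> = (\<integral>\<^sup>+a. \<integral>\<^sup>+q. F (coords (a, q)) \<partial>(lborel \<Otimes>\<^sub>M lborel) \<partial>lborel)"
    by (simp add: lborel_prod)
  also have "\<dots> = (\<integral>\<^sup>+a. \<integral>\<^sup>+b. \<integral>\<^sup>+c. F (coords (a, b, c)) \<partial>lborel \<partial>lborel \<partial>lborel)"
    by (intro nn_integral_cong lborel.nn_integral_fst[symmetric] m)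
  finally show ?thesis .
qed

text \<open>A square root that sends infinity to infinity, so that the geometric inequality below
  can be stated for line integrals whose finiteness is not known beforehand.\<close>

definition esqrt :: "ennreal \<Rightarrow> ennreal" where
  "esqrt x = (if x = top then top else ennreal (sqrt (enn2real x)))"

lemma esqrt_measurable [measurable]: "esqrt \<in> borel_measurable borel"
  unfolding esqrt_def[abs_def] by measurable

lemma esqrt_sq: "(esqrt x)\<^sup>2 = x"
  by (cases x) (auto simp: esqrt_def ennreal_power power_eq_top_ennreal)

lemma sq_esqrt: "esqrt (x\<^sup>2) = x"
  by (cases x) (auto simp: esqrt_def ennreal_power power_eq_top_ennreal)

lemma esqrt_mono: "x \<le> y \<Longrightarrow> esqrt x \<le> esqrt y"
  by (cases x; cases y) (auto simp: esqrt_def top_unique intro!: ennreal_leI)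

lemma ennreal_sq_le_imp_le: "x\<^sup>2 \<le> y\<^sup>2 \<Longrightarrow> x \<le> (y :: ennreal)"
  using esqrt_mono[of "x\<^sup>2" "y\<^sup>2"] by (simp add: sq_esqrt)

lemma nn_integral_esqrt_mult:
  assumes [measurable]: "f \<in> borel_measurable M" "g \<in> borel_measurable M"
  shows "(\<integral>\<^sup>+x. esqrt (f x) * esqrt (g x) \<partial>M) \<le> esqrt (\<integral>\<^sup>+x. f x \<partial>M) * esqrt (\<integral>\<^sup>+x. g x \<partial>M)"
proof (rule ennreal_sq_le_imp_le)
  have "(\<integral>\<^sup>+x. esqrt (f x) * esqrt (g x) \<partial>M)\<^sup>2 \<le>
      (\<integral>\<^sup>+x. (esqrt (f x))\<^sup>2 \<partial>M) * (\<integral>\<^sup>+x. (esqrt (g x))\<^sup>2 \<partial>M)"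
    by (rule Cauchy_Schwarz_nn_integral) measurable
  then show "(\<integral>\<^sup>+x. esqrt (f x) * esqrt (g x) \<partial>M)\<^sup>2 \<le>
      (esqrt (\<integral>\<^sup>+x. f x \<partial>M) * esqrt (\<integral>\<^sup>+x. g x \<partial>M))\<^sup>2"
    by (simp only: esqrt_sq power_mult_distrib)
qed

text \<open>Cauchy-Schwarz is applied in the variables c, b and a in turn. At each stage one of the
  three factors does not depend on the variable of integration and is pulled out, so two factors are
  left for the inequality.\<close>

lemma Loomis_Whitney:
  fixes A B C :: "real \<Rightarrow> real \<Rightarrow> ennreal"
  assumes [measurable]: "case_prod A \<in> borel_measurable borel" "case_prod B \<in> borel_measurable borel"
    "case_prod C \<in> borel_measurable borel"
  shows "(\<integral>\<^sup>+a. \<integral>\<^sup>+b. \<integral>\<^sup>+c. esqrt (A b c) * esqrt (B a c) * esqrt (C a b) \<partial>lborel \<partial>lborel \<partial>lborel) \<le>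
    esqrt (\<integral>\<^sup>+b. \<integral>\<^sup>+c. A b c \<partial>lborel \<partial>lborel) * esqrt (\<integral>\<^sup>+a. \<integral>\<^sup>+c. B a c \<partial>lborel \<partial>lborel) *
    esqrt (\<integral>\<^sup>+a. \<integral>\<^sup>+b. C a b \<partial>lborel \<partial>lborel)"
proof -
  have [measurable]: "case_prod A \<in> borel_measurable (borel \<Otimes>\<^sub>M borel)" "case_prod B \<in> borel_measurable (borel \<Otimes>\<^sub>M borel)"
    "case_prod C \<in> borel_measurable (borel \<Otimes>\<^sub>M borel)"
    using assms by (simp_all add: borel_prod)
  define A1 where "A1 b = (\<integral>\<^sup>+c. A b c \<partial>lborel)" for b
  define B1 where "B1 a = (\<integral>\<^sup>+c. B a c \<partial>lborel)" for a
  define C1 where "C1 a = (\<integral>\<^sup>+b. C a b \<partial>lborel)" for a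
  have [measurable]: "A1 \<in> borel_measurable borel" "B1 \<in> borel_measurable borel" "C1 \<in> borel_measurable borel"
    unfolding A1_def[abs_def] B1_def[abs_def] C1_def[abs_def] by measurable
  have "(\<integral>\<^sup>+a. \<integral>\<^sup>+b. \<integral>\<^sup>+c. esqrt (A b c) * esqrt (B a c) * esqrt (C a b) \<partial>lborel \<partial>lborel \<partial>lborel)
     = (\<integral>\<^sup>+a. \<integral>\<^sup>+b. (\<integral>\<^sup>+c. esqrt (A b c) * esqrt (B a c) \<partial>lborel) * esqrt (C a b) \<partial>lborel \<partial>lborel)"
    by (simp add: nn_integral_multc)
  also have "\<dots> \<le> (\<integral>\<^sup>+a. \<integral>\<^sup>+b. (esqrt (A1 b) * esqrt (B1 a)) * esqrt (C a b) \<partial>lborel \<partial>lborel)"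
    unfolding A1_def B1_def by (intro nn_integral_mono mult_right_mono nn_integral_esqrt_mult) simp_all
  also have "\<dots> = (\<integral>\<^sup>+a. esqrt (B1 a) * (\<integral>\<^sup>+b. esqrt (A1 b) * esqrt (C a b) \<partial>lborel) \<partial>lborel)"
    by (intro nn_integral_cong, subst nn_integral_cmult[symmetric]) (simp_all add: mult_ac)
  also have "\<dots> \<le> (\<integral>\<^sup>+a. esqrt (B1 a) * (esqrt (\<integral>\<^sup>+b. A1 b \<partial>lborel) * esqrt (C1 a)) \<partial>lborel)"
    unfolding C1_def by (intro nn_integral_mono mult_left_mono nn_integral_esqrt_mult) simp_all
  also have "\<dots> = esqrt (\<integral>\<^sup>+b. A1 b \<partial>lborel) * (\<integral>\<^sup>+a. esqrt (B1 a) * esqrt (C1 a) \<partial>lborel)"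
    by (subst nn_integral_cmult[symmetric]) (simp_all add: mult_ac)
  also have "\<dots> \<le> esqrt (\<integral>\<^sup>+b. A1 b \<partial>lborel) * (esqrt (\<integral>\<^sup>+a. B1 a \<partial>lborel) * esqrt (\<integral>\<^sup>+a. C1 a \<partial>lborel))"
    by (intro mult_left_mono nn_integral_esqrt_mult) simp_all
  finally show ?thesis by (simp add: A1_def B1_def C1_def mult.assoc)
qed

lemma abs_le_nn_integral_derivative:
  fixes g g' :: "real \<Rightarrow> real"
  assumes "\<And>x. (g has_real_derivative g' x) (at x)" "continuous_on UNIV g'" "\<And>x. \<bar>x\<bar> > r \<Longrightarrow> g x = 0"
  shows "ennreal \<bar>g a\<bar> \<le> (\<integral>\<^sup>+x. \<bar>g' x\<bar> \<partial>lborel)"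
proof -
  \<comment> \<open>A point to the left of \<open>a\<close> and outside the support, so that
    \<open>g l\<close> vanishes and the fundamental theorem gives \<open>g a\<close> alone.\<close>
  define l where "l = - (\<bar>r\<bar> + \<bar>a\<bar> + 1)"
  have "l \<le> a" "\<bar>l\<bar> > r" unfolding l_def by linarith+
  have "has_bochner_integral lborel (\<lambda>x. indicator {l..a} x *\<^sub>R g' x) (g a - g l)"
    by (rule has_bochner_integral_FTC_Icc)
       (use \<open>l \<le> a\<close> assms(1,2) in \<open>auto simp: has_real_derivative_iff_has_vector_derivative[symmetric]
          intro: has_field_derivative_at_within continuous_on_subset\<close>)
  then have *: "integrable lborel (\<lambda>x. indicator {l..a} x *\<^sub>R g' x)" "g a = (\<integral>x. indicator {l..a} x *\<^sub>R g' x \<partial>lborel)"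
    using assms(3)[OF \<open>\<bar>l\<bar> > r\<close>] by (auto simp: has_bochner_integral_iff)
  have "ennreal \<bar>g a\<bar> \<le> (\<integral>\<^sup>+x. norm (indicator {l..a} x *\<^sub>R g' x) \<partial>lborel)"
    unfolding *(2) using integral_norm_bound_ennreal[OF *(1)] by simp
  also have "\<dots> \<le> (\<integral>\<^sup>+x. \<bar>g' x\<bar> \<partial>lborel)"
    by (intro nn_integral_mono) (auto simp: indicator_def)
  finally show ?thesis .
qed

text \<open>The line through \<open>x\<close> is parametrised by the absolute coordinate
  \<open>s\<close> instead of the distance from \<open>x\<close>. The right side is therefore
  visibly independent of the i-th coordinate of \<open>x\<close>, as the Loomis-Whitney inequality
  requires.\<close>

lemma test_line:
  assumes \<phi>: "\<phi> \<in> test_functions"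
  shows "ennreal ((\<phi> x) ^ 4) \<le> (\<integral>\<^sup>+s. \<bar>4 * (\<phi> (x + (s - x $ i) *\<^sub>R axis i 1)) ^ 3 * partial i \<phi> (x + (s - x $ i) *\<^sub>R axis i 1)\<bar> \<partial>lborel)"
proof -
  obtain r where r: "\<And>y. norm y > r \<Longrightarrow> \<phi> y = 0" using test_support[OF \<phi>] by metis
  let ?p = "\<lambda>s. x + (s - x $ i) *\<^sub>R axis i 1"
  have D: "((\<lambda>s. (\<phi> (?p s)) ^ 4) has_real_derivative 4 * (\<phi> (?p s)) ^ 3 * partial i \<phi> (?p s)) (at s)" for s
  proof -
    have "(?p has_derivative (\<lambda>h. h *\<^sub>R axis i 1)) (at s)"
      by (auto intro!: derivative_eq_intros)
    moreover have "(\<phi> has_derivative (\<lambda>h. \<Sum>j\<in>UNIV. h $ j * partial j \<phi> (?p s))) (at (?p s))"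
      by (rule has_derivative_partial[OF smooth_differentiable[OF test_smooth[OF \<phi>]]])
    ultimately have "((\<lambda>s. \<phi> (?p s)) has_derivative (\<lambda>h. \<Sum>j\<in>UNIV. (h *\<^sub>R axis i 1 :: R3) $ j * partial j \<phi> (?p s))) (at s)"
      by (rule has_derivative_compose)
    moreover have "(\<lambda>h. \<Sum>j\<in>UNIV. (h *\<^sub>R axis i 1 :: R3) $ j * partial j \<phi> (?p s)) = (\<lambda>h. partial i \<phi> (?p s) * h)"
      by (auto simp: axis_def if_distrib if_distribR mult.commute cong: if_cong)
    ultimately have "((\<lambda>s. \<phi> (?p s)) has_real_derivative partial i \<phi> (?p s)) (at s)"
      by (simp add: has_field_derivative_def)
    then show ?thesis
      by (auto intro!: derivative_eq_intros)
  qed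
  have "ennreal \<bar>(\<phi> (?p (x $ i))) ^ 4\<bar> \<le> (\<integral>\<^sup>+s. \<bar>4 * (\<phi> (?p s)) ^ 3 * partial i \<phi> (?p s)\<bar> \<partial>lborel)"
  proof (rule abs_le_nn_integral_derivative[OF D, of "max r 0"])
    have "continuous_on UNIV \<phi>" "continuous_on UNIV (partial i \<phi>)"
      by (auto intro: smooth_continuous smooth_partial test_smooth \<phi>)
    then show "continuous_on UNIV (\<lambda>s. 4 * (\<phi> (?p s)) ^ 3 * partial i \<phi> (?p s))"
      by (auto intro!: continuous_intros elim!: continuous_on_compose2)
    fix s :: real assume s: "\<bar>s\<bar> > max r 0"
    have "\<bar>?p s $ i\<bar> \<le> norm (?p s)" by (rule component_le_norm_cart)
    moreover have "?p s $ i = s" by (simp add: axis_def)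
    ultimately have "norm (?p s) > r" using s by linarith
    then show "\<phi> (?p s) ^ 4 = 0" by (simp add: r)
  qed
  then show ?thesis by simp
qed

lemma test_Cc_power: "\<phi> \<in> Cc \<Longrightarrow> n > 0 \<Longrightarrow> (\<lambda>x. (\<phi> x) ^ n) \<in> Cc"
  by (auto simp: Cc_def intro!: continuous_intros)

text \<open>Gagliardo's argument: \<open>\<phi>\<^sup>4\<close> is bounded by the integral of \<open>\<bar>\<partial>\<^sub>i(\<phi>\<^sup>4)\<bar>\<close> along the line in each of the
  three coordinate directions.\<close>

lemma sobolev_test:
  assumes \<phi>: "\<phi> \<in> test_functions"
  shows "(\<integral>x. (\<phi> x) ^ 6 \<partial>lebesgue) \<le> 4096 * (\<Sum>i\<in>UNIV. (norm (mk (partial i \<phi>)))\<^sup>2) ^ 3"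
proof -
  have C: "\<phi> \<in> Cc" "\<And>i. partial i \<phi> \<in> Cc" by (auto intro: test_Cc test_partial \<phi>)
  note [measurable] = Cc_measurable[OF C(1)] Cc_measurable[OF C(2)]
  let ?g = "\<lambda>i x. ennreal \<bar>4 * (\<phi> x) ^ 3 * partial i \<phi> x\<bar>"
  have gm [measurable]: "?g i \<in> borel_measurable borel" for i by measurable
  define D where "D = (\<Sum>i\<in>UNIV. (norm (mk (partial i \<phi>)))\<^sup>2)"
  define X where "X = (\<integral>x. (\<phi> x) ^ 6 \<partial>lebesgue)"
  have int6: "integrable lebesgue (\<lambda>x. (\<phi> x) ^ 6)" by (rule Cc_integrable(2)[OF test_Cc_power[OF C(1)]]) simp
  have X: "(\<integral>\<^sup>+x. (\<phi> x) ^ 6 \<partial>lborel) = ennreal X"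
    using nn_integral_eq_integral[OF int6] by (simp add: X_def nn_integral_completion)
  have X0: "X \<ge> 0" "D \<ge> 0" by (auto simp: X_def D_def sum_nonneg)
  define I where "I i = (\<integral>\<^sup>+x. ?g i x \<partial>lborel)" for i
  \<comment> \<open>Cauchy-Schwarz splits the integrand into 4 |\<phi>|^3 and the partial
    derivative. It brings the sixth-power integral \<open>X\<close> back to the right side, with a
    lower total power than on the left.\<close>
  have I: "(I i)\<^sup>2 \<le> ennreal (16 * X * D)" for i
  proof -
    have "(I i)\<^sup>2 = (\<integral>\<^sup>+x. ennreal (4 * \<bar>\<phi> x ^ 3\<bar>) * ennreal \<bar>partial i \<phi> x\<bar> \<partial>lborel)\<^sup>2"
      by (simp add: I_def abs_mult power_abs flip: ennreal_mult)
    also have "\<dots> \<le> (\<integral>\<^sup>+x. (ennreal (4 * \<bar>\<phi> x ^ 3\<bar>))\<^sup>2 \<partial>lborel) * (\<integral>\<^sup>+x. (ennreal \<bar>partial i \<phi> x\<bar>)\<^sup>2 \<partial>lborel)"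
      by (rule Cauchy_Schwarz_nn_integral) measurable
    also have "(\<integral>\<^sup>+x. (ennreal (4 * \<bar>\<phi> x ^ 3\<bar>))\<^sup>2 \<partial>lborel) = (\<integral>\<^sup>+x. 16 * ennreal (\<phi> x ^ 6) \<partial>lborel)"
      by (intro nn_integral_cong) (simp add: ennreal_power power_mult_distrib ennreal_mult flip: power_mult)
    also have "\<dots> = ennreal (16 * X)" using X X0 by (simp add: nn_integral_cmult ennreal_mult)
    also have "(\<integral>\<^sup>+x. (ennreal \<bar>partial i \<phi> x\<bar>)\<^sup>2 \<partial>lborel) = ennreal ((norm (mk (partial i \<phi>)))\<^sup>2)"
      using nn_integral_eq_integral[OF L2_integrable_sq[OF Cc_L2[OF C(2)[of i]]]]
      by (simp add: norm_mk_sq Cc_L2 C nn_integral_completion ennreal_power)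
    also have "ennreal (16 * X) * ennreal ((norm (mk (partial i \<phi>)))\<^sup>2) \<le> ennreal (16 * X) * ennreal D"
      unfolding D_def by (intro mult_left_mono ennreal_leI member_le_sum) auto
    finally show ?thesis using X0 by (simp add: ennreal_mult)
  qed
  have pos: "coords (a, b, c) + (s - a) *\<^sub>R axis 1 1 = coords (s, b, c)"
    "coords (a, b, c) + (s - b) *\<^sub>R axis 2 1 = coords (a, s, c)"
    "coords (a, b, c) + (s - c) *\<^sub>R axis 3 1 = coords (a, b, s)" for a b c s
    by (simp_all add: coords_eq algebra_simps)
  define G1 where "G1 b c = (\<integral>\<^sup>+s. ?g 1 (coords (s, b, c)) \<partial>lborel)" for b c
  define G2 where "G2 a c = (\<integral>\<^sup>+s. ?g 2 (coords (a, s, c)) \<partial>lborel)" for a c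
  define G3 where "G3 a b = (\<integral>\<^sup>+s. ?g 3 (coords (a, b, s)) \<partial>lborel)" for a b
  have [measurable]: "coords \<in> borel_measurable (borel \<Otimes>\<^sub>M borel \<Otimes>\<^sub>M borel)"
    using measurable_coords by (simp add: borel_prod)
  have Gm: "case_prod G1 \<in> borel_measurable borel" "case_prod G2 \<in> borel_measurable borel" "case_prod G3 \<in> borel_measurable borel"
    unfolding G1_def G2_def G3_def borel_prod[symmetric] by measurable
  have G: "ennreal (\<phi> (coords (a, b, c)) ^ 4) \<le> G1 b c" "ennreal (\<phi> (coords (a, b, c)) ^ 4) \<le> G2 a c"
    "ennreal (\<phi> (coords (a, b, c)) ^ 4) \<le> G3 a b" for a b c
    using test_line[OF \<phi>, of "coords (a, b, c)" 1] test_line[OF \<phi>, of "coords (a, b, c)" 2]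
      test_line[OF \<phi>, of "coords (a, b, c)" 3]
    by (simp_all add: coords_nth pos G1_def G2_def G3_def)
  have II: "(\<integral>\<^sup>+b. \<integral>\<^sup>+c. G1 b c \<partial>lborel \<partial>lborel) = I 1" "(\<integral>\<^sup>+a. \<integral>\<^sup>+c. G2 a c \<partial>lborel \<partial>lborel) = I 2"
    "(\<integral>\<^sup>+a. \<integral>\<^sup>+b. G3 a b \<partial>lborel \<partial>lborel) = I 3"
  proof -
    have "I 1 = (\<integral>\<^sup>+a. \<integral>\<^sup>+b. \<integral>\<^sup>+c. ?g 1 (coords (a, b, c)) \<partial>lborel \<partial>lborel \<partial>lborel)"
      unfolding I_def by (rule nn_integral_coords[OF gm])
    also have "\<dots> = (\<integral>\<^sup>+b. \<integral>\<^sup>+a. \<integral>\<^sup>+c. ?g 1 (coords (a, b, c)) \<partial>lborel \<partial>lborel \<partial>lborel)"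
      by (rule lborel_pair.Fubini') measurable
    also have "\<dots> = (\<integral>\<^sup>+b. \<integral>\<^sup>+c. G1 b c \<partial>lborel \<partial>lborel)"
      unfolding G1_def by (intro nn_integral_cong lborel_pair.Fubini') measurable
    finally show "(\<integral>\<^sup>+b. \<integral>\<^sup>+c. G1 b c \<partial>lborel \<partial>lborel) = I 1" ..
    have "I 2 = (\<integral>\<^sup>+a. \<integral>\<^sup>+b. \<integral>\<^sup>+c. ?g 2 (coords (a, b, c)) \<partial>lborel \<partial>lborel \<partial>lborel)"
      unfolding I_def by (rule nn_integral_coords[OF gm])
    also have "\<dots> = (\<integral>\<^sup>+a. \<integral>\<^sup>+c. G2 a c \<partial>lborel \<partial>lborel)"
      unfolding G2_def by (intro nn_integral_cong lborel_pair.Fubini') measurable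
    finally show "(\<integral>\<^sup>+a. \<integral>\<^sup>+c. G2 a c \<partial>lborel \<partial>lborel) = I 2" ..
    show "(\<integral>\<^sup>+a. \<integral>\<^sup>+b. G3 a b \<partial>lborel \<partial>lborel) = I 3"
      unfolding G3_def I_def by (rule nn_integral_coords[OF gm, symmetric])
  qed
  have "ennreal X = (\<integral>\<^sup>+a. \<integral>\<^sup>+b. \<integral>\<^sup>+c. ennreal (\<phi> (coords (a, b, c)) ^ 6) \<partial>lborel \<partial>lborel \<partial>lborel)"
    unfolding X[symmetric] by (rule nn_integral_coords) measurable
  also have "\<dots> \<le> (\<integral>\<^sup>+a. \<integral>\<^sup>+b. \<integral>\<^sup>+c. esqrt (G1 b c) * esqrt (G2 a c) * esqrt (G3 a b) \<partial>lborel \<partial>lborel \<partial>lborel)"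
  proof (intro nn_integral_mono)
    fix a b c
    let ?y = "\<phi> (coords (a, b, c))"
    have "ennreal (?y\<^sup>2) = esqrt (ennreal (?y ^ 4))"
      using sq_esqrt[of "ennreal (?y\<^sup>2)"] by (simp add: ennreal_power flip: power_mult)
    then have "ennreal (?y\<^sup>2) \<le> esqrt (G1 b c)" "ennreal (?y\<^sup>2) \<le> esqrt (G2 a c)" "ennreal (?y\<^sup>2) \<le> esqrt (G3 a b)"
      using G by (auto intro: esqrt_mono)
    then have "ennreal (?y\<^sup>2) * ennreal (?y\<^sup>2) * ennreal (?y\<^sup>2) \<le> esqrt (G1 b c) * esqrt (G2 a c) * esqrt (G3 a b)"
      by (intro mult_mono) auto
    moreover have "ennreal (?y\<^sup>2) * ennreal (?y\<^sup>2) * ennreal (?y\<^sup>2) = ennreal (?y ^ 6)"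
      by (simp flip: ennreal_mult power_add)
    ultimately show "ennreal (?y ^ 6) \<le> esqrt (G1 b c) * esqrt (G2 a c) * esqrt (G3 a b)" by simp
  qed
  also have "\<dots> \<le> esqrt (I 1) * esqrt (I 2) * esqrt (I 3)"
    using Loomis_Whitney[OF Gm] by (simp add: II)
  finally have "(ennreal X)\<^sup>2 \<le> (esqrt (I 1) * esqrt (I 2) * esqrt (I 3))\<^sup>2"
    by (rule power_mono) simp
  then have "(ennreal X)\<^sup>2 \<le> I 1 * I 2 * I 3" by (simp add: power_mult_distrib esqrt_sq)
  then have "((ennreal X)\<^sup>2)\<^sup>2 \<le> (I 1 * I 2 * I 3)\<^sup>2" by (rule power_mono) simp
  also have "\<dots> \<le> ennreal (16 * X * D) * ennreal (16 * X * D) * ennreal (16 * X * D)"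
    unfolding power_mult_distrib by (intro mult_mono I) auto
  also have "\<dots> = ennreal (4096 * D ^ 3 * X ^ 3)"
    using X0 by (simp add: power3_eq_cube mult_ac flip: ennreal_mult)
  finally have "ennreal (X ^ 4) \<le> ennreal (4096 * D ^ 3 * X ^ 3)"
    using X0 by (simp add: ennreal_power flip: power_mult)
  then have le: "X * X ^ 3 \<le> 4096 * D ^ 3 * X ^ 3"
    using X0 by (subst (asm) ennreal_le_iff) (auto simp: power_Suc[symmetric] simp del: power_Suc)
  \<comment> \<open>\<open>X\<close> is a finite real because a test function has compact support,
    so \<open>X ^ 3\<close> can be cancelled from \<open>X ^ 4 \<le> 4096 * D ^ 3 * X ^ 3\<close>;
    4096 is the cube of 16.\<close>
  have "X \<le> 4096 * D ^ 3"
  proof (cases "X = 0")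
    case False
    then have "X ^ 3 > 0" using X0 by simp
    then show ?thesis using le by (simp add: mult_le_cancel_right)
  qed (use X0 in auto)
  then show ?thesis by (simp add: X_def D_def)
qed

text \<open>Test functions that converge in H1 have a subsequence converging almost everywhere, and
  Fatou's lemma carries the bound over. Integrability of the sixth power is obtained from the same
  bound, so convergence in L6 is never invoked.\<close>

lemma H1_sixth_power:
  assumes f: "f \<in> H1"
  shows "integrable lebesgue (\<lambda>x. (f x) ^ 6)"
    "(\<integral>x. (f x) ^ 6 \<partial>lebesgue) \<le> 4096 * (\<Sum>i\<in>UNIV. (norm (grad i f))\<^sup>2) ^ 3"
proof -
  have fL: "f \<in> L2" by (rule H1_L2[OF f])
  note [measurable] = L2_measurable[OF fL]
  have "\<exists>\<phi>. \<phi> \<in> test_functions \<and> norm (mk \<phi> - mk f) < 1 / real (Suc n) \<and> (\<forall>i. norm (mk (partial i \<phi>) - grad i f) < 1 / real (Suc n))" for n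
    by (rule test_dense_H1[OF f, of "1 / real (Suc n)"]) (simp, blast)
  then obtain \<phi> where \<phi>: "\<And>n. \<phi> n \<in> test_functions"
    and b: "\<And>n. norm (mk (\<phi> n) - mk f) < 1 / real (Suc n)" "\<And>n i. norm (mk (partial i (\<phi> n)) - grad i f) < 1 / real (Suc n)"
    by metis
  have L: "\<phi> n \<in> L2" for n by (rule Cc_L2[OF test_Cc[OF \<phi>]])
  note [measurable] = L2_measurable[OF L]
  have lim0: "(\<lambda>n. mk (\<phi> n) - mk f) \<longlonglongrightarrow> 0"
    by (rule LIMSEQ_norm_0) (use b(1) in simp)
  have limg: "(\<lambda>n. mk (partial i (\<phi> n))) \<longlonglongrightarrow> grad i f" for i
    by (rule iffD2[OF Lim_null LIMSEQ_norm_0]) (use b(2) in simp)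
  have "(\<lambda>n. (norm (mk (\<phi> n) - mk f))\<^sup>2) \<longlonglongrightarrow> (norm (0 :: l2))\<^sup>2"
    by (intro tendsto_intros lim0)
  moreover have "(norm (mk (\<phi> n) - mk f))\<^sup>2 = (\<integral>x. norm ((\<phi> n x - f x)\<^sup>2) \<partial>lebesgue)" for n
    using norm_mk_sq[OF L2_diff[OF L fL]] mk_diff[OF L fL] by simp
  ultimately have "(\<lambda>n. \<integral>x. norm ((\<phi> n x - f x)\<^sup>2) \<partial>lebesgue) \<longlonglongrightarrow> 0" by simp
  then obtain r :: "nat \<Rightarrow> nat" where r: "strict_mono r" "AE x in lebesgue. (\<lambda>n. (\<phi> (r n) x - f x)\<^sup>2) \<longlonglongrightarrow> 0"
    using tendsto_L1_AE_subseq[of lebesgue "\<lambda>n x. (\<phi> n x - f x)\<^sup>2"] L2_integrable_sq[OF L2_diff[OF L fL]] by auto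
  define S where "S = (\<Sum>i\<in>UNIV. (norm (grad i f))\<^sup>2)"
  define s where "s n = (\<Sum>i\<in>UNIV. (norm (mk (partial i (\<phi> (r n)))))\<^sup>2)" for n
  have slim: "s \<longlonglongrightarrow> S"
    unfolding s_def[abs_def] S_def
    by (intro tendsto_intros LIMSEQ_subseq_LIMSEQ[OF limg r(1), unfolded comp_def])
  have ae: "AE x in lebesgue. ennreal ((f x) ^ 6) = liminf (\<lambda>n. ennreal ((\<phi> (r n) x) ^ 6))"
    using r(2)
  proof eventually_elim
    case (elim x)
    from tendsto_real_sqrt[OF elim] have "(\<lambda>n. \<bar>\<phi> (r n) x - f x\<bar>) \<longlonglongrightarrow> 0" by simp
    then have "(\<lambda>n. \<phi> (r n) x) \<longlonglongrightarrow> f x" by (metis LIM_zero_cancel tendsto_rabs_zero_iff)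
    then have "(\<lambda>n. ennreal ((\<phi> (r n) x) ^ 6)) \<longlonglongrightarrow> ennreal ((f x) ^ 6)"
      by (intro tendsto_intros)
    from lim_imp_Liminf[OF sequentially_bot this] show ?case by (rule sym)
  qed
  have "(\<integral>\<^sup>+x. ennreal ((f x) ^ 6) \<partial>lebesgue) = (\<integral>\<^sup>+x. liminf (\<lambda>n. ennreal ((\<phi> (r n) x) ^ 6)) \<partial>lebesgue)"
    by (rule nn_integral_cong_AE[OF ae])
  also have "\<dots> \<le> liminf (\<lambda>n. \<integral>\<^sup>+x. ennreal ((\<phi> (r n) x) ^ 6) \<partial>lebesgue)"
    by (rule nn_integral_liminf) measurable
  also have "\<dots> \<le> liminf (\<lambda>n. ennreal (4096 * s n ^ 3))"
  proof (rule Liminf_mono, rule always_eventually, rule allI)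
    fix n
    have "integrable lebesgue (\<lambda>x. (\<phi> (r n) x) ^ 6)"
      by (rule Cc_integrable(2)[OF test_Cc_power[OF test_Cc[OF \<phi>]]]) simp
    then have "(\<integral>\<^sup>+x. ennreal ((\<phi> (r n) x) ^ 6) \<partial>lebesgue) = ennreal (\<integral>x. (\<phi> (r n) x) ^ 6 \<partial>lebesgue)"
      by (rule nn_integral_eq_integral) simp
    also have "\<dots> \<le> ennreal (4096 * s n ^ 3)"
      unfolding s_def by (intro ennreal_leI sobolev_test \<phi>)
    finally show "(\<integral>\<^sup>+x. ennreal ((\<phi> (r n) x) ^ 6) \<partial>lebesgue) \<le> ennreal (4096 * s n ^ 3)" .
  qed
  also have "\<dots> = ennreal (4096 * S ^ 3)"
    by (intro lim_imp_Liminf) (auto intro!: tendsto_intros slim)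
  finally have le: "(\<integral>\<^sup>+x. ennreal ((f x) ^ 6) \<partial>lebesgue) \<le> ennreal (4096 * S ^ 3)" .
  show int: "integrable lebesgue (\<lambda>x. (f x) ^ 6)"
    unfolding integrable_iff_bounded using le_less_trans[OF le ennreal_less_top] by simp
  have "ennreal (\<integral>x. (f x) ^ 6 \<partial>lebesgue) \<le> ennreal (4096 * S ^ 3)"
    using nn_integral_eq_integral[OF int] le by simp
  then show "(\<integral>x. (f x) ^ 6 \<partial>lebesgue) \<le> 4096 * (\<Sum>i\<in>UNIV. (norm (grad i f))\<^sup>2) ^ 3"
    by (subst (asm) ennreal_le_iff) (auto simp: S_def sum_nonneg)
qed

section \<open>The cubic nonlinearity as a map from H1 to L2\<close>

lemma cube_L2:
  assumes "f \<in> H1"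
  shows "(\<lambda>x. (f x) ^ 3) \<in> L2"
proof (rule L2I)
  note [measurable] = L2_measurable[OF H1_L2[OF assms]]
  show "(\<lambda>x. (f x) ^ 3) \<in> borel_measurable lebesgue" by measurable
  show "integrable lebesgue (\<lambda>x. ((f x) ^ 3)\<^sup>2)"
    using H1_sixth_power(1)[OF assms] by (simp flip: power_mult)
qed

lemma norm_cube_sq:
  assumes "f \<in> H1"
  shows "(norm (mk (\<lambda>x. (f x) ^ 3)))\<^sup>2 = (\<integral>x. (f x) ^ 6 \<partial>lebesgue)"
  using norm_mk_sq[OF cube_L2[OF assms]] by (simp flip: power_mult)

text \<open>Factor the difference of cubes into the difference times a quadratic expression, and
  distribute the resulting sixth-degree product by a pointwise Young inequality in place of a
  three-factor Hoelder inequality. Taking for \<open>s\<close> any positive upper bound of the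
  gradient difference avoids a division by zero when the gradients coincide.\<close>

lemma cube_diff_bound:
  assumes f: "f \<in> H1" and g: "g \<in> H1" and s: "s > 0" "(\<Sum>i\<in>UNIV. (norm (grad i f - grad i g))\<^sup>2) \<le> s"
  shows "(norm (mk (\<lambda>x. (f x) ^ 3) - mk (\<lambda>x. (g x) ^ 3)))\<^sup>2 \<le>
    72 * s * (2 + (norm (mk (\<lambda>x. (f x) ^ 3)))\<^sup>2 + (norm (mk (\<lambda>x. (g x) ^ 3)))\<^sup>2)"
proof -
  let ?d = "\<lambda>x. f x - g x"
  have d: "?d \<in> H1" by (rule H1_diff[OF f g])
  \<comment> \<open>The scale for Young's inequality: 16 is the cube root of the Sobolev constant
    4096, so the sixth-power integral of the difference is at most \<open>l ^ 3\<close>.\<close>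
  define l where "l = 16 * s"
  have l: "l > 0" using s by (simp add: l_def)
  have dint: "(\<integral>x. (?d x) ^ 6 \<partial>lebesgue) \<le> l ^ 3"
  proof -
    have "(\<integral>x. (?d x) ^ 6 \<partial>lebesgue) \<le> 4096 * (\<Sum>i\<in>UNIV. (norm (grad i ?d))\<^sup>2) ^ 3" by (rule H1_sixth_power(2)[OF d])
    also have "\<dots> \<le> 4096 * s ^ 3"
      using s by (intro mult_left_mono power_mono) (auto simp: grad_diff f g sum_nonneg)
    also have "\<dots> = l ^ 3" by (simp add: l_def power_mult_distrib)
    finally show ?thesis .
  qed
  have key: "((f x) ^ 3 - (g x) ^ 3)\<^sup>2 \<le> 9 / 2 * l * (2 * ((?d x) ^ 6 / l ^ 3) + (f x) ^ 6 + (g x) ^ 6)" for x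
  proof -
    \<comment> \<open>After division of \<open>a\<close> by \<open>l\<close> this is the crude bound
      of \<open>c * b\<^sup>2\<close> by the cube of the larger of the two numbers.\<close>
    have young: "a * b\<^sup>2 \<le> l * (a ^ 3 / l ^ 3 + b ^ 3)" if "a \<ge> 0" "b \<ge> 0" for a b :: real
    proof -
      define c where "c = a / l"
      have c0: "c \<ge> 0" using that l by (simp add: c_def)
      have "c * b\<^sup>2 \<le> c ^ 3 + b ^ 3"
      proof (cases "c \<le> b")
        case True
        then have "c * b\<^sup>2 \<le> b * b\<^sup>2" by (intro mult_right_mono) auto
        then show ?thesis using c0 by (simp add: power3_eq_cube power2_eq_square add_increasing)
      next
        case False
        then have "c * b\<^sup>2 \<le> c * c\<^sup>2" using that c0 by (intro mult_left_mono power_mono) auto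
        moreover have "b ^ 3 \<ge> 0" using that by simp
        ultimately show ?thesis by (simp add: power3_eq_cube power2_eq_square)
      qed
      from mult_left_mono[OF this, of l] show ?thesis
        using l by (simp add: c_def power_divide)
    qed
    have "(f x) ^ 3 - (g x) ^ 3 = ?d x * ((f x)\<^sup>2 + f x * g x + (g x)\<^sup>2)"
      by (simp add: power3_eq_cube power2_eq_square algebra_simps)
    then have "((f x) ^ 3 - (g x) ^ 3)\<^sup>2 = (?d x)\<^sup>2 * ((f x)\<^sup>2 + f x * g x + (g x)\<^sup>2)\<^sup>2"
      by (simp add: power_mult_distrib)
    also have "\<dots> \<le> (?d x)\<^sup>2 * (9 / 2 * (((f x)\<^sup>2)\<^sup>2 + ((g x)\<^sup>2)\<^sup>2))"
    proof (rule mult_left_mono)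
      have abs_gen: "\<bar>a + p + b\<bar> \<le> \<bar>3 / 2 * (a + b)\<bar>"
        if "p \<le> (a + b) / 2" "- p \<le> (a + b) / 2" "a \<ge> 0" "b \<ge> 0" for a b p :: real
        using that by (auto simp: abs_le_iff)
      have "2 * f x * g x \<le> (f x)\<^sup>2 + (g x)\<^sup>2" "- (2 * f x * g x) \<le> (f x)\<^sup>2 + (g x)\<^sup>2"
        using sum_squares_bound[of "f x" "g x"] sum_squares_bound[of "- f x" "g x"] by auto
      then have "f x * g x \<le> ((f x)\<^sup>2 + (g x)\<^sup>2) / 2" "- (f x * g x) \<le> ((f x)\<^sup>2 + (g x)\<^sup>2) / 2"
        by (simp_all add: mult.assoc)
      then have "\<bar>(f x)\<^sup>2 + f x * g x + (g x)\<^sup>2\<bar> \<le> \<bar>3 / 2 * ((f x)\<^sup>2 + (g x)\<^sup>2)\<bar>"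
        using abs_gen[of "f x * g x" "(f x)\<^sup>2" "(g x)\<^sup>2"] by simp
      then have "((f x)\<^sup>2 + f x * g x + (g x)\<^sup>2)\<^sup>2 \<le> (3 / 2 * ((f x)\<^sup>2 + (g x)\<^sup>2))\<^sup>2"
        by (simp only: abs_le_square_iff)
      also have "\<dots> = 9 / 4 * ((f x)\<^sup>2 + (g x)\<^sup>2)\<^sup>2"
        by (subst power_mult_distrib) (simp add: power_divide)
      also have "\<dots> \<le> 9 / 2 * (((f x)\<^sup>2)\<^sup>2 + ((g x)\<^sup>2)\<^sup>2)"
        using sum_squares_bound[of "(f x)\<^sup>2" "(g x)\<^sup>2"] by (simp add: power2_sum)
      finally show "((f x)\<^sup>2 + f x * g x + (g x)\<^sup>2)\<^sup>2 \<le> 9 / 2 * (((f x)\<^sup>2)\<^sup>2 + ((g x)\<^sup>2)\<^sup>2)" .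
    qed simp
    also have "\<dots> = 9 / 2 * ((?d x)\<^sup>2 * ((f x)\<^sup>2)\<^sup>2 + (?d x)\<^sup>2 * ((g x)\<^sup>2)\<^sup>2)" by (simp add: algebra_simps)
    also have "\<dots> \<le> 9 / 2 * (l * (((?d x)\<^sup>2) ^ 3 / l ^ 3 + ((f x)\<^sup>2) ^ 3) + l * (((?d x)\<^sup>2) ^ 3 / l ^ 3 + ((g x)\<^sup>2) ^ 3))"
      by (intro mult_left_mono add_mono young) auto
    also have "\<dots> = 9 / 2 * l * (2 * ((?d x) ^ 6 / l ^ 3) + (f x) ^ 6 + (g x) ^ 6)"
      by (simp add: algebra_simps flip: power_mult)
    finally show ?thesis .
  qed
  have "(norm (mk (\<lambda>x. (f x) ^ 3) - mk (\<lambda>x. (g x) ^ 3)))\<^sup>2 = (\<integral>x. ((f x) ^ 3 - (g x) ^ 3)\<^sup>2 \<partial>lebesgue)"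
    using norm_mk_sq[OF L2_diff[OF cube_L2[OF f] cube_L2[OF g]]] mk_diff[OF cube_L2[OF f] cube_L2[OF g]] by simp
  also have "\<dots> \<le> (\<integral>x. 9 / 2 * l * (2 * ((?d x) ^ 6 / l ^ 3) + (f x) ^ 6 + (g x) ^ 6) \<partial>lebesgue)"
  proof (rule integral_mono[OF _ _ key])
    show "integrable lebesgue (\<lambda>x. ((f x) ^ 3 - (g x) ^ 3)\<^sup>2)"
      by (intro L2_integrable_sq L2_diff cube_L2 f g)
    show "integrable lebesgue (\<lambda>x. 9 / 2 * l * (2 * ((?d x) ^ 6 / l ^ 3) + (f x) ^ 6 + (g x) ^ 6))"
      by (intro integrable_mult_right Bochner_Integration.integrable_add integrable_divide H1_sixth_power f g d)
  qed
  also have "\<dots> = 9 / 2 * l * (2 * ((\<integral>x. (?d x) ^ 6 \<partial>lebesgue) / l ^ 3) + (\<integral>x. (f x) ^ 6 \<partial>lebesgue) + (\<integral>x. (g x) ^ 6 \<partial>lebesgue))"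
    using H1_sixth_power(1)[OF f] H1_sixth_power(1)[OF g] H1_sixth_power(1)[OF d] by simp
  also have "\<dots> \<le> 9 / 2 * l * (2 * 1 + (\<integral>x. (f x) ^ 6 \<partial>lebesgue) + (\<integral>x. (g x) ^ 6 \<partial>lebesgue))"
    using l dint by (intro mult_left_mono add_mono) (auto simp: divide_le_eq)
  finally show ?thesis
    by (simp add: l_def norm_cube_sq f g)
qed

subsection \<open>Integration by parts\<close>

text \<open>A derivative along a single axis is all that one integration by parts consumes. This
  notion covers the smooth mollified functions and the rational weights alike, so that the weights
  need only explicit first derivatives.\<close>

definition dir_deriv :: "3 \<Rightarrow> (R3 \<Rightarrow> real) \<Rightarrow> (R3 \<Rightarrow> real) \<Rightarrow> bool" where
  "dir_deriv i g g' \<longleftrightarrow> (\<forall>x. ((\<lambda>s. g (x + s *\<^sub>R axis i 1)) has_real_derivative g' x) (at 0))"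

lemma dir_deriv_mult:
  assumes "dir_deriv i f f'" "dir_deriv i g g'"
  shows "dir_deriv i (\<lambda>x. f x * g x) (\<lambda>x. f' x * g x + f x * g' x)"
  unfolding dir_deriv_def
proof
  fix x :: R3
  have "((\<lambda>s. f (x + s *\<^sub>R axis i 1) * g (x + s *\<^sub>R axis i 1)) has_real_derivative
      f' x * g (x + 0 *\<^sub>R axis i 1) + g' x * f (x + 0 *\<^sub>R axis i 1)) (at 0)"
    using assms unfolding dir_deriv_def by (intro DERIV_mult) auto
  then show "((\<lambda>s. f (x + s *\<^sub>R axis i 1) * g (x + s *\<^sub>R axis i 1)) has_real_derivative
      f' x * g x + f x * g' x) (at 0)"
    by (simp add: mult.commute)
qed

lemma dir_deriv_smooth:
  assumes "smooth f"
  shows "dir_deriv i f (partial i f)"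
  unfolding dir_deriv_def
proof
  fix x :: R3
  have "((\<lambda>s. x + s *\<^sub>R axis i 1) has_derivative (\<lambda>h. h *\<^sub>R axis i 1)) (at 0)"
    by (auto intro!: derivative_eq_intros)
  moreover have "(f has_derivative (\<lambda>h. \<Sum>j\<in>UNIV. h $ j * partial j f x)) (at (x + 0 *\<^sub>R axis i 1))"
    using has_derivative_partial[OF smooth_differentiable[OF assms, of x]] by simp
  ultimately have "((\<lambda>s. f (x + s *\<^sub>R axis i 1)) has_derivative
      (\<lambda>h. \<Sum>j\<in>UNIV. (h *\<^sub>R axis i 1 :: R3) $ j * partial j f x)) (at 0)"
    by (rule has_derivative_compose)
  moreover have "(\<lambda>h. \<Sum>j\<in>UNIV. (h *\<^sub>R axis i 1 :: R3) $ j * partial j f x) = (\<lambda>h. partial i f x * h)"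
    by (auto simp: axis_def if_distrib if_distribR mult.commute cong: if_cong)
  ultimately show "((\<lambda>s. f (x + s *\<^sub>R axis i 1)) has_real_derivative partial i f x) (at 0)"
    by (simp add: has_field_derivative_def)
qed

lemma lborel_shift:
  fixes G :: "R3 \<Rightarrow> real"
  assumes "integrable lborel G"
  shows "integrable lborel (\<lambda>x. G (x + c))" "(\<integral>x. G (x + c) \<partial>lborel) = (\<integral>x. G x \<partial>lborel)"
proof -
  have [measurable]: "G \<in> borel_measurable borel" using borel_measurable_integrable[OF assms] by simp
  have "integrable (distr lborel borel ((+) c)) G" using assms by (simp add: lborel_distr_plus)
  then show "integrable lborel (\<lambda>x. G (x + c))" by (subst (asm) integrable_distr_eq) (auto simp: add.commute)
  have "(\<integral>x. G x \<partial>lborel) = (\<integral>x. G x \<partial>distr lborel borel ((+) c))" by (simp add: lborel_distr_plus)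
  also have "\<dots> = (\<integral>x. G (c + x) \<partial>lborel)" by (rule integral_distr) auto
  finally show "(\<integral>x. G (x + c) \<partial>lborel) = (\<integral>x. G x \<partial>lborel)" by (simp add: add.commute)
qed

text \<open>By the fundamental theorem of calculus, the integral of \<open>g'\<close> is that of
  \<open>x \<mapsto> g (x + e\<^sub>i) - g x\<close>, which vanishes by translation invariance.\<close>

lemma integral_dir_deriv_lborel:
  assumes D: "dir_deriv i g g'" and c: "continuous_on UNIV g'"
    and g: "integrable lborel g" and g': "integrable lborel g'"
  shows "(\<integral>x. g' x \<partial>lborel) = 0"
proof -
  let ?e = "axis i 1 :: R3"
  note [measurable] = borel_measurable_continuous_onI[OF c]
  have DD: "((\<lambda>s. g (x + s *\<^sub>R ?e)) has_real_derivative g' (x + s *\<^sub>R ?e)) (at s)" for x s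
  proof -
    have "((\<lambda>t. g ((x + s *\<^sub>R ?e) + t *\<^sub>R ?e)) has_real_derivative g' (x + s *\<^sub>R ?e)) (at 0)"
      using D by (simp add: dir_deriv_def)
    then have "((\<lambda>t. g (x + (t + s) *\<^sub>R ?e)) has_real_derivative g' (x + s *\<^sub>R ?e)) (at 0)"
      by (simp add: algebra_simps)
    then show ?thesis
      using DERIV_shift[of "\<lambda>t. g (x + t *\<^sub>R ?e)" "g' (x + s *\<^sub>R ?e)" 0 s] by simp
  qed
  let ?F = "\<lambda>s x. indicator {0..1} s * g' (x + s *\<^sub>R ?e)"
  have FTC: "(\<integral>s. ?F s x \<partial>lborel) = g (x + ?e) - g x" for x
  proof -
    have "(\<integral>s. indicator {0..1} s *\<^sub>R g' (x + s *\<^sub>R ?e) \<partial>lborel) = g (x + 1 *\<^sub>R ?e) - g (x + 0 *\<^sub>R ?e)"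
    proof (rule integral_FTC_Icc)
      show "((\<lambda>s. g (x + s *\<^sub>R ?e)) has_vector_derivative g' (x + s *\<^sub>R ?e)) (at s within {0..1})" for s
        using DD[of x s] by (simp add: has_real_derivative_iff_has_vector_derivative[symmetric] has_field_derivative_at_within)
      show "continuous_on {0..1} (\<lambda>s. g' (x + s *\<^sub>R ?e))"
        by (rule continuous_on_compose2[OF c]) (auto intro!: continuous_intros)
    qed simp
    then show ?thesis by simp
  qed
  have int: "integrable (lborel \<Otimes>\<^sub>M lborel) (\<lambda>(s, x). ?F s x)"
  proof (rule lborel_pair.Fubini_integrable)
    have "continuous_on UNIV (\<lambda>p. g' (snd p + fst p *\<^sub>R ?e))"
      by (rule continuous_on_compose2[OF c]) (auto intro!: continuous_intros)
    then have "(\<lambda>p. g' (snd p + fst p *\<^sub>R ?e)) \<in> borel_measurable (borel \<Otimes>\<^sub>M borel)"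
      by (simp add: borel_measurable_continuous_onI borel_prod)
    then have [measurable]: "(\<lambda>p. g' (snd p + fst p *\<^sub>R ?e)) \<in> borel_measurable (lborel \<Otimes>\<^sub>M lborel)" by simp
    show "(\<lambda>(s, x). ?F s x) \<in> borel_measurable (lborel \<Otimes>\<^sub>M lborel)"
      unfolding case_prod_beta by measurable
    have "(\<integral>x. norm (?F s x) \<partial>lborel) = indicator {0..1} s * (\<integral>x. \<bar>g' x\<bar> \<partial>lborel)" for s
      using lborel_shift(2)[OF integrable_abs[OF g'], of "s *\<^sub>R ?e"] by (simp add: abs_mult)
    then show "integrable lborel (\<lambda>s. \<integral>x. norm (case (s, x) of (s, x) \<Rightarrow> ?F s x) \<partial>lborel)"
      by (simp add: integrable_real_indicator)
    show "AE s in lborel. integrable lborel (\<lambda>x. case (s, x) of (s, x) \<Rightarrow> ?F s x)"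
      using lborel_shift(1)[OF g'] by auto
  qed
  have "0 = (\<integral>x. g (x + ?e) \<partial>lborel) - (\<integral>x. g x \<partial>lborel)"
    using lborel_shift(2)[OF g] by simp
  also have "\<dots> = (\<integral>x. (\<integral>s. ?F s x \<partial>lborel) \<partial>lborel)"
    unfolding FTC using lborel_shift(1)[OF g] g by simp
  also have "\<dots> = (\<integral>s. (\<integral>x. ?F s x \<partial>lborel) \<partial>lborel)"
    by (rule lborel_pair.Fubini_integral[OF int])
  also have "\<dots> = (\<integral>s. indicator {0..1 :: real} s * (\<integral>x. g' x \<partial>lborel) \<partial>lborel)"
    using lborel_shift(2)[OF g'] by simp
  also have "\<dots> = (\<integral>x. g' x \<partial>lborel)" by simp
  finally show ?thesis ..
qed

lemma integral_dir_deriv: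
  assumes D: "dir_deriv i g g'" and c: "continuous_on UNIV g" "continuous_on UNIV g'"
    and g: "integrable lebesgue g" "integrable lebesgue g'"
  shows "(\<integral>x. g' x \<partial>lebesgue) = 0"
proof -
  note [measurable] = borel_measurable_continuous_onI[OF c(1)] borel_measurable_continuous_onI[OF c(2)]
  have "integrable lborel g" "integrable lborel g'"
    using g by (simp_all add: integrable_completion)
  then show ?thesis
    using integral_dir_deriv_lborel[OF D c(2)] by (simp add: integral_completion)
qed

text \<open>All terms of the multiplier computation have this shape, which reduces that computation
  to linear relations between finitely many numbers.\<close>

definition tri :: "(R3 \<Rightarrow> real) \<Rightarrow> (R3 \<Rightarrow> real) \<Rightarrow> (R3 \<Rightarrow> real) \<Rightarrow> real" where
  "tri m f g = (\<integral>x. m x * f x * g x \<partial>lebesgue)"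

lemma tri_integrable:
  "bdd_measurable m \<Longrightarrow> f \<in> L2 \<Longrightarrow> g \<in> L2 \<Longrightarrow> integrable lebesgue (\<lambda>x. m x * f x * g x)"
  by (rule L2_mult_integrable[OF L2_bdd_mult])

lemma Mul_inner_mk: "bdd_measurable m \<Longrightarrow> f \<in> L2 \<Longrightarrow> g \<in> L2 \<Longrightarrow> Mul m (mk f) \<bullet> mk g = tri m f g"
  by (simp add: Mul_mk inner_mk L2_bdd_mult tri_def)

lemma tri_commute: "tri m f g = tri m g f"
  by (simp add: tri_def mult_ac)

text \<open>The regularity for which a bounded weight times a product of two such functions has an
  integrable partial derivative. Mollified L2 functions and their partial derivatives qualify; none
  of them has to vanish at infinity pointwise.\<close>

definition good :: "(R3 \<Rightarrow> real) \<Rightarrow> bool" where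
  "good f \<longleftrightarrow> smooth f \<and> f \<in> L2 \<and> (\<forall>i. partial i f \<in> L2)"

lemma good_L2: "good f \<Longrightarrow> f \<in> L2" "good f \<Longrightarrow> partial i f \<in> L2"
  by (auto simp: good_def)

text \<open>The product rule combined with \<open>integral_dir_deriv\<close>: the boundary term is
  absent because the product and its derivative are integrable over the whole space.\<close>

lemma tri_by_parts:
  assumes m: "dir_deriv i m m'" "continuous_on UNIV m" "continuous_on UNIV m'" "bdd_measurable m" "bdd_measurable m'"
    and f: "good f" and g: "good g"
  shows "tri m' f g + tri m (partial i f) g + tri m f (partial i g) = 0"
proof -
  have sf: "smooth f" "smooth g" using f g by (auto simp: good_def)
  have cf: "continuous_on UNIV f" "continuous_on UNIV g" "continuous_on UNIV (partial i f)" "continuous_on UNIV (partial i g)"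
    using sf by (auto intro: smooth_continuous smooth_partial)
  note int = tri_integrable[OF m(5) good_L2(1)[OF f] good_L2(1)[OF g]]
    tri_integrable[OF m(4) good_L2(2)[OF f] good_L2(1)[OF g], of i]
    tri_integrable[OF m(4) good_L2(1)[OF f] good_L2(2)[OF g], of i]
  have "(\<integral>x. (m' x * f x + m x * partial i f x) * g x + m x * f x * partial i g x \<partial>lebesgue) = 0"
  proof (rule integral_dir_deriv)
    show "dir_deriv i (\<lambda>x. m x * f x * g x) (\<lambda>x. (m' x * f x + m x * partial i f x) * g x + m x * f x * partial i g x)"
      by (intro dir_deriv_mult m dir_deriv_smooth sf)
    show "continuous_on UNIV (\<lambda>x. m x * f x * g x)"
      "continuous_on UNIV (\<lambda>x. (m' x * f x + m x * partial i f x) * g x + m x * f x * partial i g x)"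
      by (intro continuous_intros m cf)+
    show "integrable lebesgue (\<lambda>x. m x * f x * g x)" by (rule tri_integrable[OF m(4) good_L2(1)[OF f] good_L2(1)[OF g]])
    show "integrable lebesgue (\<lambda>x. (m' x * f x + m x * partial i f x) * g x + m x * f x * partial i g x)"
      using int by (simp add: distrib_right)
  qed
  then show ?thesis using int by (simp add: tri_def distrib_right)
qed

subsection \<open>Symmetry of second derivatives of mollified functions\<close>

lemma sum_axis: "(\<Sum>k\<in>UNIV. axis i 1 $ k * c k) = (c i :: real)"
  by (simp add: axis_def if_distrib[of "\<lambda>x. x * _"] cong: if_cong)

lemma partial_add:
  assumes "f differentiable (at x)" "g differentiable (at x)"
  shows "partial i (\<lambda>x. f x + g x) x = partial i f x + partial i g x"
  by (subst partial_eqI[OF has_derivative_add[OF has_derivative_partial[OF assms(1)] has_derivative_partial[OF assms(2)]]])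
     (simp only: sum_axis)

lemma partial_mult:
  assumes "f differentiable (at x)" "g differentiable (at x)"
  shows "partial i (\<lambda>x. f x * g x) x = f x * partial i g x + partial i f x * g x"
  by (subst partial_eqI[OF has_derivative_mult[OF has_derivative_partial[OF assms(1)] has_derivative_partial[OF assms(2)]]])
     (simp only: sum_axis)

lemma partial_expinv:
  assumes "f differentiable (at x)"
  shows "partial i (\<lambda>x. expinv k (f x)) x = (expinv (k + 2) (f x) + - real k * expinv (k + 1) (f x)) * partial i f x"
  by (subst partial_eqI[OF DERIV_compose_FDERIV[OF DERIV_expinv has_derivative_partial[OF assms]]])
     (simp only: sum_axis, simp)

lemma partial_const: "partial i (\<lambda>_. c) x = 0"
  by (rule partial_eqI) simp

lemma partial_coord: "partial i (\<lambda>x. x $ j) x = axis i 1 $ j"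
  by (rule partial_eqI) (rule bounded_linear_imp_has_derivative[OF bounded_linear_vec_nth])

text \<open>Symmetry is checked along the construction of \<open>gen\<close>. In the composition
  case the chain rule writes the derivative of the outer factor as a common multiple
  \<open>c\<close> of the partial derivatives of \<open>f\<close>, so the additional term is a
  product of two first derivatives and symmetric by inspection.\<close>

lemma gen_partial_commute: "f \<in> gen \<Longrightarrow> partial i (partial j f) x = partial j (partial i f) x"
proof (induction arbitrary: x rule: gen.induct)
  case (gen_const c)
  show ?case by (simp add: partial_const[abs_def])
next
  case (gen_coord k)
  show ?case by (simp add: partial_coord[abs_def] partial_const)
next
  case (gen_expinv f k)
  have d: "f differentiable (at x)" "partial i f differentiable (at x)" for x i
    by (auto intro: smooth_differentiable smooth_partial gen_smooth gen_expinv.hyps)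
  let ?E = "\<lambda>x. expinv (k + 2) (f x) + - real k * expinv (k + 1) (f x)"
  have E: "?E \<in> gen" by (intro gen.intros gen_expinv.hyps)
  have dE: "?E differentiable (at x)" for x by (rule smooth_differentiable[OF gen_smooth[OF E]])
  have dE1: "(\<lambda>x. expinv n (f x)) differentiable (at x)" for n x
    by (rule smooth_differentiable[OF gen_smooth[OF gen.gen_expinv[OF gen_expinv.hyps]]])
  have dE2: "(\<lambda>x. - real k * expinv (k + 1) (f x)) differentiable (at x)" for x
    by (rule smooth_differentiable[OF gen_smooth]) (intro gen.intros gen_expinv.hyps)
  have "\<exists>c. \<forall>j. partial j ?E x = c * partial j f x"
  proof -
    have "partial j (\<lambda>x. - real k * expinv (k + 1) (f x)) x =
      - real k * (expinv (k + 1 + 2) (f x) + - real (k + 1) * expinv (k + 1 + 1) (f x)) * partial j f x" for j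
      by (subst partial_mult) (simp_all add: partial_const partial_expinv d dE1 differentiable_const del: of_nat_add)
    then have "partial j ?E x = ((expinv (k + 2 + 2) (f x) + - real (k + 2) * expinv (k + 2 + 1) (f x)) +
      - real k * (expinv (k + 1 + 2) (f x) + - real (k + 1) * expinv (k + 1 + 1) (f x))) * partial j f x" for j
      by (subst partial_add[OF dE1 dE2], subst partial_expinv[OF d(1)], simp only: distrib_right)
    then show ?thesis by blast
  qed
  then obtain c where c: "\<And>j. partial j ?E x = c * partial j f x" by blast
  have "partial i (partial j (\<lambda>x. expinv k (f x))) x = ?E x * partial i (partial j f) x + c * partial i f x * partial j f x" for i j
  proof -
    have "partial j (\<lambda>x. expinv k (f x)) = (\<lambda>x. ?E x * partial j f x)"
      by (rule ext) (rule partial_expinv[OF d(1)])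
    then show ?thesis by (simp only: partial_mult[OF dE d(2)] c)
  qed
  then show ?case by (simp add: gen_expinv.IH)
next
  case (gen_add f g)
  have d: "f differentiable (at x)" "partial i f differentiable (at x)" "g differentiable (at x)" "partial i g differentiable (at x)" for x i
    by (auto intro: smooth_differentiable smooth_partial gen_smooth gen_add.hyps)
  show ?case by (simp add: partial_add[OF d(1,3), abs_def] partial_add[OF d(2,4)] gen_add.IH)
next
  case (gen_mult f g)
  have d: "f differentiable (at x)" "partial i f differentiable (at x)" "g differentiable (at x)" "partial i g differentiable (at x)" for x i
    by (auto intro: smooth_differentiable smooth_partial gen_smooth gen_mult.hyps)
  have d2: "(\<lambda>x. f x * partial i g x) differentiable (at x)" "(\<lambda>x. partial i f x * g x) differentiable (at x)" for x i
    by (intro differentiable_mult d)+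
  have "partial i (partial j (\<lambda>x. f x * g x)) x =
      f x * partial i (partial j g) x + partial i f x * partial j g x + (partial j f x * partial i g x + partial i (partial j f) x * g x)" for i j
    using partial_add[OF d2] by (simp add: partial_mult[OF d(1,3), abs_def] partial_mult d)
  then show ?case by (simp add: gen_mult.IH)
qed

lemma moll_gen: "moll n \<in> gen"
proof -
  have "moll n = (\<lambda>x. (1 / (\<integral>x. bump (1 / real (Suc n)) x \<partial>lebesgue)) * bump (1 / real (Suc n)) x)"
    by (simp add: moll_def mollifier_def fun_eq_iff)
  also have "\<dots> \<in> gen" by (intro gen.intros bump_gen)
  finally show ?thesis .
qed

lemma good_conv: "\<kappa> \<in> test_functions \<Longrightarrow> f \<in> L2 \<Longrightarrow> good (conv \<kappa> f)"
  by (simp add: good_def smooth_conv conv_L2 partial_conv test_partial)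

lemma partial_commute_conv:
  assumes "f \<in> L2"
  shows "partial i (partial j (conv (moll n) f)) = partial j (partial i (conv (moll n) f))"
proof -
  have "partial i (partial j (moll n)) = partial j (partial i (moll n))"
    by (rule ext) (rule gen_partial_commute[OF moll_gen])
  then show ?thesis by (simp add: partial_conv moll_test test_partial assms)
qed

subsection \<open>The multiplier\<close>

text \<open>In the notation of the proof idea, \<open>th\<close>, \<open>fv\<close>, \<open>wv\<close> and \<open>qv\<close> are \<open>\<theta>\<close>, \<open>f\<close>, \<open>w\<close> and \<open>q\<close>, and \<open>dirv\<close> is
  \<open>f / k\<close>. The formulas \<open>dfv k i j\<close> and \<open>dqv k i\<close> are those of \<open>\<partial>\<^sub>if\<^sub>j\<close> and \<open>\<partial>\<^sub>iq\<close>.\<close>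

definition th :: "real \<Rightarrow> R3 \<Rightarrow> real" where "th k x = k\<^sup>2 / (k\<^sup>2 + x \<bullet> x)"
definition dirv :: "real \<Rightarrow> 3 \<Rightarrow> R3 \<Rightarrow> real" where "dirv k i x = th k x * x $ i / k"
definition fv :: "real \<Rightarrow> 3 \<Rightarrow> R3 \<Rightarrow> real" where "fv k i x = k * dirv k i x"
definition dfv :: "real \<Rightarrow> 3 \<Rightarrow> 3 \<Rightarrow> R3 \<Rightarrow> real" where
  "dfv k i j x = (if i = j then th k x else 0) - 2 * dirv k i x * dirv k j x"
definition wv :: "real \<Rightarrow> R3 \<Rightarrow> real" where "wv k x = 1 - th k x - 1 / (16 * k)"
definition qv :: "real \<Rightarrow> R3 \<Rightarrow> real" where "qv k x = 1 - 1 / (16 * k) - th k x / 2 + (th k x)\<^sup>2"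
definition dqv :: "real \<Rightarrow> 3 \<Rightarrow> R3 \<Rightarrow> real" where
  "dqv k i x = (th k x - 4 * (th k x)\<^sup>2) * dirv k i x / k"

lemma th_bounds:
  assumes "k > 0"
  shows "th k x > 0" "th k x \<le> 1"
proof -
  have "k\<^sup>2 + x \<bullet> x > 0" using assms by (simp add: add_pos_nonneg)
  then show "th k x > 0" "th k x \<le> 1" using assms by (auto simp: th_def)
qed

text \<open>|x|^2 / (k^2 + |x|^2) equals 1 - \<theta>. Dividing \<theta> x by \<open>k\<close> thus
  produces a vector of length at most one whose square is a polynomial in \<theta>, so all estimates
  on the weights become estimates in the single variable \<theta>.\<close>

lemma sum_dirv_sq:
  assumes "k > 0"
  shows "(\<Sum>i\<in>UNIV. (dirv k i x)\<^sup>2) = th k x * (1 - th k x)"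
proof -
  have p: "k\<^sup>2 + x \<bullet> x > 0" using assms by (simp add: add_pos_nonneg)
  have "(dirv k i x)\<^sup>2 = (th k x)\<^sup>2 / k\<^sup>2 * (x $ i * x $ i)" for i
    by (simp add: dirv_def power2_eq_square)
  then have "(\<Sum>i\<in>UNIV. (dirv k i x)\<^sup>2) = (th k x)\<^sup>2 / k\<^sup>2 * (x \<bullet> x)"
    by (simp add: inner_vec_def sum_distrib_left)
  also have "\<dots> = th k x * (1 - th k x)"
    using p assms by (simp add: th_def power2_eq_square divide_simps)
  finally show ?thesis .
qed

text \<open>The identity part of the derivative has trace 3 \<theta>, and the rank-one part removes
  2 \<theta> (1 - \<theta>).\<close>

lemma sum_dfv_diag:
  assumes "k > 0"
  shows "(\<Sum>i\<in>UNIV. dfv k i i x) = th k x + 2 * (th k x)\<^sup>2"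
proof -
  have "(\<Sum>i\<in>UNIV. dfv k i i x) = 3 * th k x - 2 * (\<Sum>i\<in>UNIV. (dirv k i x)\<^sup>2)"
    by (simp add: dfv_def sum_subtractf sum_distrib_left power2_eq_square mult_ac)
  then show ?thesis unfolding sum_dirv_sq[OF assms] by (simp add: power2_eq_square algebra_simps)
qed

lemma qv_eq: "k > 0 \<Longrightarrow> qv k x = wv k x + (\<Sum>i\<in>UNIV. dfv k i i x) / 2"
  by (simp add: sum_dfv_diag qv_def wv_def)

lemma abs_dirv_le:
  assumes "k > 0"
  shows "\<bar>dirv k i x\<bar> \<le> 1"
proof -
  have "(dirv k i x)\<^sup>2 \<le> (\<Sum>i\<in>UNIV. (dirv k i x)\<^sup>2)" by (rule member_le_sum) auto
  also have "\<dots> \<le> 1 * 1"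
    unfolding sum_dirv_sq[OF assms] using th_bounds[OF assms, of x] by (intro mult_mono) auto
  finally show ?thesis by (simp add: abs_square_le_1)
qed

lemma dir_deriv_th:
  assumes "k > 0"
  shows "dir_deriv i (th k) (\<lambda>x. - 2 * th k x * dirv k i x / k)"
  unfolding dir_deriv_def
proof
  fix x :: R3
  have p: "k\<^sup>2 + x \<bullet> x > 0" using assms by (simp add: add_pos_nonneg)
  have e: "(x + s *\<^sub>R axis i 1) \<bullet> (x + s *\<^sub>R axis i 1) = x \<bullet> x + 2 * s * x $ i + s\<^sup>2" for s
    by (simp add: inner_add_left inner_add_right inner_axis inner_axis' power2_eq_square algebra_simps)
  have "((\<lambda>s. k\<^sup>2 / (k\<^sup>2 + (x \<bullet> x + 2 * s * x $ i + s\<^sup>2))) has_real_derivative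
      - (k\<^sup>2 * (2 * x $ i)) / (k\<^sup>2 + x \<bullet> x)\<^sup>2) (at 0)"
    using p by (auto intro!: derivative_eq_intros simp: power2_eq_square)
  moreover have "- (k\<^sup>2 * (2 * x $ i)) / (k\<^sup>2 + x \<bullet> x)\<^sup>2 = - 2 * th k x * dirv k i x / k"
    using p assms by (simp add: th_def dirv_def power2_eq_square divide_simps)
  ultimately show "((\<lambda>s. th k (x + s *\<^sub>R axis i 1)) has_real_derivative - 2 * th k x * dirv k i x / k) (at 0)"
    unfolding th_def e by simp
qed

lemma dir_deriv_coord: "dir_deriv i (\<lambda>x. x $ j) (\<lambda>x. if i = j then 1 else 0)"
  unfolding dir_deriv_def by (auto simp: axis_def intro!: derivative_eq_intros)

lemma dir_deriv_fv:
  assumes "k > 0"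
  shows "dir_deriv i (fv k j) (dfv k i j)"
proof -
  have "fv k j = (\<lambda>x. th k x * x $ j)" using assms by (simp add: fun_eq_iff fv_def dirv_def)
  moreover have "dfv k i j = (\<lambda>x. (- 2 * th k x * dirv k i x / k) * x $ j + th k x * (if i = j then 1 else 0))"
    using assms by (auto simp: fun_eq_iff dfv_def dirv_def)
  ultimately show ?thesis
    using dir_deriv_mult[OF dir_deriv_th[OF assms] dir_deriv_coord, of i j] by simp
qed

lemma dir_deriv_qv:
  assumes "k > 0"
  shows "dir_deriv i (qv k) (dqv k i)"
  unfolding dir_deriv_def
proof
  fix x :: R3
  have t: "((\<lambda>s. th k (x + s *\<^sub>R axis i 1)) has_real_derivative - 2 * th k x * dirv k i x / k) (at 0)"
    using dir_deriv_th[OF assms] by (simp add: dir_deriv_def)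
  show "((\<lambda>s. qv k (x + s *\<^sub>R axis i 1)) has_real_derivative dqv k i x) (at 0)"
    unfolding qv_def using assms
    by (auto intro!: derivative_eq_intros t simp: dqv_def power2_eq_square divide_simps) (simp add: algebra_simps)
qed

lemma continuous_th: "k > 0 \<Longrightarrow> continuous_on UNIV (th k)"
  unfolding th_def[abs_def]
  by (intro continuous_intros) (metis add_pos_nonneg inner_ge_zero less_irrefl zero_less_power)

lemma continuous_dirv: "k > 0 \<Longrightarrow> continuous_on UNIV (dirv k i)"
  unfolding dirv_def[abs_def] by (intro continuous_intros continuous_th) auto

lemma continuous_weights:
  assumes "k > 0"
  shows "continuous_on UNIV (fv k i)" "continuous_on UNIV (dfv k i j)" "continuous_on UNIV (wv k)"
    "continuous_on UNIV (qv k)" "continuous_on UNIV (dqv k i)"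
proof -
  note c = continuous_th[OF assms] continuous_dirv[OF assms]
  show "continuous_on UNIV (fv k i)" "continuous_on UNIV (wv k)" "continuous_on UNIV (qv k)"
    unfolding fv_def[abs_def] wv_def[abs_def] qv_def[abs_def]
    by (intro continuous_intros c; simp)+
  show "continuous_on UNIV (dqv k i)"
    unfolding dqv_def[abs_def] using assms by (intro continuous_intros c) auto
  show "continuous_on UNIV (dfv k i j)"
    unfolding dfv_def[abs_def] by (cases "i = j"; simp; intro continuous_intros c)
qed

lemma bdd_weights:
  assumes "k \<ge> 1"
  shows "bdd_measurable (fv k i)" "bdd_measurable (dfv k i j)" "bdd_measurable (wv k)"
    "bdd_measurable (qv k)" "bdd_measurable (dqv k i)"
proof -
  have k: "k > 0" using assms by simp
  note c = continuous_weights[OF k]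
  have t: "0 < th k x" "th k x \<le> 1" "(th k x)\<^sup>2 \<le> 1" for x
    using th_bounds[OF k, of x] by (auto simp: power_le_one)
  have a: "\<bar>dirv k i x\<bar> \<le> 1" for i x by (rule abs_dirv_le[OF k])
  have d: "0 \<le> 1 / (16 * k)" "1 / (16 * k) \<le> 1" using assms by (auto simp: divide_simps)
  show "bdd_measurable (fv k i)"
    by (rule bdd_measurableI[OF c(1), of _ k]) (use k a in \<open>auto simp: fv_def abs_mult\<close>)
  show "bdd_measurable (dfv k i j)"
  proof (rule bdd_measurableI[OF c(2)])
    fix x
    have "\<bar>dirv k i x * dirv k j x\<bar> \<le> 1 * 1"
      unfolding abs_mult using a by (intro mult_mono) auto
    moreover have "\<bar>c - 2 * b\<bar> \<le> 3" if "0 \<le> c" "c \<le> 1" "\<bar>b\<bar> \<le> 1" for b c :: real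
      using that by linarith
    ultimately show "\<bar>dfv k i j x\<bar> \<le> 3"
      unfolding dfv_def mult.assoc using t[of x] by simp
  qed
  show "bdd_measurable (wv k)"
  proof (rule bdd_measurableI[OF c(3)])
    fix x show "\<bar>wv k x\<bar> \<le> 2" unfolding wv_def using t[of x] d by linarith
  qed
  show "bdd_measurable (qv k)"
  proof (rule bdd_measurableI[OF c(4)])
    fix x show "\<bar>qv k x\<bar> \<le> 3" unfolding qv_def using t[of x] d zero_le_power2[of "th k x"] by linarith
  qed
  show "bdd_measurable (dqv k i)"
  proof (rule bdd_measurableI[OF c(5)])
    fix x
    have "\<bar>th k x - 4 * (th k x)\<^sup>2\<bar> \<le> 5" using t[of x] zero_le_power2[of "th k x"] by linarith
    then have "\<bar>(th k x - 4 * (th k x)\<^sup>2) * dirv k i x\<bar> \<le> 5 * 1"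
      unfolding abs_mult using a by (intro mult_mono) auto
    then show "\<bar>dqv k i x\<bar> \<le> 5" using assms by (simp add: dqv_def abs_mult divide_le_eq order_trans[OF _ mult_left_mono[of 1 k 5]])
  qed
qed

text \<open>Here \<open>G\<close> is \<open>\<bar>\<nabla>v\<bar>\<^sup>2\<close>, \<open>z\<close> is
  \<open>\<theta> x \<bullet> \<nabla>v / k\<close>, and the summand with the factor \<open>1 / (4 k)\<close> has integral zero: it is a Hardy
  inequality in disguise and compensates the negative sign of the weight \<open>1 - \<theta> - 1 / (16 k)\<close> near
  the origin.\<close>

lemma multiplier_coercive:
  fixes t G z v k :: real
  assumes k: "k \<ge> 100" and t: "0 < t" "t \<le> 1" and G: "G \<ge> 0" and z: "z\<^sup>2 \<le> t * (1 - t) * G"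
  shows "1 / (8 * k) * (G + v\<^sup>2) \<le> (t * G - 2 * z\<^sup>2) + (1 - t - 1 / (16 * k)) * G + (t - 4 * t\<^sup>2) * z * v / k
    + (1 - t - 1 / (16 * k)) * v\<^sup>2 + 1 / (4 * k) * ((t + 2 * t\<^sup>2) * v\<^sup>2 + 2 * (k * z * v))"
proof -
  define T where "T = 1 - t"
  define V where "V = v\<^sup>2"
  have T: "T \<ge> 0" "T \<le> 1" and V: "V \<ge> 0" using t by (auto simp: T_def V_def)
  define d where "d = 1 / k"
  have d: "d > 0" "d \<le> 1 / 100" using k by (auto simp: d_def divide_simps)
  \<comment> \<open>The maximum of t (1 - t) is 1 / 4, so the radial loss consumes at most half of
    the gradient term.\<close>
  have zz: "2 * z\<^sup>2 \<le> G / 2"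
  proof -
    have "t * (1 - t) \<le> 1 / 4" using zero_le_power2[of "t - 1/2"] by (simp add: power2_eq_square algebra_simps)
    then have "t * (1 - t) * G \<le> 1 / 4 * G" using G by (rule mult_right_mono)
    then show ?thesis using z by linarith
  qed
  \<comment> \<open>The factor \<open>T\<close> must stay on \<open>V\<close>: near the origin
    \<open>T\<close> vanishes and with it the main part \<open>T * V\<close> of the available
    \<open>V\<close>. It is supplied by the bound on \<open>z\<close>, which vanishes there as
    well.\<close>
  have zv: "\<bar>z * v\<bar> \<le> (G + T * V) / 2"
  proof -
    have "z\<^sup>2 \<le> T * G"
      using z mult_right_mono[OF mult_left_le_one_le[of "1 - t" t] G] t by (simp add: T_def)
    then have "(z * v)\<^sup>2 \<le> T * G * V" by (simp add: power_mult_distrib V_def mult_right_mono)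
    also have "\<dots> \<le> ((G + T * V) / 2)\<^sup>2"
      using zero_le_power2[of "G - T * V"] by (simp add: power2_eq_square algebra_simps)
    finally show ?thesis using G T V by (simp add: abs_le_square_iff[symmetric])
  qed
  have t4: "\<bar>t - 4 * t\<^sup>2\<bar> \<le> 3"
  proof -
    have "t\<^sup>2 \<le> t" using t by (simp add: power2_eq_square mult_left_le)
    moreover have "t\<^sup>2 \<ge> 0" by simp
    ultimately show ?thesis using t by linarith
  qed
  have cross: "\<bar>(t - 4 * t\<^sup>2) * z * v / k\<bar> \<le> 3 * d * ((G + T * V) / 2)"
  proof -
    have "\<bar>(t - 4 * t\<^sup>2) * (z * v)\<bar> \<le> 3 * ((G + T * V) / 2)"
      unfolding abs_mult[of _ "z * v"] using t4 zv by (intro mult_mono) auto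
    from mult_left_mono[OF this, of d] show ?thesis
      using d k by (simp add: d_def abs_mult mult_ac)
  qed
  have GT: "0 \<le> G + T * V" using G T V by simp
  have c2: "3 * d * ((G + T * V) / 2) \<le> 3 / 100 * ((G + T * V) / 2)"
    using d GT by (intro mult_right_mono) auto
  have TV: "0 \<le> T * V" "0 \<le> d * V" "0 \<le> d * G" using d T V G by auto
  have dle: "d * (T * V) \<le> 1 / 100 * (T * V)" "d * G \<le> 1 / 100 * G"
    by (rule mult_right_mono[OF d(2) TV(1)], rule mult_right_mono[OF d(2) G])
  \<comment> \<open>At the origin, where \<open>T = 0\<close>, this contributes
    \<open>d * V / 4\<close>, against the loss \<open>d * V / 16\<close> caused by the negative
    weight.\<close>
  have th: "1 / (4 * k) * ((t + 2 * t\<^sup>2) * v\<^sup>2 + 2 * (k * z * v)) \<ge> d * V / 4 - d * (T * V) / 4 + (z * v) / 2"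
  proof -
    have "1 / (4 * k) * ((t + 2 * t\<^sup>2) * v\<^sup>2 + 2 * (k * z * v)) = d / 4 * (t * V) + d / 2 * (t\<^sup>2 * V) + (z * v) / 2"
      using k by (simp add: d_def V_def field_simps)
    moreover have "0 \<le> d / 2 * (t\<^sup>2 * V)" using d V by simp
    moreover have "d / 4 * (t * V) = d * V / 4 - d * (T * V) / 4" by (simp add: T_def field_simps)
    ultimately show ?thesis by linarith
  qed
  have lin: "(t * G - 2 * z\<^sup>2) + (1 - t - 1 / (16 * k)) * G + (1 - t - 1 / (16 * k)) * v\<^sup>2
      = G - 2 * z\<^sup>2 - d * G / 16 + T * V - d * V / 16"
    using k by (simp add: d_def T_def V_def field_simps)
  have l: "1 / (8 * k) * (G + v\<^sup>2) = d * G / 8 + d * V / 8" using k by (simp add: d_def V_def field_simps)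
  have c1: "- (3 / 100 * ((G + T * V) / 2)) \<le> (t - 4 * t\<^sup>2) * z * v / k"
    using abs_le_D2[OF order_trans[OF cross c2]] by (simp only: minus_le_iff)
  have c3: "- ((G + T * V) / 2) \<le> z * v" using zv by linarith
  \<comment> \<open>The products are renamed to variables so that the remaining goal is linear.
    Balance for \<open>dV\<close>: 1/4 - 1/16 = 3/16 exceeds the required 1/8. Balance for
    \<open>G\<close>: 1 - 1/2 - 1/4 = 1/4, from which 3/200 for the cross term and multiples of
    \<open>dG\<close> are paid, the latter being small by \<open>k \<ge> 100\<close>. For
    \<open>TV\<close> there remains 1 - 1/4 up to small terms.\<close>
  have combine: "dG / 8 + dV / 8 \<le> A + B + X + C + H"
    if "A + B + C = G - 2 * y - dG / 16 + TV - dV / 16" "dV / 4 - dTV / 4 + u / 2 \<le> H"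
      "- (3 / 100 * ((G + TV) / 2)) \<le> X" "- ((G + TV) / 2) \<le> u" "2 * y \<le> G / 2" "0 \<le> TV" "0 \<le> dV"
      "dTV \<le> 1 / 100 * TV" "dG \<le> 1 / 100 * G" for A B C X H y u TV dV dTV dG
  proof -
    have "X \<ge> - (3 / 200 * G) - 3 / 200 * TV" "u \<ge> - (G / 2) - TV / 2"
      using that(3,4) by (simp_all add: field_simps)
    then show ?thesis using that(1,2,5-) G by (simp add: field_simps)
  qed
  show ?thesis unfolding l by (rule combine[OF lin th c1 c3 zz TV(1,2) dle])
qed

text \<open>Integration by parts rewrites the pairing as minus the integral of the form in
  \<open>multiplier_coercive\<close>. \<open>A1\<close> moves a derivative off the Laplacian in the
  f-part, \<open>A2\<close> evaluates the second-order remainder as - div f |grad v|^2 / 2 using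
  symmetry of second derivatives, and \<open>A3\<close> treats the q-part. \<open>A4\<close> gives
  the mass term - div f / 2. In the sum, div f cancels against the half divergence contained in
  \<open>q\<close>, and only \<open>w\<close> is left.\<close>

lemma multiplier_identity:
  fixes k :: real and a :: l2 and n :: nat
  assumes k: "k \<ge> 100"
  defines "v \<equiv> conv (moll n) (rep a)"
  shows "tri (\<lambda>_. 1) (\<lambda>x. (\<Sum>i\<in>UNIV. partial i (partial i v) x) - v x) (\<lambda>x. (\<Sum>j\<in>UNIV. fv k j x * partial j v x) + qv k x * v x)
    \<le> - (1 / (8 * k)) * ((norm (mk v))\<^sup>2 + (\<Sum>i\<in>UNIV. (norm (mk (partial i v)))\<^sup>2))"
proof -
  have k0: "k > 0" and k1: "k \<ge> 1" using k by auto
  note w = bdd_weights[OF k1] and cw = continuous_weights[OF k0]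
  have t: "moll n \<in> test_functions" by (rule moll_test)
  have v: "good v" unfolding v_def by (intro good_conv t rep_L2)
  have dv: "good (partial i v)" for i
    unfolding v_def by (simp add: partial_conv t good_conv test_partial)
  have comm: "partial i (partial j v) = partial j (partial i v)" for i j
    unfolding v_def by (rule partial_commute_conv) simp
  note L = good_L2[OF v] good_L2[OF dv]
  have A1: "tri (dfv k i j) (partial i v) (partial j v) + tri (fv k j) (partial i (partial i v)) (partial j v)
      + tri (fv k j) (partial i v) (partial i (partial j v)) = 0" for i j
    by (rule tri_by_parts[OF dir_deriv_fv[OF k0] cw(1,2) w(1,2) dv dv])
  have A2: "tri (dfv k j j) (partial i v) (partial i v) + 2 * tri (fv k j) (partial i v) (partial i (partial j v)) = 0" for i j
    using tri_by_parts[OF dir_deriv_fv[OF k0, of j j] cw(1,2) w(1,2) dv[of i] dv[of i]]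
    by (simp add: comm[of j i] tri_commute[of _ "partial i (partial j v)"])
  have A3: "tri (dqv k i) (partial i v) v + tri (qv k) (partial i (partial i v)) v + tri (qv k) (partial i v) (partial i v) = 0" for i
    by (rule tri_by_parts[OF dir_deriv_qv[OF k0] cw(4,5) w(4,5) dv v])
  have A4: "tri (dfv k j j) v v + 2 * tri (fv k j) (partial j v) v = 0" for j
    using tri_by_parts[OF dir_deriv_fv[OF k0, of j j] cw(1,2) w(1,2) v v]
    by (simp add: tri_commute[of _ v "partial j v"])
  have int: "integrable lebesgue (\<lambda>x. m x * f x * g x)" if "bdd_measurable m" "f \<in> L2" "g \<in> L2" for m f g
    by (rule tri_integrable[OF that])
  define S where "S = (\<Sum>i\<in>UNIV. \<Sum>j\<in>UNIV. tri (fv k j) (partial i (partial i v)) (partial j v))"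
  have lhs: "tri (\<lambda>_. 1) (\<lambda>x. (\<Sum>i\<in>UNIV. partial i (partial i v) x) - v x) (\<lambda>x. (\<Sum>j\<in>UNIV. fv k j x * partial j v x) + qv k x * v x)
     = S + (\<Sum>i\<in>UNIV. tri (qv k) (partial i (partial i v)) v) - (\<Sum>j\<in>UNIV. tri (fv k j) (partial j v) v) - tri (qv k) v v"
  proof -
    have "(\<lambda>x. 1 * ((\<Sum>i\<in>UNIV. partial i (partial i v) x) - v x) * ((\<Sum>j\<in>UNIV. fv k j x * partial j v x) + qv k x * v x)) =
      (\<lambda>x. (\<Sum>i\<in>UNIV. \<Sum>j\<in>UNIV. fv k j x * partial i (partial i v) x * partial j v x) + (\<Sum>i\<in>UNIV. qv k x * partial i (partial i v) x * v x)
         - (\<Sum>j\<in>UNIV. fv k j x * partial j v x * v x) - qv k x * v x * v x)"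
    proof (rule ext)
      fix x
      let ?d = "\<Sum>i\<in>UNIV. partial i (partial i v) x" and ?f = "\<Sum>j\<in>UNIV. fv k j x * partial j v x"
      have "?d * ?f = (\<Sum>i\<in>UNIV. \<Sum>j\<in>UNIV. fv k j x * partial i (partial i v) x * partial j v x)"
        by (simp add: sum_product mult_ac)
      moreover have "?d * (qv k x * v x) = (\<Sum>i\<in>UNIV. qv k x * partial i (partial i v) x * v x)"
        by (simp add: sum_distrib_left mult_ac)
      moreover have "v x * ?f = (\<Sum>j\<in>UNIV. fv k j x * partial j v x * v x)"
        by (simp add: sum_distrib_left mult_ac)
      moreover have "1 * (?d - v x) * (?f + qv k x * v x) = ?d * ?f + ?d * (qv k x * v x) - v x * ?f - qv k x * v x * v x"
        by (simp add: algebra_simps)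
      ultimately show "1 * (?d - v x) * (?f + qv k x * v x) =
        (\<Sum>i\<in>UNIV. \<Sum>j\<in>UNIV. fv k j x * partial i (partial i v) x * partial j v x) + (\<Sum>i\<in>UNIV. qv k x * partial i (partial i v) x * v x)
         - (\<Sum>j\<in>UNIV. fv k j x * partial j v x * v x) - qv k x * v x * v x" by simp
    qed
    then show ?thesis
      unfolding tri_def S_def
      by (simp add: Bochner_Integration.integral_diff Bochner_Integration.integral_add Bochner_Integration.integral_sum
          Bochner_Integration.integrable_diff Bochner_Integration.integrable_add Bochner_Integration.integrable_sum int w L)
  qed
  \<comment> \<open>The bracket multiplied by \<open>1 / (4 * k)\<close> is the left side of
    \<open>A4\<close> summed over the axes. Its integral is zero, so it is added to the integrand at
    no cost.\<close>
  let ?I = "\<lambda>x. (\<Sum>i\<in>UNIV. \<Sum>j\<in>UNIV. dfv k i j x * partial i v x * partial j v x) + (\<Sum>i\<in>UNIV. wv k x * partial i v x * partial i v x)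
    + (\<Sum>i\<in>UNIV. dqv k i x * partial i v x * v x) + wv k x * v x * v x
    + 1 / (4 * k) * ((\<Sum>i\<in>UNIV. dfv k i i x * v x * v x) + 2 * (\<Sum>i\<in>UNIV. fv k i x * partial i v x * v x))"
  note divf = sum_dfv_diag[OF k0]
  note qw = qv_eq[OF k0]
  have qtri: "tri (qv k) f g = tri (wv k) f g + (\<Sum>j\<in>UNIV. tri (dfv k j j) f g) / 2" if "f \<in> L2" "g \<in> L2" for f g
  proof -
    have "(\<lambda>x. qv k x * f x * g x) = (\<lambda>x. wv k x * f x * g x + (\<Sum>j\<in>UNIV. dfv k j j x * f x * g x) / 2)"
      by (rule ext) (simp add: qw distrib_right sum_distrib_right)
    then show ?thesis
      unfolding tri_def using that by (simp add: int w)
  qed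
  have I: "(\<integral>x. ?I x \<partial>lebesgue) = (\<Sum>i\<in>UNIV. \<Sum>j\<in>UNIV. tri (dfv k i j) (partial i v) (partial j v)) + (\<Sum>i\<in>UNIV. tri (wv k) (partial i v) (partial i v))
     + (\<Sum>i\<in>UNIV. tri (dqv k i) (partial i v) v) + tri (wv k) v v
     + 1 / (4 * k) * ((\<Sum>i\<in>UNIV. tri (dfv k i i) v v) + 2 * (\<Sum>i\<in>UNIV. tri (fv k i) (partial i v) v))"
    unfolding tri_def
    by (simp add: Bochner_Integration.integral_add Bochner_Integration.integral_sum
          Bochner_Integration.integrable_add Bochner_Integration.integrable_sum int w L)
  have "(\<integral>x. ?I x \<partial>lebesgue) = - (S + (\<Sum>i\<in>UNIV. tri (qv k) (partial i (partial i v)) v) - (\<Sum>j\<in>UNIV. tri (fv k j) (partial j v) v) - tri (qv k) v v)"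
  proof -
    \<comment> \<open>Second derivatives beyond the Laplacian occur only in \<open>X\<close>, which
      is eliminated between \<open>s1\<close> and \<open>s2\<close>.\<close>
    define X where "X = (\<Sum>i\<in>UNIV. \<Sum>j\<in>UNIV. tri (fv k j) (partial i v) (partial i (partial j v)))"
    have "(\<Sum>i\<in>UNIV. \<Sum>j\<in>UNIV. tri (dfv k i j) (partial i v) (partial j v) + tri (fv k j) (partial i (partial i v)) (partial j v)
      + tri (fv k j) (partial i v) (partial i (partial j v))) = 0"
      by (simp only: A1 sum.neutral_const)
    then have s1: "(\<Sum>i\<in>UNIV. \<Sum>j\<in>UNIV. tri (dfv k i j) (partial i v) (partial j v)) + S + X = 0"
      by (simp add: sum.distrib S_def X_def)
    have "(\<Sum>i\<in>UNIV. \<Sum>j\<in>UNIV. tri (dfv k j j) (partial i v) (partial i v) + 2 * tri (fv k j) (partial i v) (partial i (partial j v))) = 0"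
      by (simp only: A2 sum.neutral_const)
    then have s2: "(\<Sum>i\<in>UNIV. \<Sum>j\<in>UNIV. tri (dfv k j j) (partial i v) (partial i v)) + 2 * X = 0"
      by (simp add: sum.distrib X_def sum_distrib_left)
    have "(\<Sum>i\<in>UNIV. tri (dqv k i) (partial i v) v + tri (qv k) (partial i (partial i v)) v + tri (qv k) (partial i v) (partial i v)) = 0"
      by (simp only: A3 sum.neutral_const)
    then have s3: "(\<Sum>i\<in>UNIV. tri (dqv k i) (partial i v) v) + (\<Sum>i\<in>UNIV. tri (qv k) (partial i (partial i v)) v) + (\<Sum>i\<in>UNIV. tri (qv k) (partial i v) (partial i v)) = 0"
      by (simp add: sum.distrib)
    have "(\<Sum>j\<in>UNIV. tri (dfv k j j) v v + 2 * tri (fv k j) (partial j v) v) = 0"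
      by (simp only: A4 sum.neutral_const)
    then have s4: "(\<Sum>j\<in>UNIV. tri (dfv k j j) v v) + 2 * (\<Sum>j\<in>UNIV. tri (fv k j) (partial j v) v) = 0"
      by (simp add: sum.distrib sum_distrib_left)
    have s5: "(\<Sum>i\<in>UNIV. tri (qv k) (partial i v) (partial i v)) = (\<Sum>i\<in>UNIV. tri (wv k) (partial i v) (partial i v))
       + (\<Sum>i\<in>UNIV. \<Sum>j\<in>UNIV. tri (dfv k j j) (partial i v) (partial i v)) / 2"
      by (simp add: qtri L sum.distrib sum_divide_distrib)
    have s6: "tri (qv k) v v = tri (wv k) v v + (\<Sum>j\<in>UNIV. tri (dfv k j j) v v) / 2"
      by (simp add: qtri L)
    show ?thesis unfolding I s4 using s1 s2 s3 s4 s5 s6 by linarith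
  qed
  moreover have "(\<integral>x. 1 / (8 * k) * ((\<Sum>i\<in>UNIV. (partial i v x)\<^sup>2) + (v x)\<^sup>2) \<partial>lebesgue) \<le> (\<integral>x. ?I x \<partial>lebesgue)"
  proof (rule integral_mono)
    show "integrable lebesgue (\<lambda>x. 1 / (8 * k) * ((\<Sum>i\<in>UNIV. (partial i v x)\<^sup>2) + (v x)\<^sup>2))"
      by (intro integrable_mult_right Bochner_Integration.integrable_add Bochner_Integration.integrable_sum L2_integrable_sq L)
    show "integrable lebesgue ?I"
      by (intro integrable_mult_right Bochner_Integration.integrable_add Bochner_Integration.integrable_sum int w L)
    fix x
    define p where "p = (\<lambda>i. partial i v x)"
    define G where "G = (\<Sum>i\<in>UNIV. (p i)\<^sup>2)"
    define z where "z = (\<Sum>i\<in>UNIV. dirv k i x * p i)"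
    have z2: "z\<^sup>2 \<le> th k x * (1 - th k x) * G"
      using Cauchy_Schwarz_ineq_sum[of "\<lambda>i. dirv k i x" p UNIV] by (simp add: z_def G_def sum_dirv_sq[OF k0])
    have e1: "(\<Sum>i\<in>UNIV. \<Sum>j\<in>UNIV. dfv k i j x * p i * p j) = th k x * G - 2 * z\<^sup>2"
    proof -
      have "dfv k i j x * p i * p j = (if i = j then th k x * p i * p j else 0) - 2 * ((dirv k i x * p i) * (dirv k j x * p j))" for i j
        by (simp add: dfv_def algebra_simps)
      then have "(\<Sum>i\<in>UNIV. \<Sum>j\<in>UNIV. dfv k i j x * p i * p j) = (\<Sum>i\<in>UNIV. th k x * p i * p i) - 2 * (\<Sum>i\<in>UNIV. \<Sum>j\<in>UNIV. (dirv k i x * p i) * (dirv k j x * p j))"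
        by (simp add: sum_subtractf sum_distrib_left)
      also have "(\<Sum>i\<in>UNIV. \<Sum>j\<in>UNIV. (dirv k i x * p i) * (dirv k j x * p j)) = z\<^sup>2"
        by (simp add: z_def power2_eq_square sum_product)
      finally show ?thesis by (simp add: G_def sum_distrib_left power2_eq_square mult.assoc)
    qed
    have e2: "(\<Sum>i\<in>UNIV. wv k x * p i * p i) = wv k x * G"
      by (simp add: G_def sum_distrib_left power2_eq_square mult.assoc)
    have e3: "(\<Sum>i\<in>UNIV. dqv k i x * p i * v x) = (th k x - 4 * (th k x)\<^sup>2) * z * v x / k"
      by (simp add: dqv_def z_def sum_distrib_left sum_distrib_right sum_divide_distrib mult_ac)
    have e4: "(\<Sum>i\<in>UNIV. dfv k i i x * v x * v x) = (th k x + 2 * (th k x)\<^sup>2) * (v x)\<^sup>2"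
      unfolding divf[symmetric] by (simp add: sum_distrib_right power2_eq_square mult.assoc)
    have e5: "(\<Sum>i\<in>UNIV. fv k i x * p i * v x) = k * z * v x"
      by (simp add: fv_def z_def sum_distrib_left sum_distrib_right mult_ac)
    have "1 / (8 * k) * (G + (v x)\<^sup>2) \<le> (th k x * G - 2 * z\<^sup>2) + wv k x * G + (th k x - 4 * (th k x)\<^sup>2) * z * v x / k
      + wv k x * (v x)\<^sup>2 + 1 / (4 * k) * ((th k x + 2 * (th k x)\<^sup>2) * (v x)\<^sup>2 + 2 * (k * z * v x))"
      unfolding wv_def
      by (rule multiplier_coercive[OF k th_bounds[OF k0] _ z2]) (simp add: G_def sum_nonneg)
    then show "1 / (8 * k) * ((\<Sum>i\<in>UNIV. (partial i v x)\<^sup>2) + (v x)\<^sup>2) \<le> ?I x"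
      unfolding p_def[symmetric] using e1 e2 e3 e4 e5
      by (simp add: G_def p_def power2_eq_square mult.assoc)
  qed
  moreover have "(\<integral>x. 1 / (8 * k) * ((\<Sum>i\<in>UNIV. (partial i v x)\<^sup>2) + (v x)\<^sup>2) \<partial>lebesgue)
      = 1 / (8 * k) * ((norm (mk v))\<^sup>2 + (\<Sum>i\<in>UNIV. (norm (mk (partial i v)))\<^sup>2))"
    by (simp add: norm_mk_sq L Bochner_Integration.integral_add Bochner_Integration.integral_sum
        Bochner_Integration.integrable_sum L2_integrable_sq add.commute)
  ultimately show ?thesis unfolding lhs by linarith
qed

section \<open>Mollified derivatives and the multiplier as operators on L2\<close>

definition Q :: "nat \<Rightarrow> 3 \<Rightarrow> l2 \<Rightarrow> l2" where "Q n i = Conv (partial i (moll n))"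
definition Lap :: "nat \<Rightarrow> l2 \<Rightarrow> l2" where "Lap n a = (\<Sum>i\<in>UNIV. Conv (partial i (partial i (moll n))) a)"
text \<open>Gradient and function are separate arguments, so the same expression applies to
  mollified data and to the weak gradient of the solution in the limit.\<close>

definition Mult :: "real \<Rightarrow> (3 \<Rightarrow> l2) \<Rightarrow> l2 \<Rightarrow> l2" where
  "Mult k g a = (\<Sum>i\<in>UNIV. Mul (fv k i) (g i)) + Mul (qv k) a"

lemma mollified_mk:
  "P n a = mk (conv (moll n) (rep a))"
  "Q n i a = mk (partial i (conv (moll n) (rep a)))"
  "Conv (partial i (partial j (moll n))) a = mk (partial i (partial j (conv (moll n) (rep a))))"
  by (simp_all add: Conv_def Q_def partial_conv moll_test test_partial)

lemma mollified_good:
  "good (conv (moll n) (rep a))" "good (partial i (conv (moll n) (rep a)))"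
  by (simp_all add: partial_conv moll_test test_partial good_conv)

lemma Lap_mk: "Lap n a = mk (\<lambda>x. \<Sum>i\<in>UNIV. partial i (partial i (conv (moll n) (rep a))) x)"
  unfolding Lap_def mollified_mk by (rule mk_sum[symmetric]) (rule good_L2(2)[OF mollified_good(2)])

lemma Lap_inner: "Lap n a \<bullet> P n b = - (\<Sum>i\<in>UNIV. Q n i a \<bullet> Q n i b)"
proof -
  let ?v = "conv (moll n) (rep a)" and ?w = "conv (moll n) (rep b)"
  have one: "bdd_measurable (\<lambda>_. 1)" "bdd_measurable (\<lambda>_. 0)" by (auto intro!: bdd_measurableI[of _ 1])
  have d: "dir_deriv i (\<lambda>_. 1) (\<lambda>_. 0)" for i by (simp add: dir_deriv_def)
  have "tri (\<lambda>_. 1) (partial i (partial i ?v)) ?w + tri (\<lambda>_. 1) (partial i ?v) (partial i ?w) = 0" for i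
    using tri_by_parts[OF d continuous_on_const continuous_on_const one
      mollified_good(2)[where i=i and n=n and a=a] mollified_good(1)[where n=n and a=b], of i] by (simp add: tri_def)
  then have A: "tri (\<lambda>_. 1) (partial i (partial i ?v)) ?w = - tri (\<lambda>_. 1) (partial i ?v) (partial i ?w)" for i
    by (simp add: eq_neg_iff_add_eq_0)
  have "Conv (partial i (partial i (moll n))) a \<bullet> P n b = - (Q n i a \<bullet> Q n i b)" for i
    unfolding mollified_mk using A[of i] by (simp add: inner_mk good_L2 mollified_good tri_def)
  then show ?thesis by (simp add: Lap_def inner_sum_left sum_negf)
qed

lemma Mult_mk:
  assumes "k \<ge> 1"
  shows "Mult k (\<lambda>i. Q n i a) (P n a) = mk (\<lambda>x. (\<Sum>j\<in>UNIV. fv k j x * partial j (conv (moll n) (rep a)) x) + qv k x * conv (moll n) (rep a) x)"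
proof -
  note L = good_L2(1)[OF mollified_good(1)] good_L2(2)[OF mollified_good(1)]
  show ?thesis
    unfolding Mult_def mollified_mk
    by (simp add: Mul_mk bdd_weights[OF assms] L mk_add mk_sum L2_sum L2_bdd_mult)
qed

text \<open>Integration by parts of the f-part yields - div f / 2, which the divergence part of
  \<open>q\<close> compensates. This computes the kinetic term in the derivative of the multiplier
  functional.\<close>

lemma Mult_inner_self:
  assumes "k \<ge> 1"
  shows "P n a \<bullet> Mult k (\<lambda>i. Q n i a) (P n a) = Mul (wv k) (P n a) \<bullet> P n a"
proof -
  let ?v = "conv (moll n) (rep a)"
  have k0: "k > 0" using assms by simp
  note w = bdd_weights[OF assms] and cw = continuous_weights[OF k0]
  note L = good_L2(1)[OF mollified_good(1)] good_L2(2)[OF mollified_good(1)]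
  have A: "tri (dfv k j j) ?v ?v + 2 * tri (fv k j) (partial j ?v) ?v = 0" for j
    using tri_by_parts[OF dir_deriv_fv[OF k0, of j j] cw(1,2) w(1,2) mollified_good(1)[of n a] mollified_good(1)[of n a]]
    by (simp add: tri_commute[of _ ?v "partial j ?v"])
  have "(\<lambda>x. qv k x * ?v x * ?v x) = (\<lambda>x. wv k x * ?v x * ?v x + (\<Sum>j\<in>UNIV. dfv k j j x * ?v x * ?v x) / 2)"
    by (rule ext) (simp add: qv_eq[OF k0] distrib_right sum_distrib_right)
  then have q: "tri (qv k) ?v ?v = tri (wv k) ?v ?v + (\<Sum>j\<in>UNIV. tri (dfv k j j) ?v ?v) / 2"
    unfolding tri_def by (simp add: tri_integrable w L)
  have "P n a \<bullet> Mult k (\<lambda>i. Q n i a) (P n a) = (\<Sum>j\<in>UNIV. tri (fv k j) (partial j ?v) ?v) + tri (qv k) ?v ?v"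
    unfolding Mult_def mollified_mk inner_commute[of "mk ?v"]
    by (simp add: inner_add_left inner_sum_left Mul_inner_mk w L)
  moreover have "(\<Sum>j\<in>UNIV. tri (dfv k j j) ?v ?v + 2 * tri (fv k j) (partial j ?v) ?v) = 0"
    by (simp only: A sum.neutral_const)
  then have "(\<Sum>j\<in>UNIV. tri (dfv k j j) ?v ?v) + 2 * (\<Sum>j\<in>UNIV. tri (fv k j) (partial j ?v) ?v) = 0"
    by (simp add: sum.distrib sum_distrib_left)
  ultimately show ?thesis
    unfolding mollified_mk by (simp add: Mul_inner_mk w L q)
qed

lemma Mult_coercive:
  assumes "k \<ge> 100"
  shows "(Lap n a - P n a) \<bullet> Mult k (\<lambda>i. Q n i a) (P n a) \<le> - (1 / (8 * k)) * ((norm (P n a))\<^sup>2 + (\<Sum>i\<in>UNIV. (norm (Q n i a))\<^sup>2))"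
proof -
  have k1: "k \<ge> 1" using assms by simp
  note L = good_L2(1)[OF mollified_good(1)] good_L2(2)[OF mollified_good(1)] good_L2(2)[OF mollified_good(2)]
  have "(Lap n a - P n a) \<bullet> Mult k (\<lambda>i. Q n i a) (P n a) =
    tri (\<lambda>_. 1) (\<lambda>x. (\<Sum>i\<in>UNIV. partial i (partial i (conv (moll n) (rep a))) x) - conv (moll n) (rep a) x)
      (\<lambda>x. (\<Sum>j\<in>UNIV. fv k j x * partial j (conv (moll n) (rep a)) x) + qv k x * conv (moll n) (rep a) x)"
    unfolding Mult_mk[OF k1] Lap_mk unfolding mollified_mk
    by (simp add: mk_diff[symmetric] inner_mk tri_def L2_diff L2_add L2_sum L2_bdd_mult bdd_weights[OF k1] L)
  then show ?thesis
    using multiplier_identity[OF assms, of n a] by (simp add: mollified_mk)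
qed

subsection \<open>A limiting Gronwall inequality\<close>

text \<open>The limit \<open>L\<close> is not known to be differentiable, so the inequality is
  integrated for each \<open>n\<close> with the factor exp (c t), and only then is the limit taken
  by dominated convergence. \<open>Dn\<close> is a continuous majorant of the derivative: it is
  integrable and convergent even where the derivative itself is only estimated. The sign condition
  involves the limits alone, so terms that cancel only as n tends to infinity are admissible. The
  rate \<open>c = 0\<close> gives monotonicity.\<close>

lemma gronwall_limit:
  fixes Ln Dn :: "nat \<Rightarrow> real \<Rightarrow> real" and L D \<beta> :: "real \<Rightarrow> real"
  assumes deriv: "\<And>n t. t \<ge> 0 \<Longrightarrow> \<exists>d. (Ln n has_real_derivative d) (at t within {0..}) \<and> d \<le> Dn n t"
    and contD: "\<And>n. continuous_on {0..} (Dn n)" and cont\<beta>: "continuous_on {0..} \<beta>"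
    and bound: "\<And>n t. t \<ge> 0 \<Longrightarrow> \<bar>Dn n t\<bar> \<le> \<beta> t" "\<And>n t. t \<ge> 0 \<Longrightarrow> \<bar>Ln n t\<bar> \<le> \<beta> t"
    and limL: "\<And>t. t \<ge> 0 \<Longrightarrow> (\<lambda>n. Ln n t) \<longlonglongrightarrow> L t" and limD: "\<And>t. t \<ge> 0 \<Longrightarrow> (\<lambda>n. Dn n t) \<longlonglongrightarrow> D t"
    and le: "\<And>t. t \<ge> 0 \<Longrightarrow> D t + c * L t \<le> 0"
    and T: "T \<ge> 0"
  shows "L T \<le> L 0 * exp (- c * T)"
proof -
  have "\<forall>n t. \<exists>d. t \<ge> 0 \<longrightarrow> (Ln n has_real_derivative d) (at t within {0..}) \<and> d \<le> Dn n t"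
    using deriv by blast
  then obtain d where "\<forall>n t. t \<ge> 0 \<longrightarrow> (Ln n has_real_derivative d n t) (at t within {0..}) \<and> d n t \<le> Dn n t"
    by metis
  then have d: "\<And>n t. t \<ge> 0 \<Longrightarrow> (Ln n has_real_derivative d n t) (at t within {0..})" "\<And>n t. t \<ge> 0 \<Longrightarrow> d n t \<le> Dn n t"
    by auto
  have contL: "continuous_on {0..} (Ln n)" for n
    using d(1) by (intro DERIV_continuous_on[where D="d n"]) auto
  define f where "f n t = exp (c * t) * (Dn n t + c * Ln n t)" for n t
  define f' where "f' t = exp (c * t) * (D t + c * L t)" for t
  define h where "h t = exp (c * t) * (\<beta> t + \<bar>c\<bar> * \<beta> t)" for t
  have sub: "{0..T} \<subseteq> {0..}" by auto
  have intf: "f n integrable_on {0..T}" for n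
    unfolding f_def
    by (intro integrable_continuous_real continuous_intros continuous_on_subset[OF contL sub] continuous_on_subset[OF contD sub])
  have inth: "h integrable_on {0..T}"
    unfolding h_def by (intro integrable_continuous_real continuous_intros continuous_on_subset[OF cont\<beta> sub])
  have step: "exp (c * T) * Ln n T - Ln n 0 \<le> integral {0..T} (f n)" for n
  proof -
    have "((\<lambda>t. exp (c * t) * (d n t + c * Ln n t)) has_integral (exp (c * T) * Ln n T - exp (c * 0) * Ln n 0)) {0..T}"
    proof (rule fundamental_theorem_of_calculus[OF T])
      fix t assume t: "t \<in> {0..T}"
      have "(Ln n has_real_derivative d n t) (at t within {0..T})"
        by (rule has_field_derivative_subset[OF d(1) sub]) (use t in auto)
      then have "((\<lambda>t. exp (c * t) * Ln n t) has_real_derivative (exp (c * t) * (d n t + c * Ln n t))) (at t within {0..T})"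
        by (auto intro!: derivative_eq_intros simp: algebra_simps)
      then show "((\<lambda>t. exp (c * t) * Ln n t) has_vector_derivative (exp (c * t) * (d n t + c * Ln n t))) (at t within {0..T})"
        by (simp add: has_real_derivative_iff_has_vector_derivative)
    qed
    then have "exp (c * T) * Ln n T - exp (c * 0) * Ln n 0 \<le> integral {0..T} (f n)"
    proof (rule has_integral_le[OF _ integrable_integral[OF intf]])
      fix t assume "t \<in> {0..T}"
      then show "exp (c * t) * (d n t + c * Ln n t) \<le> f n t"
        using d(2) by (simp add: f_def)
    qed
    then show ?thesis by simp
  qed
  have bnd: "norm (f n t) \<le> h t" if "t \<in> {0..T}" for n t
  proof -
    have "\<bar>Dn n t + c * Ln n t\<bar> \<le> \<bar>Dn n t\<bar> + \<bar>c\<bar> * \<bar>Ln n t\<bar>"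
      using abs_triangle_ineq[of "Dn n t" "c * Ln n t"] by (simp add: abs_mult)
    also have "\<dots> \<le> \<beta> t + \<bar>c\<bar> * \<beta> t"
      using that bound by (intro add_mono mult_left_mono) auto
    finally show ?thesis by (simp add: f_def h_def abs_mult)
  qed
  have lim: "(\<lambda>n. f n t) \<longlonglongrightarrow> f' t" if "t \<in> {0..T}" for t
    unfolding f_def f'_def using that by (intro tendsto_intros limL limD) auto
  have conv: "f' integrable_on {0..T}" "(\<lambda>n. integral {0..T} (f n)) \<longlonglongrightarrow> integral {0..T} f'"
    using dominated_convergence[OF intf inth bnd lim] by auto
  have "integral {0..T} f' \<le> integral {0..T} (\<lambda>_. 0)"
    using conv(1) le by (intro integral_le) (auto simp: f'_def mult_nonneg_nonpos)
  moreover have "exp (c * T) * L T - L 0 \<le> integral {0..T} f'"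
  proof (rule LIMSEQ_le[OF _ conv(2)])
    show "(\<lambda>n. exp (c * T) * Ln n T - Ln n 0) \<longlonglongrightarrow> exp (c * T) * L T - L 0"
      by (intro tendsto_intros limL) (use T in auto)
  qed (use step in blast)
  ultimately have "exp (c * T) * L T \<le> L 0" by simp
  then have "exp (- c * T) * (exp (c * T) * L T) \<le> exp (- c * T) * L 0"
    by (rule mult_left_mono) simp
  moreover have "exp (- c * T) * exp (c * T) = 1" by (simp flip: exp_add)
  ultimately show ?thesis by (simp only: mult.assoc[symmetric] mult_1_left mult.commute[of _ "L 0"])
qed

subsection \<open>Operator bounds\<close>

lemma Mult_bound:
  assumes "k \<ge> 1"
  obtains M where "M \<ge> 1" "\<And>g a. norm (Mult k g a) \<le> M * sqrt ((norm a)\<^sup>2 + (\<Sum>i\<in>UNIV. (norm (g i))\<^sup>2))"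
proof -
  have "\<exists>C\<ge>0. \<forall>a. norm (Mul (fv k i) a) \<le> norm a * C" for i
    using bounded_linear.nonneg_bounded[OF bounded_linear_Mul[OF bdd_weights(1)[OF assms]]] by blast
  then obtain C where C: "\<And>i. C i \<ge> 0" "\<And>i a. norm (Mul (fv k i) a) \<le> norm a * C i" by metis
  obtain C0 where C0: "C0 \<ge> 0" "\<And>a. norm (Mul (qv k) a) \<le> norm a * C0"
    using bounded_linear.nonneg_bounded[OF bounded_linear_Mul[OF bdd_weights(4)[OF assms]]] by blast
  define M where "M = 1 + C0 + (\<Sum>i\<in>UNIV. C i)"
  have "norm (Mult k g a) \<le> M * sqrt ((norm a)\<^sup>2 + (\<Sum>i\<in>UNIV. (norm (g i))\<^sup>2))" for g a
  proof -
    let ?s = "sqrt ((norm a)\<^sup>2 + (\<Sum>i\<in>UNIV. (norm (g i))\<^sup>2))"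
    have a: "norm a \<le> ?s" by (rule real_le_rsqrt) (simp add: sum_nonneg)
    have g: "norm (g i) \<le> ?s" for i
    proof (rule real_le_rsqrt)
      have "(norm (g i))\<^sup>2 \<le> (\<Sum>i\<in>UNIV. (norm (g i))\<^sup>2)" by (rule member_le_sum) auto
      then show "(norm (g i))\<^sup>2 \<le> (norm a)\<^sup>2 + (\<Sum>i\<in>UNIV. (norm (g i))\<^sup>2)" by (simp add: add_increasing)
    qed
    have "norm (Mult k g a) \<le> (\<Sum>i\<in>UNIV. norm (Mul (fv k i) (g i))) + norm (Mul (qv k) a)"
      unfolding Mult_def by (intro order_trans[OF norm_triangle_ineq] add_mono norm_sum order_refl)
    also have "\<dots> \<le> (\<Sum>i\<in>UNIV. ?s * C i) + ?s * C0"
      by (intro add_mono sum_mono order_trans[OF C(2)] order_trans[OF C0(2)] mult_right_mono a g C(1) C0(1))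
    also have "\<dots> = ?s * ((\<Sum>i\<in>UNIV. C i) + C0)" by (simp add: sum_distrib_left distrib_left)
    also have "\<dots> \<le> ?s * M" unfolding M_def by (intro mult_left_mono) (auto simp: sum_nonneg)
    finally show ?thesis by (simp add: mult.commute)
  qed
  moreover have "M \<ge> 1" using C0(1) C(1) by (simp add: M_def sum_nonneg)
  ultimately show ?thesis using that by blast
qed

lemma Mul_inner_rep: "bdd_measurable m \<Longrightarrow> Mul m a \<bullet> a = (\<integral>x. m x * (rep a x)\<^sup>2 \<partial>lebesgue)"
  using Mul_inner_mk[of m "rep a" "rep a"] by (simp add: tri_def power2_eq_square mult.assoc)

lemma Mul_sq_integrable: "bdd_measurable m \<Longrightarrow> integrable lebesgue (\<lambda>x. m x * (rep a x)\<^sup>2)"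
  using tri_integrable[of m "rep a" "rep a"] by (simp add: power2_eq_square mult.assoc)

lemma bounded_linear_P: "bounded_linear (P n)"
  by (rule bounded_linear_Conv[OF moll_test])

lemma bounded_linear_Q: "bounded_linear (Q n i)"
  unfolding Q_def by (rule bounded_linear_Conv[OF test_partial[OF moll_test]])

lemma bounded_linear_Lap: "bounded_linear (Lap n)"
  unfolding Lap_def[abs_def] by (intro bounded_linear_sum bounded_linear_Conv test_partial moll_test)

lemma bounded_linear_Mult:
  assumes "k \<ge> 1"
  shows "bounded_linear (\<lambda>a. Mult k (\<lambda>i. Q n i a) (P n a))"
  unfolding Mult_def[abs_def]
  by (intro bounded_linear_add bounded_linear_sum
      bounded_linear_compose[OF bounded_linear_Mul bounded_linear_Q] bounded_linear_compose[OF bounded_linear_Mul bounded_linear_P]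
      bdd_weights assms)

lemma continuous_on_Mult:
  assumes "k \<ge> 1" "\<And>i. continuous_on S (g i)" "continuous_on S a"
  shows "continuous_on S (\<lambda>t. Mult k (\<lambda>i. g i t) (a t))"
  unfolding Mult_def
  by (intro continuous_intros bounded_linear.continuous_on[OF bounded_linear_Mul] bdd_weights assms)

lemma tendsto_Mult:
  assumes "k \<ge> 1" "\<And>i. ((\<lambda>n. g n i) \<longlongrightarrow> g' i) F" "(a \<longlongrightarrow> a') F"
  shows "((\<lambda>n. Mult k (g n) (a n)) \<longlongrightarrow> Mult k g' a') F"
  unfolding Mult_def
  by (intro tendsto_intros bounded_linear.tendsto[OF bounded_linear_Mul] bdd_weights assms)

lemma partial_uminus: "f differentiable (at x) \<Longrightarrow> partial i (\<lambda>y. - f y) x = - partial i f x"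
  by (subst partial_eqI[OF has_derivative_minus[OF has_derivative_partial]]) (simp_all only: sum_axis)

text \<open>Each derivative switches parity, so the second derivatives of the even mollifier are
  even again, which is the symmetry that \<open>Conv_adjoint\<close> asks of a kernel.\<close>

lemma moll_second_even: "partial i (partial i (moll n)) (- x) = partial i (partial i (moll n)) x"
proof -
  let ?k = "moll n"
  have odd: "partial i ?k (- y) = - partial i ?k y" for y
  proof -
    have "partial i (\<lambda>y. ?k (0 - y)) y = - partial i ?k (0 - y)" by (rule test_reflect(2)[OF moll_test])
    then show ?thesis by (simp add: moll_even)
  qed
  have "- partial i (partial i ?k) (- x) = partial i (\<lambda>y. partial i ?k (0 - y)) x"
    by (subst test_reflect(2)[OF test_partial[OF moll_test]]) simp
  also have "(\<lambda>y. partial i ?k (0 - y)) = (\<lambda>y. - partial i ?k y)" by (simp add: odd)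
  also have "partial i \<dots> x = - partial i (partial i ?k) x"
    by (rule partial_uminus[OF smooth_differentiable[OF test_smooth[OF test_partial[OF moll_test]]]])
  finally show ?thesis by simp
qed

lemma Lap_adjoint: "Lap n a \<bullet> b = a \<bullet> Lap n b"
  unfolding Lap_def inner_sum_left inner_sum_right
  by (intro sum.cong refl Conv_adjoint test_partial moll_test moll_second_even)

subsection \<open>Solutions as curves in the Hilbert space\<close>

locale damped_wave =
  fixes \<alpha> :: "R3 \<Rightarrow> real" and u0 u1 :: "R3 \<Rightarrow> real" and u ut :: "real \<Rightarrow> R3 \<Rightarrow> real"
  assumes sol: "global_solution \<alpha> u0 u1 u ut" and alpha: "bdd_measurable \<alpha>"
begin

definition U :: "real \<Rightarrow> l2" where "U t = mk (u t)"
definition V :: "real \<Rightarrow> l2" where "V t = mk (ut t)"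
definition Dg :: "3 \<Rightarrow> real \<Rightarrow> l2" where "Dg i t = grad i (u t)"
definition N :: "real \<Rightarrow> l2" where "N t = mk (\<lambda>x. (u t x) ^ 3)"
text \<open>The cube and the damping are treated together as an L2-valued forcing of the linear
  Klein-Gordon equation; the Sobolev inequality puts the cube into L2 for times t \<ge> 0.\<close>

definition F :: "real \<Rightarrow> l2" where "F t = N t - Mul \<alpha> (V t)"
definition H :: "real \<Rightarrow> real" where "H t = (norm (U t))\<^sup>2 + (\<Sum>i\<in>UNIV. (norm (Dg i t))\<^sup>2)"
definition \<Gamma> :: "real \<Rightarrow> real" where "\<Gamma> t = (U t \<bullet> N t) / 4"

lemma uH1: "t \<ge> 0 \<Longrightarrow> u t \<in> H1" and utL2: "t \<ge> 0 \<Longrightarrow> ut t \<in> L2"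
  using sol by (auto simp: global_solution_def)

lemma uL2: "t \<ge> 0 \<Longrightarrow> u t \<in> L2"
  by (rule H1_L2[OF uH1])

lemma at_within_nonneg: "\<forall>\<^sub>F s in at t within {0..}. s \<ge> (0::real)"
  by (simp add: eventually_at_filter)

lemma continuous_U: "continuous_on {0..} U" and continuous_Dg: "continuous_on {0..} (Dg i)"
proof -
  have *: "(U \<longlongrightarrow> U t) (at t within {0..}) \<and> (Dg i \<longlongrightarrow> Dg i t) (at t within {0..})" if t: "t \<ge> 0" for t
  proof -
    have lim: "((\<lambda>s. H1_norm (\<lambda>x. u s x - u t x)) \<longlongrightarrow> 0) (at t within {0..})"
      using sol t by (simp add: global_solution_def)
    have "norm (U s - U t) \<le> H1_norm (\<lambda>x. u s x - u t x) \<and> norm (Dg i s - Dg i t) \<le> H1_norm (\<lambda>x. u s x - u t x)" if s: "s \<ge> 0" for s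
    proof -
      let ?n = "H1_norm (\<lambda>x. u s x - u t x)"
      have n: "?n\<^sup>2 = (\<Sum>i\<in>UNIV. (norm (Dg i s - Dg i t))\<^sup>2) + (norm (U s - U t))\<^sup>2" "?n \<ge> 0"
        using H1_norm_sq[OF H1_diff[OF uH1[OF s] uH1[OF t]]] grad_diff[OF uH1[OF s] uH1[OF t]] mk_diff[OF uL2[OF s] uL2[OF t]]
        by (auto simp: U_def Dg_def H1_norm_def sum_nonneg)
      have "(norm (Dg i s - Dg i t))\<^sup>2 \<le> (\<Sum>i\<in>UNIV. (norm (Dg i s - Dg i t))\<^sup>2)" by (rule member_le_sum) auto
      then have "(norm (U s - U t))\<^sup>2 \<le> ?n\<^sup>2" "(norm (Dg i s - Dg i t))\<^sup>2 \<le> ?n\<^sup>2"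
        unfolding n(1) by (auto simp: sum_nonneg add_increasing2)
      then show ?thesis using n(2) power2_le_imp_le by blast
    qed
    then have ev: "\<forall>\<^sub>F s in at t within {0..}. norm (U s - U t) \<le> H1_norm (\<lambda>x. u s x - u t x)"
      "\<forall>\<^sub>F s in at t within {0..}. norm (Dg i s - Dg i t) \<le> H1_norm (\<lambda>x. u s x - u t x)"
      using at_within_nonneg[of t] by (auto elim: eventually_mono)
    show ?thesis
      using Lim_null_comparison[OF ev(1) lim] Lim_null_comparison[OF ev(2) lim] by (simp add: LIM_zero_iff)
  qed
  then show "continuous_on {0..} U" "continuous_on {0..} (Dg i)"
    by (auto simp: continuous_on_def)
qed

lemma continuous_V: "continuous_on {0..} V"
  unfolding continuous_on_def
proof
  fix t :: real assume "t \<in> {0..}"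
  then have t: "t \<ge> 0" by simp
  have lim: "((\<lambda>s. L2_norm (\<lambda>x. ut s x - ut t x)) \<longlongrightarrow> 0) (at t within {0..})"
    using sol t by (simp add: global_solution_def)
  have "\<forall>\<^sub>F s in at t within {0..}. norm (V s - V t) \<le> L2_norm (\<lambda>x. ut s x - ut t x)"
    using at_within_nonneg[of t]
  proof eventually_elim
    case (elim s)
    then show ?case
      using norm_mk[OF L2_diff[OF utL2[OF elim] utL2[OF t]]] mk_diff[OF utL2[OF elim] utL2[OF t]] by (simp add: V_def)
  qed
  from Lim_null_comparison[OF this lim] show "(V \<longlongrightarrow> V t) (at t within {0..})" by (simp add: LIM_zero_iff)
qed

lemma U_derivative:
  assumes t: "t \<ge> 0"
  shows "(U has_vector_derivative V t) (at t within {0..})"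
  unfolding has_vector_derivative_def has_derivative_iff_norm
proof (intro conjI bounded_linear_scaleR_left)
  have lim: "((\<lambda>s. L2_norm (\<lambda>x. (u s x - u t x) / (s - t) - ut t x)) \<longlongrightarrow> 0) (at t within {0..})"
    using sol t by (simp add: global_solution_def)
  have "\<forall>\<^sub>F s in at t within {0..}. L2_norm (\<lambda>x. (u s x - u t x) / (s - t) - ut t x) = norm (U s - U t - (s - t) *\<^sub>R V t) / norm (s - t)"
    unfolding eventually_at_filter
  proof (rule always_eventually, intro allI impI)
    fix s :: real assume st: "s \<noteq> t" and "s \<in> {0..}"
    then have s: "s \<ge> 0" by simp
    let ?c = "1 / (s - t)"
    have L: "(\<lambda>x. u s x - u t x) \<in> L2" by (intro L2_diff uL2 s t)
    have "(\<lambda>x. (u s x - u t x) / (s - t) - ut t x) = (\<lambda>x. ?c * (u s x - u t x) - ut t x)" by simp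
    then have "L2_norm (\<lambda>x. (u s x - u t x) / (s - t) - ut t x) = norm (mk (\<lambda>x. ?c * (u s x - u t x) - ut t x))"
      using norm_mk[OF L2_diff[OF L2_cmult[OF L] utL2[OF t]], of ?c] by simp
    also have "mk (\<lambda>x. ?c * (u s x - u t x) - ut t x) = ?c *\<^sub>R (U s - U t) - V t"
      using mk_diff[OF L2_cmult[OF L] utL2[OF t], of ?c] mk_cmult[OF L, of ?c] mk_diff[OF uL2[OF s] uL2[OF t]]
      by (simp add: U_def V_def)
    also have "\<dots> = ?c *\<^sub>R (U s - U t - (s - t) *\<^sub>R V t)"
      using st by (simp add: scaleR_diff_right)
    finally show "L2_norm (\<lambda>x. (u s x - u t x) / (s - t) - ut t x) = norm (U s - U t - (s - t) *\<^sub>R V t) / norm (s - t)"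
      by simp
  qed
  then show "((\<lambda>s. norm (U s - U t - (s - t) *\<^sub>R V t) / norm (s - t)) \<longlongrightarrow> 0) (at t within {0..})"
    using lim by (simp add: tendsto_cong)
qed

lemma norm_N_sq: "t \<ge> 0 \<Longrightarrow> (norm (N t))\<^sup>2 \<le> 4096 * (\<Sum>i\<in>UNIV. (norm (Dg i t))\<^sup>2) ^ 3"
  using H1_sixth_power(2)[OF uH1] by (simp add: N_def Dg_def norm_cube_sq uH1)

lemma continuous_N: "continuous_on {0..} N"
  unfolding continuous_on_def
proof
  fix t :: real assume "t \<in> {0..}"
  then have t: "t \<ge> 0" by simp
  \<comment> \<open>The summand \<open>\<bar>r - t\<bar>\<close> keeps \<open>s r\<close> positive
    when the gradients at the two times agree, as \<open>cube_diff_bound\<close> demands.\<close>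
  define s where "s r = (\<Sum>i\<in>UNIV. (norm (Dg i r - Dg i t))\<^sup>2) + \<bar>r - t\<bar>" for r
  define b where "b r = 72 * s r * (2 + 4096 * (\<Sum>i\<in>UNIV. (norm (Dg i r))\<^sup>2) ^ 3 + (norm (N t))\<^sup>2)" for r
  have D: "(Dg i \<longlongrightarrow> Dg i t) (at t within {0..})" for i
    using continuous_Dg t by (auto simp: continuous_on_def)
  have "(s \<longlongrightarrow> (\<Sum>i\<in>(UNIV :: 3 set). (norm (Dg i t - Dg i t))\<^sup>2) + \<bar>t - t\<bar>) (at t within {0..})"
    unfolding s_def by (intro tendsto_intros D)
  then have s0: "(s \<longlongrightarrow> 0) (at t within {0..})" by simp
  have "(b \<longlongrightarrow> 72 * 0 * (2 + 4096 * (\<Sum>i\<in>UNIV. (norm (Dg i t))\<^sup>2) ^ 3 + (norm (N t))\<^sup>2)) (at t within {0..})"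
    unfolding b_def by (intro tendsto_intros D s0)
  then have b0: "((\<lambda>r. sqrt (b r)) \<longlongrightarrow> 0) (at t within {0..})"
    using tendsto_real_sqrt by fastforce
  have "\<forall>\<^sub>F r in at t within {0..}. norm (N r - N t) \<le> sqrt (b r)"
    unfolding eventually_at_filter
  proof (rule always_eventually, intro allI impI)
    fix r :: real assume rt: "r \<noteq> t" and "r \<in> {0..}"
    then have r: "r \<ge> 0" by simp
    have sp: "s r > 0" using rt by (simp add: s_def add_nonneg_pos sum_nonneg)
    have "(norm (N r - N t))\<^sup>2 \<le> 72 * s r * (2 + (norm (N r))\<^sup>2 + (norm (N t))\<^sup>2)"
      unfolding N_def by (rule cube_diff_bound[OF uH1[OF r] uH1[OF t] sp]) (simp add: s_def Dg_def)
    also have "\<dots> \<le> b r"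
      unfolding b_def using sp norm_N_sq[OF r] by (intro mult_left_mono) auto
    finally show "norm (N r - N t) \<le> sqrt (b r)" by (rule real_le_rsqrt)
  qed
  from Lim_null_comparison[OF this b0] show "(N \<longlongrightarrow> N t) (at t within {0..})" by (simp add: LIM_zero_iff)
qed

lemma continuous_F: "continuous_on {0..} F"
  unfolding F_def[abs_def]
  by (intro continuous_intros continuous_N bounded_linear.continuous_on[OF bounded_linear_Mul[OF alpha] continuous_V])

lemma Gamma_eq: "t \<ge> 0 \<Longrightarrow> \<Gamma> t = (\<integral>x. (u t x) ^ 4 \<partial>lebesgue) / 4"
  by (simp add: \<Gamma>_def U_def N_def inner_mk uL2 cube_L2 uH1) (simp add: power4_eq_xxxx power3_eq_cube mult.assoc)

text \<open>This is convexity of \<open>x\<^sup>4 / 4\<close>. Used in both directions it makes \<open>\<Gamma>\<close> differentiable without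
  any estimate of second-order terms.\<close>

lemma Gamma_convex:
  assumes "s \<ge> 0" "t \<ge> 0"
  shows "N t \<bullet> (U s - U t) \<le> \<Gamma> s - \<Gamma> t"
proof -
  have L: "u s \<in> L2" "u t \<in> L2" "(\<lambda>x. (u s x) ^ 3) \<in> L2" "(\<lambda>x. (u t x) ^ 3) \<in> L2"
    using assms by (auto intro: uL2 cube_L2 uH1)
  have "N t \<bullet> (U s - U t) = (\<integral>x. (u t x) ^ 3 * (u s x - u t x) \<partial>lebesgue)"
    unfolding N_def U_def using L by (simp add: mk_diff[symmetric] inner_mk L2_diff)
  also have "\<dots> \<le> (\<integral>x. (u s x * (u s x) ^ 3) / 4 - (u t x * (u t x) ^ 3) / 4 \<partial>lebesgue)"
  proof (rule integral_mono)
    show "integrable lebesgue (\<lambda>x. (u t x) ^ 3 * (u s x - u t x))" by (intro L2_mult_integrable L2_diff L)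
    show "integrable lebesgue (\<lambda>x. (u s x * (u s x) ^ 3) / 4 - (u t x * (u t x) ^ 3) / 4)"
      by (intro Bochner_Integration.integrable_diff integrable_divide L2_mult_integrable L)
    fix x
    define a b where "a = u t x" and "b = u s x"
    have "b * b ^ 3 - a * a ^ 3 - 4 * (a ^ 3 * (b - a)) = (b - a)\<^sup>2 * ((b + a)\<^sup>2 + 2 * a\<^sup>2)"
      by (simp add: power2_eq_square power3_eq_cube algebra_simps)
    moreover have "0 \<le> (b - a)\<^sup>2 * ((b + a)\<^sup>2 + 2 * a\<^sup>2)" by simp
    ultimately show "(u t x) ^ 3 * (u s x - u t x) \<le> (u s x * (u s x) ^ 3) / 4 - (u t x * (u t x) ^ 3) / 4"
      unfolding a_def b_def by linarith
  qed
  also have "\<dots> = \<Gamma> s - \<Gamma> t"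
    unfolding \<Gamma>_def U_def N_def using L by (simp add: inner_mk L2_mult_integrable)
  finally show ?thesis .
qed

lemma Gamma_derivative:
  assumes t: "t \<ge> 0"
  shows "(\<Gamma> has_real_derivative N t \<bullet> V t) (at t within {0..})"
proof -
  have q: "((\<lambda>s. (U s - U t) /\<^sub>R (s - t)) \<longlongrightarrow> V t) (at t within {0..})"
  proof -
    have lim: "((\<lambda>s. norm (U s - U t - (s - t) *\<^sub>R V t) / norm (s - t)) \<longlongrightarrow> 0) (at t within {0..})"
      using U_derivative[OF t] by (simp add: has_vector_derivative_def has_derivative_iff_norm)
    have "\<forall>\<^sub>F s in at t within {0..}. norm ((U s - U t) /\<^sub>R (s - t) - V t) \<le> norm (U s - U t - (s - t) *\<^sub>R V t) / norm (s - t)"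
      unfolding eventually_at_filter
    proof (rule always_eventually, intro allI impI)
      fix s :: real assume "s \<noteq> t"
      then have "(U s - U t) /\<^sub>R (s - t) - V t = (U s - U t - (s - t) *\<^sub>R V t) /\<^sub>R (s - t)"
        by (simp add: scaleR_diff_right)
      then show "norm ((U s - U t) /\<^sub>R (s - t) - V t) \<le> norm (U s - U t - (s - t) *\<^sub>R V t) / norm (s - t)"
        by (simp add: divide_inverse mult.commute)
    qed
    from Lim_null_comparison[OF this lim] show ?thesis by (simp add: LIM_zero_iff)
  qed
  have Nt: "(N \<longlongrightarrow> N t) (at t within {0..})" using continuous_N t by (auto simp: continuous_on_def)
  have "((\<lambda>s. (\<Gamma> s - \<Gamma> t) / (s - t) - N t \<bullet> ((U s - U t) /\<^sub>R (s - t))) \<longlongrightarrow> 0) (at t within {0..})"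
  proof (rule Lim_null_comparison)
    have "((\<lambda>s. norm (N s - N t) * norm ((U s - U t) /\<^sub>R (s - t))) \<longlongrightarrow> norm (N t - N t) * norm (V t)) (at t within {0..})"
      by (intro tendsto_intros q Nt)
    then show "((\<lambda>s. norm (N s - N t) * norm ((U s - U t) /\<^sub>R (s - t))) \<longlongrightarrow> 0) (at t within {0..})" by simp
    show "\<forall>\<^sub>F s in at t within {0..}. norm ((\<Gamma> s - \<Gamma> t) / (s - t) - N t \<bullet> ((U s - U t) /\<^sub>R (s - t)))
        \<le> norm (N s - N t) * norm ((U s - U t) /\<^sub>R (s - t))"
      unfolding eventually_at_filter
    proof (rule always_eventually, intro allI impI)
      fix s :: real assume st: "s \<noteq> t" and "s \<in> {0..}"
      then have s: "s \<ge> 0" by simp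
      \<comment> \<open>Convexity based at \<open>s\<close> in place of \<open>t\<close> bounds the
        increment from above. The remainder is then a product of two differences; one is of order s
        - t by differentiability of \<open>U\<close>, the other tends to zero by continuity of
        \<open>N\<close>.\<close>
      have "\<Gamma> s - \<Gamma> t \<le> N s \<bullet> (U s - U t)"
        using Gamma_convex[OF t s] by (simp add: inner_diff_right)
      then have "\<bar>\<Gamma> s - \<Gamma> t - N t \<bullet> (U s - U t)\<bar> \<le> (N s - N t) \<bullet> (U s - U t)"
        using Gamma_convex[OF s t] by (simp add: inner_diff_left)
      also have "\<dots> \<le> norm (N s - N t) * norm (U s - U t)" by (rule norm_cauchy_schwarz)
      finally have le: "\<bar>\<Gamma> s - \<Gamma> t - N t \<bullet> (U s - U t)\<bar> / \<bar>s - t\<bar> \<le> norm (N s - N t) * norm (U s - U t) / \<bar>s - t\<bar>"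
        by (rule divide_right_mono) simp
      have eq: "(\<Gamma> s - \<Gamma> t) / (s - t) - N t \<bullet> ((U s - U t) /\<^sub>R (s - t)) = (\<Gamma> s - \<Gamma> t - N t \<bullet> (U s - U t)) / (s - t)"
        by (simp add: divide_inverse algebra_simps)
      have n: "norm ((U s - U t) /\<^sub>R (s - t)) = norm (U s - U t) / \<bar>s - t\<bar>"
        by (simp add: divide_inverse mult.commute)
      show "norm ((\<Gamma> s - \<Gamma> t) / (s - t) - N t \<bullet> ((U s - U t) /\<^sub>R (s - t)))
          \<le> norm (N s - N t) * norm ((U s - U t) /\<^sub>R (s - t))"
        unfolding eq n real_norm_def abs_divide using le by simp
    qed
  qed
  moreover have "((\<lambda>s. N t \<bullet> ((U s - U t) /\<^sub>R (s - t))) \<longlongrightarrow> N t \<bullet> V t) (at t within {0..})"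
    by (intro tendsto_intros q)
  ultimately have "((\<lambda>s. (\<Gamma> s - \<Gamma> t) / (s - t)) \<longlongrightarrow> 0 + N t \<bullet> V t) (at t within {0..})"
    using tendsto_add by fastforce
  then show ?thesis by (simp add: has_field_derivative_iff)
qed

section \<open>The mollified equation and its energy and multiplier functionals\<close>

definition G :: "nat \<Rightarrow> real \<Rightarrow> l2" where "G n t = Lap n (U t) - P n (U t) + P n (F t)"

lemma continuous_G: "continuous_on {0..} (G n)"
  unfolding G_def[abs_def]
  by (intro continuous_intros bounded_linear.continuous_on[OF bounded_linear_P] bounded_linear.continuous_on[OF bounded_linear_Lap]
      continuous_U continuous_F)

text \<open>The test function put into the equation is a mollified truncation. Evenness of the
  kernel and of its second derivatives moves \<open>P n\<close> and \<open>Lap n\<close> from the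
  test function onto the solution.\<close>

lemma PV_weak_derivative:
  assumes t: "t \<ge> 0" and f: "f \<in> L2"
  shows "((\<lambda>s. P n (V s) \<bullet> mk (trunc m f)) has_real_derivative G n t \<bullet> mk (trunc m f)) (at t within {0..})"
proof -
  let ?\<psi> = "trunc m f" and ?\<phi> = "conv (moll n) (trunc m f)"
  have \<psi>: "?\<psi> \<in> L2" by (rule trunc_L2[OF f])
  have \<phi>: "?\<phi> \<in> test_functions" by (rule conv_test[OF moll_test \<psi> trunc_support])
  have \<phi>L: "?\<phi> \<in> L2" by (rule conv_L2(1)[OF moll_test \<psi>])
  let ?rhs = "\<integral>x. u t x * laplace ?\<phi> x + (- (\<alpha> x * ut t x) - u t x + (u t x) ^ 3) * ?\<phi> x \<partial>lebesgue"
  have eq: "((\<lambda>s. \<integral>x. ut s x * ?\<phi> x \<partial>lebesgue) has_real_derivative ?rhs) (at t within {0..})"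
    using sol t \<phi> by (simp add: global_solution_def)
  have lap: "laplace ?\<phi> = (\<lambda>x. \<Sum>i\<in>UNIV. conv (partial i (partial i (moll n))) ?\<psi> x)"
    by (simp add: laplace_def[abs_def] partial_conv moll_test test_partial \<psi>)
  have cL: "conv (partial i (partial i (moll n))) ?\<psi> \<in> L2" for i
    by (intro conv_L2(1) test_partial moll_test \<psi>)
  have lapL: "laplace ?\<phi> \<in> L2" unfolding lap by (intro L2_sum cL)
  have mklap: "mk (laplace ?\<phi>) = Lap n (mk ?\<psi>)"
    unfolding lap Lap_def by (simp add: mk_sum cL Conv_mk test_partial moll_test \<psi>)
  have mk\<phi>: "mk ?\<phi> = P n (mk ?\<psi>)" by (simp add: Conv_mk moll_test \<psi>)
  have FL: "(\<lambda>x. - (\<alpha> x * ut t x) - u t x + (u t x) ^ 3) \<in> L2"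
    by (intro L2_add L2_diff L2_uminus L2_bdd_mult alpha utL2 uL2 cube_L2 uH1 t)
  have "mk (\<lambda>x. - (\<alpha> x * ut t x) - u t x + (u t x) ^ 3) = F t - U t"
    by (simp add: mk_add mk_diff mk_uminus L2_diff L2_uminus L2_bdd_mult alpha utL2 uL2 cube_L2 uH1 t
        F_def N_def U_def V_def Mul_mk)
  then have "?rhs = U t \<bullet> Lap n (mk ?\<psi>) + (F t - U t) \<bullet> P n (mk ?\<psi>)"
    using inner_mk[OF uL2[OF t] lapL] inner_mk[OF FL \<phi>L]
    by (simp add: mklap mk\<phi> L2_mult_integrable[OF uL2[OF t] lapL] L2_mult_integrable[OF FL \<phi>L] U_def)
  also have "\<dots> = G n t \<bullet> mk ?\<psi>"
    by (simp add: G_def Lap_adjoint[symmetric] Conv_adjoint[OF moll_test moll_even, symmetric] inner_add_left inner_diff_left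
        bounded_linear.linear[OF bounded_linear_P, THEN linear_diff])
  finally have rhs: "?rhs = G n t \<bullet> mk ?\<psi>" .
  have lhs: "(\<integral>x. ut s x * ?\<phi> x \<partial>lebesgue) = P n (V s) \<bullet> mk ?\<psi>" if "s \<ge> 0" for s
    using inner_mk[OF utL2[OF that] \<phi>L] by (simp add: mk\<phi> V_def Conv_adjoint[OF moll_test moll_even])
  show ?thesis
    by (rule has_field_derivative_transform_within[OF eq[unfolded rhs], of 1]) (use t in \<open>auto simp: lhs\<close>)
qed

text \<open>The weak derivative \<open>G n\<close> is continuous in norm, so the mean value inequality against a fixed
  function is uniform on the unit ball and the derivative is strong.\<close>

lemma PV_derivative:
  assumes t: "t \<ge> 0"
  shows "((\<lambda>s. P n (V s)) has_vector_derivative G n t) (at t within {0..})"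
  unfolding has_vector_derivative_def has_derivative_within_alt
proof (intro conjI bounded_linear_scaleR_left allI impI)
  fix e :: real assume e: "e > 0"
  obtain d where d: "d > 0" "\<And>r. r \<ge> 0 \<Longrightarrow> dist r t < d \<Longrightarrow> dist (G n r) (G n t) < e"
    using continuous_G[of n] t e unfolding continuous_on_iff by (meson atLeast_iff)
  show "\<exists>d>0. \<forall>s\<in>{0..}. norm (s - t) < d \<longrightarrow> norm (P n (V s) - P n (V t) - (s - t) *\<^sub>R G n t) \<le> e * norm (s - t)"
  proof (intro exI[of _ d] conjI ballI impI)
    fix s :: real assume "s \<in> {0..}" and sd: "norm (s - t) < d"
    then have s: "s \<ge> 0" by simp
    let ?x = "P n (V s) - P n (V t) - (s - t) *\<^sub>R G n t"
    have bound: "\<bar>?x \<bullet> mk (trunc m f)\<bar> \<le> e * \<bar>s - t\<bar> * norm (mk (trunc m f))" if f: "f \<in> L2" for m f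
    proof -
      let ?\<psi> = "mk (trunc m f)"
      let ?S = "{0..} \<inter> ball t d"
      have "norm ((P n (V s) \<bullet> ?\<psi> - s * (G n t \<bullet> ?\<psi>)) - (P n (V t) \<bullet> ?\<psi> - t * (G n t \<bullet> ?\<psi>))) \<le> (e * norm ?\<psi>) * norm (s - t)"
      proof (rule field_differentiable_bound[where S="?S"])
        show "convex ?S" by (intro convex_Int convex_ball) (simp add: convex_real_interval)
        fix r assume r: "r \<in> ?S"
        then have r0: "r \<ge> 0" "dist r t < d" by (auto simp: dist_commute)
        have "((\<lambda>s. P n (V s) \<bullet> ?\<psi>) has_real_derivative G n r \<bullet> ?\<psi>) (at r within ?S)"
          by (rule has_field_derivative_subset[OF PV_weak_derivative[OF r0(1) f]]) auto
        then show "((\<lambda>s. P n (V s) \<bullet> ?\<psi> - s * (G n t \<bullet> ?\<psi>)) has_field_derivative (G n r \<bullet> ?\<psi> - G n t \<bullet> ?\<psi>)) (at r within ?S)"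
          by (auto intro!: derivative_eq_intros)
        have "\<bar>(G n r - G n t) \<bullet> ?\<psi>\<bar> \<le> norm (G n r - G n t) * norm ?\<psi>" by (rule Cauchy_Schwarz_ineq2)
        also have "\<dots> \<le> e * norm ?\<psi>" using d(2)[OF r0] by (intro mult_right_mono) (auto simp: dist_norm)
        finally show "norm (G n r \<bullet> ?\<psi> - G n t \<bullet> ?\<psi>) \<le> e * norm ?\<psi>" by (simp add: inner_diff_left)
      qed (use s t sd d(1) in \<open>auto simp: dist_real_def abs_minus_commute\<close>)
      moreover have "(P n (V s) \<bullet> ?\<psi> - s * (G n t \<bullet> ?\<psi>)) - (P n (V t) \<bullet> ?\<psi> - t * (G n t \<bullet> ?\<psi>)) = ?x \<bullet> ?\<psi>"
        by (simp add: inner_diff_left algebra_simps)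
      ultimately show ?thesis by (simp add: mult_ac)
    qed
    \<comment> \<open>Pairing the remainder with truncations of itself recovers its squared norm.
      The truncation is what makes the mollified function an admissible test function.\<close>
    have lim: "(\<lambda>m. mk (trunc m (rep ?x))) \<longlonglongrightarrow> ?x"
      using trunc_tendsto[OF rep_L2, of ?x] by simp
    have "\<bar>?x \<bullet> ?x\<bar> \<le> e * \<bar>s - t\<bar> * norm ?x"
    proof (rule LIMSEQ_le)
      show "(\<lambda>m. \<bar>?x \<bullet> mk (trunc m (rep ?x))\<bar>) \<longlonglongrightarrow> \<bar>?x \<bullet> ?x\<bar>" by (intro tendsto_intros lim)
      show "(\<lambda>m. e * \<bar>s - t\<bar> * norm (mk (trunc m (rep ?x)))) \<longlonglongrightarrow> e * \<bar>s - t\<bar> * norm ?x" by (intro tendsto_intros lim)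
      show "\<exists>N. \<forall>m\<ge>N. \<bar>?x \<bullet> mk (trunc m (rep ?x))\<bar> \<le> e * \<bar>s - t\<bar> * norm (mk (trunc m (rep ?x)))"
        using bound[OF rep_L2] by blast
    qed
    then have "norm ?x * norm ?x \<le> (e * \<bar>s - t\<bar>) * norm ?x"
      by (simp add: dot_square_norm power2_eq_square)
    then show "norm ?x \<le> e * norm (s - t)"
      using e by (cases "norm ?x = 0") (auto simp: mult_le_cancel_right)
  qed (rule d(1))
qed

lemma Q_U: "t \<ge> 0 \<Longrightarrow> Q n i (U t) = P n (Dg i t)"
  unfolding Q_def U_def Dg_def by (rule Conv_grad[OF moll_test uH1])

text \<open>Only the quadratic part of the energy is mollified. The quartic part
  \<open>\<Gamma>\<close> is differentiable along the solution itself by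
  \<open>Gamma_derivative\<close>.\<close>

definition En :: "nat \<Rightarrow> real \<Rightarrow> real" where
  "En n t = (P n (V t) \<bullet> P n (V t) + P n (U t) \<bullet> P n (U t) + (\<Sum>i\<in>UNIV. Q n i (U t) \<bullet> Q n i (U t))) / 2"

text \<open>The Laplacian and the mass term in \<open>G\<close> cancel the derivatives of the
  gradient and mass parts of \<open>En\<close>, which leaves the power of the forcing.\<close>

lemma En_derivative:
  assumes t: "t \<ge> 0"
  shows "(En n has_real_derivative P n (F t) \<bullet> P n (V t)) (at t within {0..})"
proof -
  have dV: "((\<lambda>s. P n (V s)) has_derivative (\<lambda>h. h *\<^sub>R G n t)) (at t within {0..})"
    using PV_derivative[OF t] by (simp add: has_vector_derivative_def)
  have dU: "((\<lambda>s. B (U s)) has_derivative (\<lambda>h. h *\<^sub>R B (V t))) (at t within {0..})" if "bounded_linear B" for B :: "l2 \<Rightarrow> l2"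
    using bounded_linear.has_vector_derivative[OF that U_derivative[OF t]] by (simp add: has_vector_derivative_def)
  have "(En n has_derivative (\<lambda>h. h * (G n t \<bullet> P n (V t) + P n (U t) \<bullet> P n (V t) + (\<Sum>i\<in>UNIV. Q n i (U t) \<bullet> Q n i (V t))))) (at t within {0..})"
    unfolding En_def[abs_def]
    by (auto intro!: derivative_eq_intros dV dU[OF bounded_linear_P] dU[OF bounded_linear_Q]
        simp: inner_commute fun_eq_iff sum.distrib algebra_simps sum_distrib_left)
  moreover have "G n t \<bullet> P n (V t) + P n (U t) \<bullet> P n (V t) + (\<Sum>i\<in>UNIV. Q n i (U t) \<bullet> Q n i (V t)) = P n (F t) \<bullet> P n (V t)"
    by (simp add: G_def inner_add_left inner_diff_left Lap_inner)
  ultimately show ?thesis by (simp add: has_field_derivative_def mult_commute_abs)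
qed

definition Mn :: "real \<Rightarrow> nat \<Rightarrow> real \<Rightarrow> real" where
  "Mn k n t = P n (V t) \<bullet> Mult k (\<lambda>i. Q n i (U t)) (P n (U t))"

text \<open>Differentiating the second factor gives the multiplier applied to the velocity and hence
  the weight \<open>wv\<close>. Differentiating the first gives the Laplacian and mass terms,
  estimated by \<open>Mult_coercive\<close>, and the forcing. Because of this estimate only an upper
  bound of the derivative is recorded.\<close>

lemma Mn_derivative:
  assumes t: "t \<ge> 0" and k: "k \<ge> 100"
  shows "\<exists>d. (Mn k n has_real_derivative d) (at t within {0..}) \<and>
    d \<le> Mul (wv k) (P n (V t)) \<bullet> P n (V t) - 1 / (8 * k) * ((norm (P n (U t)))\<^sup>2 + (\<Sum>i\<in>UNIV. (norm (P n (Dg i t)))\<^sup>2))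
      + P n (F t) \<bullet> Mult k (\<lambda>i. P n (Dg i t)) (P n (U t))"
proof -
  have k1: "k \<ge> 1" using k by simp
  let ?R = "\<lambda>a. Mult k (\<lambda>i. Q n i a) (P n a)"
  have dV: "((\<lambda>s. P n (V s)) has_derivative (\<lambda>h. h *\<^sub>R G n t)) (at t within {0..})"
    using PV_derivative[OF t] by (simp add: has_vector_derivative_def)
  have dR: "((\<lambda>s. ?R (U s)) has_derivative (\<lambda>h. h *\<^sub>R ?R (V t))) (at t within {0..})"
    using bounded_linear.has_vector_derivative[OF bounded_linear_Mult[OF k1] U_derivative[OF t]] by (simp add: has_vector_derivative_def)
  have "(Mn k n has_derivative (\<lambda>h. h * (P n (V t) \<bullet> ?R (V t) + G n t \<bullet> ?R (U t)))) (at t within {0..})"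
    unfolding Mn_def[abs_def]
    by (rule has_derivative_eq_rhs[OF has_derivative_inner[OF dV dR]]) (simp add: fun_eq_iff algebra_simps)
  then have "(Mn k n has_real_derivative (P n (V t) \<bullet> ?R (V t) + G n t \<bullet> ?R (U t))) (at t within {0..})"
    by (simp add: has_field_derivative_def mult_commute_abs)
  moreover have "P n (V t) \<bullet> ?R (V t) + G n t \<bullet> ?R (U t) \<le>
    Mul (wv k) (P n (V t)) \<bullet> P n (V t) - 1 / (8 * k) * ((norm (P n (U t)))\<^sup>2 + (\<Sum>i\<in>UNIV. (norm (P n (Dg i t)))\<^sup>2))
      + P n (F t) \<bullet> Mult k (\<lambda>i. P n (Dg i t)) (P n (U t))"
    using Mult_coercive[OF k, of n "U t"] Mult_inner_self[OF k1, of n "V t"]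
    by (simp add: G_def inner_add_left Q_U[OF t])
  ultimately show ?thesis by blast
qed

lemma En_limit: "t \<ge> 0 \<Longrightarrow> (\<lambda>n. En n t) \<longlonglongrightarrow> ((norm (V t))\<^sup>2 + H t) / 2"
proof -
  assume t: "t \<ge> 0"
  have "(\<lambda>n. (P n (V t) \<bullet> P n (V t) + P n (U t) \<bullet> P n (U t) + (\<Sum>i\<in>UNIV. P n (Dg i t) \<bullet> P n (Dg i t))) / 2)
    \<longlonglongrightarrow> (V t \<bullet> V t + U t \<bullet> U t + (\<Sum>i\<in>UNIV. Dg i t \<bullet> Dg i t)) / 2"
    by (intro tendsto_intros P_tendsto) auto
  then show ?thesis by (simp add: En_def Q_U[OF t] H_def power2_norm_eq_inner add.assoc)
qed

lemma En_bound: "t \<ge> 0 \<Longrightarrow> \<bar>En n t\<bar> \<le> (norm (V t))\<^sup>2 + H t"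
proof -
  assume t: "t \<ge> 0"
  have "(norm (P n a))\<^sup>2 \<le> (norm a)\<^sup>2" for a by (rule power_mono[OF norm_P_le]) simp
  then have "(norm (P n (V t)))\<^sup>2 + (norm (P n (U t)))\<^sup>2 + (\<Sum>i\<in>UNIV. (norm (P n (Dg i t)))\<^sup>2)
    \<le> (norm (V t))\<^sup>2 + (norm (U t))\<^sup>2 + (\<Sum>i\<in>UNIV. (norm (Dg i t))\<^sup>2)"
    by (intro add_mono sum_mono)
  moreover have "0 \<le> (norm (P n (V t)))\<^sup>2 + (norm (P n (U t)))\<^sup>2 + (\<Sum>i\<in>UNIV. (norm (P n (Dg i t)))\<^sup>2)"
    by (simp add: sum_nonneg)
  ultimately show ?thesis by (simp add: En_def Q_U[OF t] H_def power2_norm_eq_inner)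
qed

lemma continuous_H: "continuous_on {0..} H"
  unfolding H_def[abs_def] by (intro continuous_intros continuous_U continuous_Dg)

lemma continuous_Gamma: "continuous_on {0..} \<Gamma>"
  unfolding \<Gamma>_def[abs_def] by (intro continuous_intros continuous_U continuous_N) auto

lemma continuous_P: "continuous_on S f \<Longrightarrow> continuous_on S (\<lambda>t. P n (f t))"
  by (rule bounded_linear.continuous_on[OF bounded_linear_P])

section \<open>Energy dissipation, the Lyapunov inequality and propagation of smallness\<close>

definition E :: "real \<Rightarrow> real" where "E t = ((norm (V t))\<^sup>2 + H t) / 2 - \<Gamma> t"

text \<open>For fixed \<open>n\<close> the mollified cubic power and the derivative of
  \<open>\<Gamma>\<close> do not cancel. They do in the limit, where the nonnegative dissipation
  remains with a minus sign, so \<open>gronwall_limit\<close> is used with rate 0.\<close>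

lemma energy_inequality:
  assumes "t \<ge> 0" and nonneg: "\<And>a. Mul \<alpha> a \<bullet> a \<ge> 0"
  shows "E t \<le> E 0"
proof -
  let ?Dn = "\<lambda>n t. P n (F t) \<bullet> P n (V t) - N t \<bullet> V t"
  let ?\<beta> = "\<lambda>t. norm (F t) * norm (V t) + norm (N t) * norm (V t) + ((norm (V t))\<^sup>2 + H t + \<bar>\<Gamma> t\<bar>)"
  have H0: "H t \<ge> 0" for t by (simp add: H_def sum_nonneg)
  have "E t \<le> E 0 * exp (- 0 * t)"
  proof (rule gronwall_limit[where Ln="\<lambda>n t. En n t - \<Gamma> t" and Dn="?Dn" and \<beta>="?\<beta>" and D="\<lambda>t. F t \<bullet> V t - N t \<bullet> V t"])
    fix n and t :: real assume t: "t \<ge> 0"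
    show "\<exists>d. ((\<lambda>t. En n t - \<Gamma> t) has_real_derivative d) (at t within {0..}) \<and> d \<le> ?Dn n t"
      using DERIV_diff[OF En_derivative[OF t] Gamma_derivative[OF t]] by blast
    have "\<bar>P n (F t) \<bullet> P n (V t)\<bar> \<le> norm (F t) * norm (V t)"
      by (rule order_trans[OF Cauchy_Schwarz_ineq2]) (intro mult_mono norm_P_le norm_ge_zero)
    moreover have "\<bar>N t \<bullet> V t\<bar> \<le> norm (N t) * norm (V t)" by (rule Cauchy_Schwarz_ineq2)
    ultimately show "\<bar>?Dn n t\<bar> \<le> ?\<beta> t"
      using H0[of t] abs_ge_zero[of "\<Gamma> t"] zero_le_power2[of "norm (V t)"] by linarith
    show "\<bar>En n t - \<Gamma> t\<bar> \<le> ?\<beta> t"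
    proof -
      have "0 \<le> norm (F t) * norm (V t)" "0 \<le> norm (N t) * norm (V t)" by auto
      then show ?thesis using En_bound[OF t, of n] by linarith
    qed
  next
    show "continuous_on {0..} (?Dn n)" for n
      by (intro continuous_intros continuous_P continuous_F continuous_V continuous_N)
    show "continuous_on {0..} ?\<beta>"
      by (intro continuous_intros continuous_F continuous_V continuous_N continuous_H continuous_Gamma)
  next
    fix t :: real assume t: "t \<ge> 0"
    show "(\<lambda>n. En n t - \<Gamma> t) \<longlonglongrightarrow> E t" unfolding E_def by (intro tendsto_intros En_limit t)
    show "(\<lambda>n. ?Dn n t) \<longlonglongrightarrow> F t \<bullet> V t - N t \<bullet> V t" by (intro tendsto_intros P_tendsto)
    show "F t \<bullet> V t - N t \<bullet> V t + 0 * E t \<le> 0" using nonneg[of "V t"] by (simp add: F_def inner_diff_left)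
  qed (rule assms(1))
  then show ?thesis by simp
qed

text \<open>The hypothesis bounds what a formal computation for a smooth solution yields for the
  derivative of the functional, plus \<open>c\<close> times the functional. It is an algebraic
  condition at each time and contains no time derivative. The long majorant in the proof exists to
  justify dominated convergence.\<close>

lemma lyapunov:
  assumes k: "k \<ge> 100" and A: "A \<ge> 0"
    and le: "\<And>t. t \<ge> 0 \<Longrightarrow> - A * (Mul \<alpha> (V t) \<bullet> V t) + Mul (wv k) (V t) \<bullet> V t - 1 / (8 * k) * H t
      + F t \<bullet> Mult k (\<lambda>i. Dg i t) (U t) + c * (A * E t + V t \<bullet> Mult k (\<lambda>i. Dg i t) (U t)) \<le> 0"
    and T: "T \<ge> 0"
  shows "A * E T + V T \<bullet> Mult k (\<lambda>i. Dg i T) (U T) \<le> (A * E 0 + V 0 \<bullet> Mult k (\<lambda>i. Dg i 0) (U 0)) * exp (- c * T)"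
proof -
  have k1: "k \<ge> 1" and k0: "1 / (8 * k) \<ge> 0" "1 / (8 * k) \<le> 1" using k by auto
  obtain M where M: "M \<ge> 1" "\<And>g a. norm (Mult k g a) \<le> M * sqrt ((norm a)\<^sup>2 + (\<Sum>i\<in>UNIV. (norm (g i))\<^sup>2))"
    by (rule Mult_bound[OF k1]) blast
  obtain W where W: "W \<ge> 0" "\<And>a. norm (Mul (wv k) a) \<le> norm a * W"
    using bounded_linear.nonneg_bounded[OF bounded_linear_Mul[OF bdd_weights(3)[OF k1]]] by blast
  let ?R = "\<lambda>n t. Mult k (\<lambda>i. P n (Dg i t)) (P n (U t))"
  let ?Dn = "\<lambda>n t. A * (P n (F t) \<bullet> P n (V t) - N t \<bullet> V t) + (Mul (wv k) (P n (V t)) \<bullet> P n (V t)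
    - 1 / (8 * k) * ((norm (P n (U t)))\<^sup>2 + (\<Sum>i\<in>UNIV. (norm (P n (Dg i t)))\<^sup>2)) + P n (F t) \<bullet> ?R n t)"
  let ?D = "\<lambda>t. A * (F t \<bullet> V t - N t \<bullet> V t) + (Mul (wv k) (V t) \<bullet> V t
    - 1 / (8 * k) * ((norm (U t))\<^sup>2 + (\<Sum>i\<in>UNIV. (norm (Dg i t))\<^sup>2)) + F t \<bullet> Mult k (\<lambda>i. Dg i t) (U t))"
  let ?Ln = "\<lambda>n t. A * (En n t - \<Gamma> t) + Mn k n t"
  let ?\<beta> = "\<lambda>t. A * (norm (F t) * norm (V t) + norm (N t) * norm (V t)) + norm (V t) * W * norm (V t) + H t
    + norm (F t) * (M * sqrt (H t)) + A * ((norm (V t))\<^sup>2 + H t + \<bar>\<Gamma> t\<bar>) + norm (V t) * (M * sqrt (H t))"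
  have H0: "H t \<ge> 0" for t by (simp add: H_def sum_nonneg)
  have PH: "(norm (P n (U t)))\<^sup>2 + (\<Sum>i\<in>UNIV. (norm (P n (Dg i t)))\<^sup>2) \<le> H t" for n t
    unfolding H_def by (intro add_mono sum_mono power_mono norm_P_le norm_ge_zero)
  have R: "norm (?R n t) \<le> M * sqrt (H t)" for n t
    by (rule order_trans[OF M(2)], rule mult_left_mono) (use PH M(1) in auto)
  have nn: "0 \<le> A * (norm (F t) * norm (V t) + norm (N t) * norm (V t))" "0 \<le> norm (V t) * W * norm (V t)"
    "0 \<le> norm (F t) * (M * sqrt (H t))" "0 \<le> A * ((norm (V t))\<^sup>2 + H t + \<bar>\<Gamma> t\<bar>)" "0 \<le> norm (V t) * (M * sqrt (H t))" for t
    using A W(1) M(1) H0[of t] by auto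
  have "A * E T + V T \<bullet> Mult k (\<lambda>i. Dg i T) (U T) \<le> (A * E 0 + V 0 \<bullet> Mult k (\<lambda>i. Dg i 0) (U 0)) * exp (- c * T)"
  proof (rule gronwall_limit[where Ln="?Ln" and Dn="?Dn" and \<beta>="?\<beta>" and D="?D"
        and L="\<lambda>t. A * E t + V t \<bullet> Mult k (\<lambda>i. Dg i t) (U t)"])
    fix n and t :: real assume t: "t \<ge> 0"
    obtain d where d: "(Mn k n has_real_derivative d) (at t within {0..})"
      "d \<le> Mul (wv k) (P n (V t)) \<bullet> P n (V t) - 1 / (8 * k) * ((norm (P n (U t)))\<^sup>2 + (\<Sum>i\<in>UNIV. (norm (P n (Dg i t)))\<^sup>2))
      + P n (F t) \<bullet> ?R n t"
      using Mn_derivative[OF t k, of n] by blast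
    show "\<exists>d. (?Ln n has_real_derivative d) (at t within {0..}) \<and> d \<le> ?Dn n t"
      using DERIV_add[OF DERIV_cmult[OF DERIV_diff[OF En_derivative[OF t] Gamma_derivative[OF t]]] d(1), of A n] d(2)
      by (intro exI[of _ "A * (P n (F t) \<bullet> P n (V t) - N t \<bullet> V t) + d"] conjI add_left_mono)
    have "\<bar>P n (F t) \<bullet> P n (V t)\<bar> \<le> norm (F t) * norm (V t)"
      by (rule order_trans[OF Cauchy_Schwarz_ineq2]) (intro mult_mono norm_P_le norm_ge_zero)
    moreover have "\<bar>N t \<bullet> V t\<bar> \<le> norm (N t) * norm (V t)" by (rule Cauchy_Schwarz_ineq2)
    ultimately have "\<bar>P n (F t) \<bullet> P n (V t) - N t \<bullet> V t\<bar> \<le> norm (F t) * norm (V t) + norm (N t) * norm (V t)" by linarith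
    then have b1: "\<bar>A * (P n (F t) \<bullet> P n (V t) - N t \<bullet> V t)\<bar> \<le> A * (norm (F t) * norm (V t) + norm (N t) * norm (V t))"
      unfolding abs_mult using A by (simp add: mult_left_mono)
    have b2: "\<bar>Mul (wv k) (P n (V t)) \<bullet> P n (V t)\<bar> \<le> norm (V t) * W * norm (V t)"
      by (rule order_trans[OF Cauchy_Schwarz_ineq2])
         (intro mult_mono order_trans[OF W(2)] norm_P_le norm_ge_zero mult_right_mono W(1) order_refl mult_nonneg_nonneg)
    have b3: "\<bar>1 / (8 * k) * ((norm (P n (U t)))\<^sup>2 + (\<Sum>i\<in>UNIV. (norm (P n (Dg i t)))\<^sup>2))\<bar> \<le> H t"
    proof -
      have nonneg: "0 \<le> (norm (P n (U t)))\<^sup>2 + (\<Sum>i\<in>UNIV. (norm (P n (Dg i t)))\<^sup>2)" by (simp add: sum_nonneg)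
      have "1 / (8 * k) * ((norm (P n (U t)))\<^sup>2 + (\<Sum>i\<in>UNIV. (norm (P n (Dg i t)))\<^sup>2)) \<le> 1 * H t"
        by (intro mult_mono PH k0 nonneg) auto
      then show ?thesis using mult_nonneg_nonneg[OF k0(1) nonneg] by linarith
    qed
    have b4: "\<bar>P n (F t) \<bullet> ?R n t\<bar> \<le> norm (F t) * (M * sqrt (H t))"
      by (rule order_trans[OF Cauchy_Schwarz_ineq2]) (intro mult_mono norm_P_le R norm_ge_zero)
    show "\<bar>?Dn n t\<bar> \<le> ?\<beta> t"
      using b1 b2 b3 b4 nn[of t] by linarith
    have b5: "\<bar>A * (En n t - \<Gamma> t)\<bar> \<le> A * ((norm (V t))\<^sup>2 + H t + \<bar>\<Gamma> t\<bar>)"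
    proof -
      have "\<bar>En n t - \<Gamma> t\<bar> \<le> (norm (V t))\<^sup>2 + H t + \<bar>\<Gamma> t\<bar>" using En_bound[OF t, of n] by linarith
      then show ?thesis unfolding abs_mult using A by (simp add: mult_left_mono)
    qed
    have b6: "\<bar>Mn k n t\<bar> \<le> norm (V t) * (M * sqrt (H t))"
      unfolding Mn_def Q_U[OF t]
      by (rule order_trans[OF Cauchy_Schwarz_ineq2]) (intro mult_mono norm_P_le R norm_ge_zero)
    show "\<bar>?Ln n t\<bar> \<le> ?\<beta> t"
      using b5 b6 nn[of t] H0[of t] by linarith
  next
    show "continuous_on {0..} (?Dn n)" for n
      by (intro continuous_intros continuous_P continuous_F continuous_V continuous_N continuous_U continuous_Dg
          continuous_on_Mult k1 bounded_linear.continuous_on[OF bounded_linear_Mul[OF bdd_weights(3)[OF k1]]])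
    show "continuous_on {0..} ?\<beta>"
      by (intro continuous_intros continuous_F continuous_V continuous_N continuous_H continuous_Gamma)
  next
    fix t :: real assume t: "t \<ge> 0"
    have "(\<lambda>n. P n (V t) \<bullet> ?R n t) \<longlonglongrightarrow> V t \<bullet> Mult k (\<lambda>i. Dg i t) (U t)"
      by (intro tendsto_intros P_tendsto tendsto_Mult k1)
    then have "(\<lambda>n. Mn k n t) \<longlonglongrightarrow> V t \<bullet> Mult k (\<lambda>i. Dg i t) (U t)"
      by (simp add: Mn_def Q_U[OF t])
    then show "(\<lambda>n. ?Ln n t) \<longlonglongrightarrow> A * E t + V t \<bullet> Mult k (\<lambda>i. Dg i t) (U t)"
      unfolding E_def by (intro tendsto_intros En_limit t)
    show "(\<lambda>n. ?Dn n t) \<longlonglongrightarrow> ?D t"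
      by (intro tendsto_intros P_tendsto tendsto_Mult k1 bounded_linear.tendsto[OF bounded_linear_Mul[OF bdd_weights(3)[OF k1]]])
    show "?D t + c * (A * E t + V t \<bullet> Mult k (\<lambda>i. Dg i t) (U t)) \<le> 0"
      using le[OF t] by (simp add: F_def[of t] inner_diff_left H_def)
  qed (rule T)
  then show ?thesis .
qed

lemma energy_eq:
  assumes t: "t \<ge> 0"
  shows "energy (u t) (ut t) = E t"
proof -
  have g: "weak_gradient (u t) \<in> L2" by (rule H1_weak_gradient(1)[OF uH1[OF t]])
  have int: "integrable lebesgue (\<lambda>x. (ut t x)\<^sup>2)" "integrable lebesgue (\<lambda>x. (u t x)\<^sup>2)"
    "integrable lebesgue (\<lambda>x. (norm (weak_gradient (u t) x))\<^sup>2)"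
    using L2_integrable_sq[OF utL2[OF t]] L2_integrable_sq[OF uL2[OF t]] g by (auto simp: L2_def)
  have int4: "integrable lebesgue (\<lambda>x. (u t x) ^ 4)"
    using L2_mult_integrable[OF uL2[OF t] cube_L2[OF uH1[OF t]]] by (simp add: power4_eq_xxxx power3_eq_cube mult.assoc)
  have "(\<integral>x. (norm (weak_gradient (u t) x))\<^sup>2 \<partial>lebesgue) = (\<Sum>i\<in>UNIV. (norm (Dg i t))\<^sup>2)"
    using L2_norm_sq_components[OF g] by (simp add: L2_norm_def Dg_def grad_def)
  then show ?thesis
    unfolding energy_def E_def Gamma_eq[OF t] H_def using int int4
    by (simp add: U_def V_def norm_mk_sq uL2 utL2 t)
qed

text \<open>The constant 64 is the square root of the Sobolev constant 4096, and 16 is a quarter of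
  it. Both bounds are of higher than quadratic order in the norm or its product with the multiplier,
  which is why smallness helps.\<close>

lemma Gamma_bounds:
  assumes t: "t \<ge> 0"
  shows "0 \<le> \<Gamma> t" "norm (N t) \<le> 64 * H t * sqrt (H t)" "\<Gamma> t \<le> 16 * (H t)\<^sup>2"
proof -
  show "0 \<le> \<Gamma> t" unfolding Gamma_eq[OF t] by simp
  have H0: "H t \<ge> 0" by (simp add: H_def sum_nonneg)
  show N: "norm (N t) \<le> 64 * H t * sqrt (H t)"
  proof (rule power2_le_imp_le)
    have "(norm (N t))\<^sup>2 \<le> 4096 * (\<Sum>i\<in>UNIV. (norm (Dg i t))\<^sup>2) ^ 3" by (rule norm_N_sq[OF t])
    also have "\<dots> \<le> 4096 * (H t) ^ 3"
      by (intro mult_left_mono power_mono) (auto simp: H_def sum_nonneg)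
    also have "\<dots> = (64 * H t * sqrt (H t))\<^sup>2" using H0 by (simp add: power_mult_distrib power2_eq_square power3_eq_cube)
    finally show "(norm (N t))\<^sup>2 \<le> (64 * H t * sqrt (H t))\<^sup>2" .
  qed (use H0 in auto)
  have "norm (U t) \<le> sqrt (H t)" by (rule real_le_rsqrt) (simp add: H_def sum_nonneg)
  then have "norm (U t) * norm (N t) \<le> sqrt (H t) * (64 * H t * sqrt (H t))"
    using N by (intro mult_mono) (use H0 in auto)
  moreover have "sqrt (H t) * (64 * H t * sqrt (H t)) = 64 * (H t)\<^sup>2"
  proof -
    have "sqrt (H t) * (64 * H t * sqrt (H t)) = 64 * H t * (sqrt (H t) * sqrt (H t))" by (simp only: mult_ac)
    then show ?thesis using H0 by (simp add: power2_eq_square)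
  qed
  moreover have "U t \<bullet> N t \<le> norm (U t) * norm (N t)" by (rule norm_cauchy_schwarz)
  ultimately show "\<Gamma> t \<le> 16 * (H t)\<^sup>2" by (simp add: \<Gamma>_def)
qed

lemma initial_norm:
  assumes u0: "u0 \<in> H1" and u1: "u1 \<in> L2"
  shows "(energy_space_norm u0 u1)\<^sup>2 = (norm (V 0))\<^sup>2 + H 0"
proof -
  have ae: "AE x in lebesgue. u 0 x = u0 x" "AE x in lebesgue. ut 0 x = u1 x"
    using sol by (auto simp: global_solution_def)
  have U: "U 0 = mk u0" and V: "V 0 = mk u1"
    unfolding U_def V_def by (auto intro: mk_cong ae uL2 utL2 H1_L2 u0 u1)
  \<comment> \<open>\<open>u 0\<close> and \<open>u0\<close> agree only almost everywhere, so their
    chosen weak gradients may be different functions. They are compared through mollification, which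
    depends on the class alone.\<close>
  have "P n (grad i (u 0)) = P n (grad i u0)" for n i
    using U by (simp add: Conv_grad[OF moll_test, symmetric] uH1 u0 U_def)
  then have "(\<lambda>n. P n (grad i u0)) \<longlonglongrightarrow> grad i (u 0)" for i
    using P_tendsto[of "grad i (u 0)"] by simp
  then have "grad i (u 0) = grad i u0" for i
    using LIMSEQ_unique[OF _ P_tendsto] by blast
  then have "H 0 = (H1_norm u0)\<^sup>2" by (simp add: H_def U Dg_def H1_norm_sq[OF u0])
  then show ?thesis using norm_mk[OF u1] by (simp add: energy_space_norm_def V)
qed

text \<open>A continuity argument with threshold 1 / 64: up to this size the quartic term, at most
  \<open>16 * (H t)\<^sup>2\<close>, takes no more than a quarter of the squared norm, so the energy
  controls the norm and its decrease gives a value below \<open>2 * \<epsilon>\<close>. As this is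
  at most the threshold, the threshold itself is never attained, and the intermediate value theorem
  excludes crossing it.\<close>

lemma bootstrap:
  assumes nonneg: "\<And>a. Mul \<alpha> a \<bullet> a \<ge> 0" and small: "(norm (V 0))\<^sup>2 + H 0 < \<epsilon>" "2 * \<epsilon> \<le> 1 / 64"
    and t: "t \<ge> 0"
  shows "(norm (V t))\<^sup>2 + H t < 2 * \<epsilon>" "((norm (V t))\<^sup>2 + H t) / 4 \<le> E t" "E t \<le> ((norm (V t))\<^sup>2 + H t) / 2"
proof -
  define n where "n t = (norm (V t))\<^sup>2 + H t" for t
  have H0: "H t \<ge> 0" for t by (simp add: H_def sum_nonneg)
  have n0: "n t \<ge> 0" "H t \<le> n t" for t using H0[of t] by (auto simp: n_def)
  have up: "E t \<le> n t / 2" if "t \<ge> 0" for t using Gamma_bounds(1)[OF that] unfolding E_def n_def by linarith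
  have low: "n t / 4 \<le> E t" if "t \<ge> 0" "n t \<le> 1 / 64" for t
  proof -
    have "(H t)\<^sup>2 \<le> n t * n t" unfolding power2_eq_square using n0[of t] H0[of t] by (intro mult_mono) auto
    also have "\<dots> \<le> 1 / 64 * n t" using that(2) n0 by (intro mult_right_mono) auto
    finally show ?thesis using Gamma_bounds(3)[OF that(1)] unfolding E_def n_def by linarith
  qed
  have key: "n t < 2 * \<epsilon>" if "t \<ge> 0" "n t \<le> 1 / 64" for t
  proof -
    have "n t / 4 \<le> E t" by (rule low[OF that])
    also have "\<dots> \<le> E 0" by (rule energy_inequality[OF that(1) nonneg])
    also have "\<dots> \<le> n 0 / 2" by (rule up) simp
    finally show ?thesis using small(1) by (simp add: n_def)
  qed
  have cont: "continuous_on {0..} n"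
    unfolding n_def[abs_def] by (intro continuous_intros continuous_V continuous_H)
  have "n t \<le> 1 / 64"
  proof (rule ccontr)
    assume "\<not> n t \<le> 1 / 64"
    moreover have "n 0 \<le> 1 / 64" using small n0(1)[of 0] by (simp add: n_def)
    ultimately have "\<exists>s\<ge>0. s \<le> t \<and> n s = 1 / 64"
      using t by (intro IVT' continuous_on_subset[OF cont]) auto
    then obtain s where "s \<ge> 0" "n s = 1 / 64" by blast
    then show False using key[of s] small(2) by simp
  qed
  then show "(norm (V t))\<^sup>2 + H t < 2 * \<epsilon>" "((norm (V t))\<^sup>2 + H t) / 4 \<le> E t" "E t \<le> ((norm (V t))\<^sup>2 + H t) / 2"
    using key[OF t] low[OF t] up[OF t] by (auto simp: n_def)
qed

end

text \<open>On the ball 1 - \<theta> is at most R^2 / k^2, hence at most 1 / (32 k) once k is at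
  least 32 R^2. That is half of the constant subtracted in \<open>wv\<close>.\<close>

lemma wv_le:
  assumes k: "k \<ge> 100" "k \<ge> 32 * R\<^sup>2" and "norm x \<le> R"
  shows "wv k x \<le> - 1 / (32 * k)"
proof -
  have k0: "k > 0" using k by simp
  have x: "x \<bullet> x \<le> R\<^sup>2" using power_mono[OF assms(3), of 2] by (simp add: power2_norm_eq_inner)
  have p: "k\<^sup>2 + x \<bullet> x > 0" using k0 by (simp add: add_pos_nonneg)
  have "1 - th k x = (x \<bullet> x) / (k\<^sup>2 + x \<bullet> x)" using p by (simp add: th_def field_simps)
  also have "\<dots> \<le> R\<^sup>2 / k\<^sup>2" using k0 x by (intro frac_le) auto
  also have "\<dots> \<le> (k / 32) / k\<^sup>2" using k(2) by (intro divide_right_mono) auto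
  also have "\<dots> = 1 / (32 * k)" using k0 by (simp add: power2_eq_square)
  finally have "1 - th k x \<le> 1 / (32 * k)" .
  moreover have "1 / (16 * k) = 2 * (1 / (32 * k))" by simp
  ultimately show ?thesis unfolding wv_def by linarith
qed

theorem theorem1p3:
  fixes \<alpha> :: "real ^ 3 \<Rightarrow> real" and \<Lambda>0 \<Lambda>1 R :: real
  assumes "\<Lambda>0 > 0" and "\<Lambda>1 > 0" and "R > 0"
    and "\<alpha> \<in> Linf"
    and "AE x in lebesgue. \<alpha> x \<ge> 0"
    and "AE x in lebesgue. x \<notin> ball 0 R \<longrightarrow> \<Lambda>0 \<le> \<alpha> x \<and> \<alpha> x \<le> \<Lambda>1"
  shows "\<exists>\<epsilon>>0. \<forall>u0 u1 u ut.
           global_solution \<alpha> u0 u1 u ut \<and> (u0, u1) \<in> PS_plus \<and> energy_space_norm u0 u1 < \<epsilon> \<longrightarrow>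
           (\<exists>C>0. \<exists>\<gamma>>0. \<forall>t\<ge>0. energy (u t) (ut t) \<le> C * exp (- \<gamma> * t))"
proof -
  have alpha: "bdd_measurable \<alpha>" using assms(4) by (simp add: Linf_def bdd_measurable_def)
  obtain c0 where c0: "AE x in lebesgue. \<bar>\<alpha> x\<bar> \<le> c0" using assms(4) by (auto simp: Linf_def)
  \<comment> \<open>The essential bound over the whole space is used, since
    \<open>\<Lambda>1\<close> says nothing about \<alpha> inside the ball.\<close>
  define B where "B = max c0 1"
  have B: "B > 0" "AE x in lebesgue. \<alpha> x \<le> B" using c0 by (auto simp: B_def)
  define k where "k = max 100 (32 * R\<^sup>2)"
  have k: "k \<ge> 100" "k \<ge> 32 * R\<^sup>2" by (auto simp: k_def)
  have k1: "k \<ge> 1" and k0: "k > 0" using k(1) by auto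
  obtain M where M: "M \<ge> 1" "\<And>g a. norm (Mult k g a) \<le> M * sqrt ((norm a)\<^sup>2 + (\<Sum>i\<in>UNIV. (norm (g i))\<^sup>2))"
    by (rule Mult_bound[OF k1]) blast
  define c8 where "c8 = 1 / (8 * k)"
  have c8: "c8 > 0" using k0 by (simp add: c8_def)
  \<comment> \<open>The first summand pays for the positive part of \<open>wv\<close> outside the
    ball, the second for the cross term of damping and multiplier. The third makes the functional
    dominate the energy: \<open>4 * M + 2\<close> times a quarter of the squared norm is
    \<open>M\<close> times it, which covers the multiplier functional, plus half of it, which is at
    least the energy.\<close>
  define A where "A = 2 / \<Lambda>0 + M\<^sup>2 * B / c8 + 4 * M + 2"
  have Age: "A \<ge> 2 / \<Lambda>0 + M\<^sup>2 * B / c8" "A \<ge> 4 * M + 2" and A0: "A > 0"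
    using M(1) B(1) c8 assms(1) by (auto simp: A_def add_pos_pos add_nonneg_pos)
  \<comment> \<open>The first entry is the threshold of \<open>bootstrap\<close>. The second limits
    the cubic term, whose bound carries the factor \<open>64 * M\<close> and the squared norm
    \<open>2 * e\<close>, to a quarter of the coercivity constant.\<close>
  define e where "e = min (1 / 128) (c8 / (512 * M))"
  have e: "e > 0" "2 * e \<le> 1 / 64" "2 * e * (64 * M) \<le> c8 / 4"
  proof -
    show "e > 0" using c8 M(1) by (simp add: e_def)
    show "2 * e \<le> 1 / 64" by (simp add: e_def)
    have "2 * e * (64 * M) \<le> 2 * (c8 / (512 * M)) * (64 * M)"
      using M(1) by (intro mult_right_mono mult_left_mono) (auto simp: e_def)
    also have "\<dots> = c8 / 4" using M(1) by simp
    finally show "2 * e * (64 * M) \<le> c8 / 4" .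
  qed
  \<comment> \<open>\<open>A / 2 + M\<close> compares the functional with the squared norm from
    above, and \<open>1 / (32 * k)\<close> is the rate at which the squared norm is
    consumed.\<close>
  define \<gamma> where "\<gamma> = 1 / (32 * k * (A / 2 + M))"
  have AM: "A / 2 + M > 0" using A0 M(1) by simp
  have \<gamma>: "\<gamma> > 0" using AM k0 by (simp add: \<gamma>_def)
  have nonneg: "Mul \<alpha> a \<bullet> a \<ge> 0" for a
    unfolding Mul_inner_rep[OF alpha]
    by (rule integral_nonneg_AE) (use assms(5) in eventually_elim, simp)
  \<comment> \<open>Pointwise this is \<alpha>^2 \<le> B \<alpha>, so the damping force is
    controlled by the dissipation it causes.\<close>
  have sq: "(norm (Mul \<alpha> a))\<^sup>2 \<le> B * (Mul \<alpha> a \<bullet> a)" for a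
  proof -
    have "(norm (Mul \<alpha> a))\<^sup>2 = (\<integral>x. (\<alpha> x * rep a x)\<^sup>2 \<partial>lebesgue)"
      unfolding Mul_def by (rule norm_mk_sq) (auto intro: L2_bdd_mult alpha)
    also have "\<dots> \<le> (\<integral>x. B * (\<alpha> x * (rep a x)\<^sup>2) \<partial>lebesgue)"
    proof (rule integral_mono_AE)
      show "integrable lebesgue (\<lambda>x. (\<alpha> x * rep a x)\<^sup>2)" by (intro L2_integrable_sq L2_bdd_mult alpha rep_L2)
      show "integrable lebesgue (\<lambda>x. B * (\<alpha> x * (rep a x)\<^sup>2))" by (intro integrable_mult_right Mul_sq_integrable alpha)
      show "AE x in lebesgue. (\<alpha> x * rep a x)\<^sup>2 \<le> B * (\<alpha> x * (rep a x)\<^sup>2)"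
        using assms(5) B(2)
      proof eventually_elim
        case (elim x)
        then have "\<alpha> x * (\<alpha> x * (rep a x)\<^sup>2) \<le> B * (\<alpha> x * (rep a x)\<^sup>2)" by (intro mult_right_mono) auto
        then show ?case by (simp add: power2_eq_square mult_ac)
      qed
    qed
    finally show ?thesis by (simp add: Mul_inner_rep[OF alpha])
  qed
  \<comment> \<open>Inside the ball the weight is negative by the choice of \<open>k\<close>.
    Outside, where it may be as large as 1, the damping satisfies 2 \<alpha> / \<Lambda>0 \<ge> 2,
    which covers the weight and \<open>1 / (32 * k)\<close> together.\<close>
  have weight: "Mul (wv k) a \<bullet> a \<le> - (1 / (32 * k)) * (norm a)\<^sup>2 + 2 / \<Lambda>0 * (Mul \<alpha> a \<bullet> a)" for a
  proof -
    have "Mul (wv k) a \<bullet> a \<le> (\<integral>x. - (1 / (32 * k)) * (rep a x)\<^sup>2 + 2 / \<Lambda>0 * (\<alpha> x * (rep a x)\<^sup>2) \<partial>lebesgue)"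
      unfolding Mul_inner_rep[OF bdd_weights(3)[OF k1]]
    proof (rule integral_mono_AE)
      show "integrable lebesgue (\<lambda>x. wv k x * (rep a x)\<^sup>2)" by (rule Mul_sq_integrable[OF bdd_weights(3)[OF k1]])
      show "integrable lebesgue (\<lambda>x. - (1 / (32 * k)) * (rep a x)\<^sup>2 + 2 / \<Lambda>0 * (\<alpha> x * (rep a x)\<^sup>2))"
        by (intro Bochner_Integration.integrable_add integrable_mult_right Mul_sq_integrable alpha L2_integrable_sq rep_L2)
      show "AE x in lebesgue. wv k x * (rep a x)\<^sup>2 \<le> - (1 / (32 * k)) * (rep a x)\<^sup>2 + 2 / \<Lambda>0 * (\<alpha> x * (rep a x)\<^sup>2)"
        using assms(5,6)
      proof eventually_elim
        case (elim x)
        have "wv k x \<le> - (1 / (32 * k)) + 2 / \<Lambda>0 * \<alpha> x"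
        proof (cases "x \<in> ball 0 R")
          case True
          then have "wv k x \<le> - (1 / (32 * k))" using wv_le[OF k, of x] by simp
          moreover have "0 \<le> 2 / \<Lambda>0 * \<alpha> x" using elim(1) assms(1) by simp
          ultimately show ?thesis by linarith
        next
          case False
          then have "\<Lambda>0 \<le> \<alpha> x" using elim(2) by simp
          then have "2 \<le> 2 / \<Lambda>0 * \<alpha> x" using assms(1) by (simp add: field_simps)
          moreover have "wv k x \<le> 1"
          proof -
            have "0 \<le> 1 / (16 * k)" using k0 by simp
            then show ?thesis unfolding wv_def using th_bounds(1)[OF k0, of x] by linarith
          qed
          moreover have "1 / (32 * k) \<le> 1" using k1 by simp
          ultimately show ?thesis by linarith
        qed
        from mult_right_mono[OF this, of "(rep a x)\<^sup>2"] show ?case by (simp add: algebra_simps)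
      qed
    qed
    also have "\<dots> = - (1 / (32 * k)) * (norm a)\<^sup>2 + 2 / \<Lambda>0 * (Mul \<alpha> a \<bullet> a)"
      using norm_mk_sq[OF rep_L2, of a] Mul_sq_integrable[OF alpha, of a] L2_integrable_sq[OF rep_L2, of a]
      by (simp add: Mul_inner_rep[OF alpha])
    finally show ?thesis .
  qed
  show ?thesis
  \<comment> \<open>\<open>e\<close> limits the squared norm, hence the square root as the
    radius.\<close>
  proof (rule exI[of _ "sqrt e"], intro conjI allI impI)
    show "sqrt e > 0" using e by simp
    fix u0 u1 u ut
    assume h: "global_solution \<alpha> u0 u1 u ut \<and> (u0, u1) \<in> PS_plus \<and> energy_space_norm u0 u1 < sqrt e"
    interpret damped_wave \<alpha> u0 u1 u ut using h alpha by unfold_locales auto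
    have "(energy_space_norm u0 u1)\<^sup>2 < (sqrt e)\<^sup>2"
      using h by (intro power_strict_mono) (auto simp: energy_space_norm_def)
    then have small: "(norm (V 0))\<^sup>2 + H 0 < e"
      using initial_norm h e(1) by (auto simp: PS_plus_def)
    define n where "n t = (norm (V t))\<^sup>2 + H t" for t
    define L where "L t = A * E t + V t \<bullet> Mult k (\<lambda>i. Dg i t) (U t)" for t
    note boot = bootstrap[OF nonneg small e(2), folded n_def]
    have H0: "H t \<ge> 0" for t by (simp add: H_def sum_nonneg)
    have Mu: "norm (Mult k (\<lambda>i. Dg i t) (U t)) \<le> M * sqrt (H t)" for t
      using M(2)[of "\<lambda>i. Dg i t" "U t"] by (simp add: H_def)
    have cross: "\<bar>V t \<bullet> Mult k (\<lambda>i. Dg i t) (U t)\<bar> \<le> M * n t" for t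
    proof -
      have "\<bar>V t \<bullet> Mult k (\<lambda>i. Dg i t) (U t)\<bar> \<le> norm (V t) * (M * sqrt (H t))"
        by (rule order_trans[OF Cauchy_Schwarz_ineq2 mult_left_mono[OF Mu]]) simp
      also have "\<dots> = M * (norm (V t) * sqrt (H t))" by simp
      also have "\<dots> \<le> M * n t"
      proof (rule mult_left_mono)
        have "2 * (norm (V t) * sqrt (H t)) \<le> n t"
          using sum_squares_bound[of "norm (V t)" "sqrt (H t)"] H0[of t] by (simp add: n_def mult.assoc)
        moreover have "0 \<le> norm (V t) * sqrt (H t)" using H0[of t] by simp
        ultimately show "norm (V t) * sqrt (H t) \<le> n t" by linarith
      qed (use M(1) in simp)
      finally show ?thesis .
    qed
    have nn: "n t \<ge> 0" for t using H0[of t] by (simp add: n_def)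
    have Lup: "L t \<le> (A / 2 + M) * n t" if "t \<ge> 0" for t
    proof -
      have "A * E t \<le> A * (n t / 2)" using boot(3)[OF that] A0 by (intro mult_left_mono) auto
      then show ?thesis using cross[of t] by (simp add: L_def algebra_simps abs_le_iff)
    qed
    have Llow: "E t \<le> L t" if "t \<ge> 0" for t
    proof -
      have "(4 * M + 2) * (n t / 4) \<le> A * E t"
        using boot(2)[OF that] Age(2) A0 nn M(1) by (intro mult_mono) auto
      then show ?thesis using cross[of t] boot(3)[OF that] by (simp add: L_def algebra_simps abs_le_iff)
    qed
    have decay: "L t \<le> L 0 * exp (- \<gamma> * t)" if t: "t \<ge> 0" for t
      unfolding L_def
    proof (rule lyapunov[OF k(1) _ _ t])
      show "A \<ge> 0" using A0 by simp
      fix s :: real assume s: "s \<ge> 0"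
      define a where "a = Mul \<alpha> (V s) \<bullet> V s"
      let ?R = "Mult k (\<lambda>i. Dg i s) (U s)"
      have a0: "a \<ge> 0" unfolding a_def by (rule nonneg)
      have Hs: "H s \<le> 2 * e" using boot(1)[OF s] zero_le_power2[of "norm (V s)"] unfolding n_def by linarith
      have sH: "sqrt (H s) * sqrt (H s) = H s" using H0[of s] by simp
      have b1: "N s \<bullet> ?R \<le> c8 / 4 * H s"
      proof -
        have "N s \<bullet> ?R \<le> norm (N s) * norm ?R" by (rule norm_cauchy_schwarz)
        also have "\<dots> \<le> (64 * H s * sqrt (H s)) * (M * sqrt (H s))"
          using Gamma_bounds(2)[OF s] Mu[of s] H0[of s] by (intro mult_mono) auto
        also have "\<dots> = (H s * (64 * M)) * (sqrt (H s) * sqrt (H s))" by (simp only: mult_ac)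
        also have "\<dots> = (H s * (64 * M)) * H s" by (simp only: sH)
        also have "\<dots> \<le> c8 / 4 * H s"
        proof (rule mult_right_mono[OF _ H0])
          have "H s * (64 * M) \<le> 2 * e * (64 * M)" using Hs M(1) by (intro mult_right_mono) auto
          then show "H s * (64 * M) \<le> c8 / 4" using e(3) by linarith
        qed
        finally show ?thesis .
      qed
      have b2: "- (Mul \<alpha> (V s) \<bullet> ?R) \<le> c8 / 4 * H s + M\<^sup>2 * B / c8 * a"
      proof -
        let ?m = "norm (Mul \<alpha> (V s))"
        have "- (Mul \<alpha> (V s) \<bullet> ?R) \<le> ?m * norm ?R"
          using Cauchy_Schwarz_ineq2[of "Mul \<alpha> (V s)" ?R] by linarith
        also have "\<dots> \<le> ?m * (M * sqrt (H s))" by (intro mult_left_mono Mu) simp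
        also have "\<dots> \<le> c8 / 4 * H s + M\<^sup>2 / c8 * ?m\<^sup>2"
        proof -
          \<comment> \<open>Young's inequality, weighted so that exactly a quarter of
            \<open>c8 * H s\<close> is spent.\<close>
          have "0 \<le> (c8 / 2 * sqrt (H s) - M * ?m)\<^sup>2 / c8" using c8 by simp
          also have "\<dots> = c8 / 4 * H s + M\<^sup>2 / c8 * ?m\<^sup>2 - ?m * (M * sqrt (H s))"
          proof -
            have "(c8 / 2 * sqrt (H s) - M * ?m)\<^sup>2 = c8\<^sup>2 / 4 * (sqrt (H s) * sqrt (H s)) - c8 * (?m * (M * sqrt (H s))) + M\<^sup>2 * ?m\<^sup>2"
              by (simp add: power2_eq_square algebra_simps)
            then show ?thesis unfolding sH using c8 by (simp add: field_simps power2_eq_square)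
          qed
          finally show ?thesis by simp
        qed
        also have "M\<^sup>2 / c8 * ?m\<^sup>2 \<le> M\<^sup>2 / c8 * (B * a)"
          unfolding a_def using c8 by (intro mult_left_mono sq) auto
        finally show ?thesis by simp
      qed
      have b3: "Mul (wv k) (V s) \<bullet> V s \<le> - (1 / (32 * k)) * (norm (V s))\<^sup>2 + 2 / \<Lambda>0 * a"
        unfolding a_def by (rule weight)
      have b4: "(2 / \<Lambda>0 + M\<^sup>2 * B / c8) * a \<le> A * a" by (rule mult_right_mono[OF Age(1) a0])
      have b5: "\<gamma> * L s \<le> 1 / (32 * k) * n s"
      proof -
        have "\<gamma> * L s \<le> \<gamma> * ((A / 2 + M) * n s)" using \<gamma> by (intro mult_left_mono Lup s) auto
        also have "\<dots> = 1 / (32 * k) * n s" using AM k0 by (simp add: \<gamma>_def)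
        finally show ?thesis .
      qed
      \<comment> \<open>The coercive term \<open>c8 * H s\<close> is spent in quarters: on the cubic
        term, on the damping cross term and on \<open>\<gamma> * L s\<close>, with one quarter to
        spare. For the velocity, the gain in \<open>b3\<close> matches its share in
        \<open>b5\<close> exactly.\<close>
      have c8k: "1 / (32 * k) = c8 / 4" by (simp add: c8_def)
      have "F s \<bullet> ?R = N s \<bullet> ?R - Mul \<alpha> (V s) \<bullet> ?R" by (simp add: F_def inner_diff_left)
      moreover have "0 \<le> c8 / 4 * H s" using c8 H0[of s] by simp
      ultimately show "- A * (Mul \<alpha> (V s) \<bullet> V s) + Mul (wv k) (V s) \<bullet> V s - 1 / (8 * k) * H s
          + F s \<bullet> ?R + \<gamma> * (A * E s + V s \<bullet> ?R) \<le> 0"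
        using b1 b2 b3 b4 b5 unfolding c8k c8_def[symmetric] a_def[symmetric] L_def[symmetric] n_def
        by (simp add: algebra_simps)
    qed
    show "\<exists>C>0. \<exists>\<gamma>>0. \<forall>t\<ge>0. energy (u t) (ut t) \<le> C * exp (- \<gamma> * t)"
    proof -
      \<comment> \<open>\<open>L 0\<close> vanishes for the zero solution, whereas the constant has
        to be positive.\<close>
      have "energy (u t) (ut t) \<le> (\<bar>L 0\<bar> + 1) * exp (- \<gamma> * t)" if t: "t \<ge> 0" for t
      proof -
        have "energy (u t) (ut t) \<le> L 0 * exp (- \<gamma> * t)"
          using energy_eq[OF t] Llow[OF t] decay[OF t] by simp
        also have "\<dots> \<le> (\<bar>L 0\<bar> + 1) * exp (- \<gamma> * t)" by (intro mult_right_mono) auto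
        finally show ?thesis .
      qed
      moreover have "\<bar>L 0\<bar> + 1 > 0" by simp
      ultimately show ?thesis using \<gamma> by blast
    qed
  qed
qed

end
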